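(* Let $\bullet\in\{*,\mathrm{sh}\}$. For every nonnegative integer $n$ (with the convention $\zeta(1)=0$ and with $\delta_{n,0}$ the Kronecker delta), \[ \zeta_{\mathcal{S}_3}^{\bullet}(\{3,1\}^n)\equiv\delta_{n,0}-2(-4)^{-n}\zeta(4n+1)\,t+2(-4)^{-n}\sum_{n_1,n_2\ge0,\; n_1+n_2=2n}\zeta(2n_1+1)\zeta(2n_2+1)\,t^2\pmod{\pi^2}, \] i.e. for each of $t^0,t^1,t^2$ the coefficients of the two sides differ by an element of $\pi^2\mathcal{Z}$.
   Context: An index is a finite (possibly empty) sequence of positive integers; it is admissible if it is empty or its last component is greater than $1$. $\{a,b\}^n$ denotes the $n$-fold repetition of $a,b$ (e.g. $\{a,b\}^2=(a,b,a,b)$). For an admissible index, $\zeta(k_1,\dots,k_r)=\sum_{1\le n_1<\dots<n_r}\frac{1}{n_1^{k_1}\cdots n_r^{k_r}}$, with $\zeta(\emptyset)=1$. $\mathcal{Z}\subset\mathbb{R}$ is the $\mathbb{Q}$-span of all these values; it is a $\mathbb{Q}$-algebra containing $\pi^2=6\zeta(2)$, and $\pi^2\mathcal{Z}$ is the ideal generated by $\pi^2$. Harmonic regularization $\zeta^*$: on the $\mathbb{Q}$-vector space $\mathcal{I}$ freely generated by all indices, define the bilinear product $*$ by $\boldsymbol{k}*\emptyset=\emptyset*\boldsymbol{k}=\boldsymbol{k}$ and $(\boldsymbol{k},k)*(\boldsymbol{l},l)=(\boldsymbol{k}*(\boldsymbol{l},l),k)+(\boldsymbol{k}*\boldsymbol{l},k+l)+((\boldsymbol{k},k)*\boldsymbol{l},l)$.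 Then $\zeta^*:\mathcal{I}\to\mathbb{R}$ is the unique $\mathbb{Q}$-linear map that is multiplicative for $*$, equals $\zeta$ on admissible indices, and satisfies $\zeta^*(1)=0$. Shuffle regularization $\zeta^{\mathrm{sh}}$: identify the index $(k_1,\dots,k_r)$ with the word $yx^{k_1-1}\cdots yx^{k_r-1}$ in $\mathbb{Q}+y\mathbb{Q}\langle x,y\rangle$, equipped with the shuffle product. Then $\zeta^{\mathrm{sh}}$ is the unique $\mathbb{Q}$-linear map that is multiplicative for the shuffle product, equals $\zeta$ on admissible indices, and satisfies $\zeta^{\mathrm{sh}}(1)=0$. Both maps take values in $\mathcal{Z}$. For $\bullet\in\{*,\mathrm{sh}\}$, an index $(k_1,\dots,k_r)$ and $m\ge0$ put \[\zeta_m^{\bullet}(k_1,\dots,k_r)=\sum_{l_1,\dots,l_r\ge0,\; l_1+\dots+l_r=m}\zeta^{\bullet}(k_1+l_1,\dots,k_r+l_r)\prod_{i=1}^r\binom{k_i+l_i-1}{l_i}\] (so $\zeta_0^\bullet(\emptyset)=1$ and $\zeta_m^\bullet(\emptyset)=0$ for $m\ge1$), and \[\zeta_{\widehat{\mathcal{S}}}^{\bullet}(k_1,\dots,k_r)=\sum_{i=0}^r(-1)^{k_{i+1}+\dots+k_r}\zeta^{\bullet}(k_1,\dots,k_i)\sum_{m\ge0}\zeta_m^{\bullet}(k_r,\dots,k_{i+1})t^m\in\mathcal{Z}[[t]].\] For $m\ge1$, $\zeta_{\mathcal{S}_m}^{\bullet}(\boldsymbol{k})$ is the image of $\zeta_{\widehat{\mathcal{S}}}^{\bullet}(\boldsymbol{k})$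 in $\mathcal{Z}[[t]]/t^m$. On the right-hand side of the claim, $\zeta(k)$ for $k\ge2$ is the Riemann zeta value, and $\zeta(1)$ is interpreted as $0$. *)

theory Defs
  imports
    "HOL-Analysis.Analysis"
    "HOL-Computational_Algebra.Formal_Power_Series"
    "HOL-Library.Poly_Mapping"
begin

definition is_index :: "nat list \<Rightarrow> bool" where
  "is_index ks \<longleftrightarrow> (\<forall>k \<in> set ks. 0 < k)"

definition admissible :: "nat list \<Rightarrow> bool" where
  "admissible ks \<longleftrightarrow> is_index ks \<and> (ks = [] \<or> 1 < last ks)"

definition mzv :: "nat list \<Rightarrow> real" where
  "mzv ks = (\<Sum>\<^sub>\<infinity> ns \<in> {ns :: nat list. length ns = length ks \<and>
                 sorted_wrt (<) ns \<and> (\<forall>n \<in> set ns. 1 \<le> n)}.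
               \<Prod>i<length ks. 1 / real (ns ! i) ^ (ks ! i))"

definition mzv_space :: "real set" where
  "mzv_space = module.span (\<lambda>(q :: rat) (x :: real). of_rat q * x) (mzv ` {ks. admissible ks})"

definition pi2_ideal :: "real set" where
  "pi2_ideal = (\<lambda>z. pi\<^sup>2 * z) ` mzv_space"

definition scaleQ :: "rat \<Rightarrow> ('b \<Rightarrow>\<^sub>0 rat) \<Rightarrow> ('b \<Rightarrow>\<^sub>0 rat)" where
  "scaleQ c p = Poly_Mapping.map ((*) c) p"

definition lin_ext :: "('b \<Rightarrow> 'c) \<Rightarrow> ('b \<Rightarrow>\<^sub>0 rat) \<Rightarrow> ('c \<Rightarrow>\<^sub>0 rat)" where
  "lin_ext g p = (\<Sum>b \<in> Poly_Mapping.keys p. Poly_Mapping.single (g b) (Poly_Mapping.lookup p b))"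

definition bilin_ext ::
  "('b \<Rightarrow> 'b \<Rightarrow> ('b \<Rightarrow>\<^sub>0 rat)) \<Rightarrow> ('b \<Rightarrow>\<^sub>0 rat) \<Rightarrow> ('b \<Rightarrow>\<^sub>0 rat) \<Rightarrow> ('b \<Rightarrow>\<^sub>0 rat)" where
  "bilin_ext m p q = (\<Sum>a \<in> Poly_Mapping.keys p. \<Sum>b \<in> Poly_Mapping.keys q.
     scaleQ (Poly_Mapping.lookup p a * Poly_Mapping.lookup q b) (m a b))"

function harmonic_prod :: "nat list \<Rightarrow> nat list \<Rightarrow> (nat list \<Rightarrow>\<^sub>0 rat)" where
  "harmonic_prod ks [] = Poly_Mapping.single ks 1"
| "harmonic_prod [] (ls @ [l]) = Poly_Mapping.single (ls @ [l]) 1"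
| "harmonic_prod (ks @ [k]) (ls @ [l]) =
     lin_ext (\<lambda>w. w @ [k]) (harmonic_prod ks (ls @ [l]))
   + lin_ext (\<lambda>w. w @ [k + l]) (harmonic_prod ks ls)
   + lin_ext (\<lambda>w. w @ [l]) (harmonic_prod (ks @ [k]) ls)"
  by (auto, metis rev_exhaust)
termination
  by (relation "Wellfounded.measure (\<lambda>(ks, ls). length ks + length ls)") auto

datatype letter = Lx | Ly

fun index_word :: "nat list \<Rightarrow> letter list" where
  "index_word [] = []"
| "index_word (k # ks) = Ly # replicate (k - 1) Lx @ index_word ks"

fun shuffle_prod :: "letter list \<Rightarrow> letter list \<Rightarrow> (letter list \<Rightarrow>\<^sub>0 rat)" where
  "shuffle_prod v [] = Poly_Mapping.single v 1"
| "shuffle_prod [] w = Poly_Mapping.single w 1"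
| "shuffle_prod (a # v) (b # w) =
     lin_ext (Cons a) (shuffle_prod v (b # w)) + lin_ext (Cons b) (shuffle_prod (a # v) w)"

text \<open>
  \<open>B\<close> is a set of basis elements whose span is the algebra in question (all indices, resp. the words
  spanning \<open>\<rat> + y\<rat>\<langle>x,y\<rangle>\<close>), \<open>m\<close> is the product on basis elements, and \<open>e\<close>
  embeds indices into the basis. The map lives on the free vector space over the whole type, so it
  is required to vanish on basis elements outside \<open>B\<close>; this only serves to make it unique as a
  total function.
\<close>

definition is_regularization ::
  "'b set \<Rightarrow> ('b \<Rightarrow> 'b \<Rightarrow> ('b \<Rightarrow>\<^sub>0 rat)) \<Rightarrow> (nat list \<Rightarrow> 'b) \<Rightarrow> (('b \<Rightarrow>\<^sub>0 rat) \<Rightarrow> real) \<Rightarrow> bool" where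
  "is_regularization B m e \<phi> \<longleftrightarrow>
     Vector_Spaces.linear scaleQ (\<lambda>q x. of_rat q * x) \<phi> \<and>
     (\<forall>p q. Poly_Mapping.keys p \<subseteq> B \<longrightarrow> Poly_Mapping.keys q \<subseteq> B \<longrightarrow>
        \<phi> (bilin_ext m p q) = \<phi> p * \<phi> q) \<and>
     (\<forall>ks. admissible ks \<longrightarrow> \<phi> (Poly_Mapping.single (e ks) 1) = mzv ks) \<and>
     \<phi> (Poly_Mapping.single (e [1]) 1) = 0 \<and>
     (\<forall>b. b \<notin> B \<longrightarrow> \<phi> (Poly_Mapping.single b 1) = 0)"

definition harmonic_reg :: "(nat list \<Rightarrow>\<^sub>0 rat) \<Rightarrow> real" where
  "harmonic_reg = (THE \<phi>. is_regularization {ks. is_index ks} harmonic_prod (\<lambda>ks. ks) \<phi>)"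

definition shuffle_reg :: "(letter list \<Rightarrow>\<^sub>0 rat) \<Rightarrow> real" where
  "shuffle_reg = (THE \<phi>. is_regularization {w. w = [] \<or> hd w = Ly} shuffle_prod index_word \<phi>)"

datatype reg = Harmonic | Shuffle

fun zeta_reg :: "reg \<Rightarrow> nat list \<Rightarrow> real" where
  "zeta_reg Harmonic ks = harmonic_reg (Poly_Mapping.single ks 1)"
| "zeta_reg Shuffle ks = shuffle_reg (Poly_Mapping.single (index_word ks) 1)"

definition zeta_shift :: "reg \<Rightarrow> nat \<Rightarrow> nat list \<Rightarrow> real" where
  "zeta_shift b m ks = (\<Sum>ls \<in> {ls. length ls = length ks \<and> sum_list ls = m}.
     zeta_reg b (map2 (+) ks ls) *
     (\<Prod>i<length ks. real ((ks ! i + ls ! i - 1) choose (ls ! i))))"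

definition zeta_Shat :: "reg \<Rightarrow> nat list \<Rightarrow> real fps" where
  "zeta_Shat b ks = (\<Sum>i = 0..length ks.
     fps_const ((-1) ^ sum_list (drop i ks) * zeta_reg b (take i ks)) *
     Abs_fps (\<lambda>m. zeta_shift b m (rev (drop i ks))))"

text \<open>A residue class modulo \<open>t\<^sup>m\<close> is represented by its truncation.\<close>

definition zeta_S :: "nat \<Rightarrow> reg \<Rightarrow> nat list \<Rightarrow> real fps" where
  "zeta_S m b ks = fps_cutoff m (zeta_Shat b ks)"

definition zeta0 :: "nat \<Rightarrow> real" where
  "zeta0 k = (if k = 1 then 0 else suminf (\<lambda>n. 1 / real (Suc n) ^ k))"

end

theory Submission
  imports Defs
begin

text \<open>
  Both regularizations are realized analytically: \<open>\<zeta>\<^sup>*\<close> by truncated sums, as polynomials in the harmonic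
  numbers up to an error smaller than all powers of these, and the shuffle one by polylogarithms at
  \<open>z \<rightarrow> 1\<close>, as polynomials in \<open>- ln (1 - z)\<close>. On indices with at most one trailing 1 the polynomials
  have degree at most one and agree by Abel summation, which reduces the theorem to the shuffle case.

  There, \<open>{3,1}\<close> is the word \<open>yxxy\<close>, and the generating functions of its cyclic prefixes solve a linear
  system of rank four which is the tensor product of two systems of rank two attached to the word \<open>yx\<close>,
  with parameters \<open>a\<close> and \<open>sqrt (-1) * a\<close>. The generating function of the symmetric values is a
  \<open>2 \<times> 2\<close> minor of the fundamental matrix and becomes, by the Wronskians of the two factors, a quadratic
  form in the generating functions of \<open>e\<^sub>n = \<zeta>({2}\<^sup>n)\<close> and \<open>d\<^sub>n = \<zeta>\<^sub>1({2}\<^sup>n)\<close>: up to the factor \<open>(-4)\<^sup>n\<close> the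
  coefficients of \<open>t\<^sup>0\<close>, \<open>t\<^sup>1\<close>, \<open>t\<^sup>2\<close> are the sums of \<open>e\<^sub>i e\<^sub>j\<close>, \<open>e\<^sub>i d\<^sub>j\<close> and \<open>d\<^sub>i d\<^sub>j / 2\<close> over \<open>i + j = 2n\<close>.
  Modulo \<open>\<pi>\<^sup>2\<close> one has \<open>e\<^sub>n = 0\<close> for \<open>n > 0\<close> by the product of the sine, and hence
  \<open>d\<^sub>n = - 2 (-1)\<^sup>n \<zeta>(2n+1)\<close> by a logarithmic derivative.
\<close>

subsection \<open>Linear extension to free vector spaces\<close>

text \<open>Both regularizations are defined by unique existence, so a model must be built before
  any value can be computed. Its errors have to beat every power of the divergent quantity, as
  otherwise a product of two expansions need not be an expansion.

  The binomial sums \<open>zeta_shift\<close> become values of single functions by replacing each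
  n_i by n_i - t, which turns z d/dz into z d/dz - t. Thus the order-m series solve the same system
  with the order-(m-1) series as inhomogeneity; rescaled, they serve as further columns of the
  fundamental matrix. The two halves of a symmetric value are prefixes of powers of
  \<open>yxxy\<close> and, by reversal, of \<open>yyxx\<close>: two starting points in one periodic
  word, hence one system with different initial values.

  The number -4 is the product of the constants -2 and 2 in the tensor product system. At order 0 it
  comes from the shuffle identity of sum a^(2n) (yx)^n with sum (-1)^n a^(2n) (yx)^n, which gives
  sum (-4)^n a^(4n) (yyxx)^n. Only the squares of the two parameters enter, so everything stays
  real.\<close>

definition lin_val :: "('b \<Rightarrow> real) \<Rightarrow> ('b \<Rightarrow>\<^sub>0 rat) \<Rightarrow> real" where
  "lin_val f p = (\<Sum>b\<in>Poly_Mapping.keys p. of_rat (Poly_Mapping.lookup p b) * f b)"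

lemma lin_val_superset:
  assumes "finite A" "Poly_Mapping.keys p \<subseteq> A"
  shows "lin_val f p = (\<Sum>b\<in>A. of_rat (Poly_Mapping.lookup p b) * f b)"
  unfolding lin_val_def
  by (rule sum.mono_neutral_left) (use assms in \<open>auto simp: in_keys_iff\<close>)

lemma lin_val_zero [simp]: "lin_val f 0 = 0"
  by (simp add: lin_val_def)

lemma lin_val_add: "lin_val f (p + q) = lin_val f p + lin_val f q"
proof -
  let ?A = "Poly_Mapping.keys p \<union> Poly_Mapping.keys q"
  have "lin_val f (p + q) = (\<Sum>b\<in>?A. of_rat (Poly_Mapping.lookup (p + q) b) * f b)"
    by (rule lin_val_superset) (use keys_add[of p q] in auto)
  also have "\<dots> = (\<Sum>b\<in>?A. of_rat (Poly_Mapping.lookup p b) * f b)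
                 + (\<Sum>b\<in>?A. of_rat (Poly_Mapping.lookup q b) * f b)"
    by (simp add: lookup_add of_rat_add distrib_right sum.distrib)
  also have "\<dots> = lin_val f p + lin_val f q"
    by (subst (1 2) lin_val_superset[where A = ?A]) auto
  finally show ?thesis .
qed

lemma lin_val_sum: "lin_val f (\<Sum>i\<in>I. p i) = (\<Sum>i\<in>I. lin_val f (p i))"
  by (induction I rule: infinite_finite_induct) (auto simp: lin_val_add)

lemma lookup_scaleQ [simp]: "Poly_Mapping.lookup (scaleQ c p) b = c * Poly_Mapping.lookup p b"
  by (simp add: scaleQ_def map.rep_eq when_def)

lemma keys_scaleQ: "Poly_Mapping.keys (scaleQ c p) \<subseteq> Poly_Mapping.keys p"
  by (auto simp: in_keys_iff)

lemma lin_val_scaleQ: "lin_val f (scaleQ c p) = of_rat c * lin_val f p"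
  by (subst lin_val_superset[OF _ keys_scaleQ])
     (auto simp: of_rat_mult sum_distrib_left lin_val_def mult.assoc)

lemma lin_val_single [simp]: "lin_val f (Poly_Mapping.single b c) = of_rat c * f b"
  by (simp add: lin_val_def)

lemma lin_val_lin_ext: "lin_val f (lin_ext g p) = lin_val (\<lambda>b. f (g b)) p"
  by (simp add: lin_ext_def lin_val_sum) (simp add: lin_val_def)

lemma keys_sum_subset: "Poly_Mapping.keys (\<Sum>i\<in>I. p i) \<subseteq> (\<Union>i\<in>I. Poly_Mapping.keys (p i))"
proof (induction I rule: infinite_finite_induct)
  case (insert x F)
  then show ?case
    using keys_add[of "p x" "sum p F"] by (simp, blast)
qed auto

lemma keys_lin_ext: "Poly_Mapping.keys (lin_ext g p) \<subseteq> g ` Poly_Mapping.keys p"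
proof -
  have "Poly_Mapping.keys (lin_ext g p) \<subseteq>
    (\<Union>b\<in>Poly_Mapping.keys p. Poly_Mapping.keys (Poly_Mapping.single (g b) (Poly_Mapping.lookup p b)))"
    unfolding lin_ext_def by (rule keys_sum_subset)
  then show ?thesis by (auto split: if_splits)
qed

lemma lin_ext_single [simp]:
  "lin_ext g (Poly_Mapping.single b c) = Poly_Mapping.single (g b) c"
  by (cases "c = 0") (auto simp: lin_ext_def)

lemma lin_val_bilin_ext:
  "lin_val f (bilin_ext m p q) = (\<Sum>a\<in>Poly_Mapping.keys p. \<Sum>b\<in>Poly_Mapping.keys q.
     of_rat (Poly_Mapping.lookup p a) * of_rat (Poly_Mapping.lookup q b) * lin_val f (m a b))"
  by (simp add: bilin_ext_def lin_val_sum lin_val_scaleQ of_rat_mult)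

lemma scaleQ_1 [simp]: "scaleQ 1 p = p"
  by (rule poly_mapping_eqI) simp

lemma lin_ext_superset:
  assumes "finite A" "Poly_Mapping.keys p \<subseteq> A"
  shows "lin_ext g p = (\<Sum>b\<in>A. Poly_Mapping.single (g b) (Poly_Mapping.lookup p b))"
  unfolding lin_ext_def
  by (rule sum.mono_neutral_left) (use assms in \<open>auto simp: in_keys_iff\<close>)

lemma lin_ext_add: "lin_ext g (p + q) = lin_ext g p + lin_ext g q"
proof -
  let ?A = "Poly_Mapping.keys p \<union> Poly_Mapping.keys q"
  have "lin_ext g (p + q) = (\<Sum>b\<in>?A. Poly_Mapping.single (g b) (Poly_Mapping.lookup (p + q) b))"
    by (rule lin_ext_superset) (use keys_add[of p q] in auto)
  also have "\<dots> = (\<Sum>b\<in>?A. Poly_Mapping.single (g b) (Poly_Mapping.lookup p b))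
                 + (\<Sum>b\<in>?A. Poly_Mapping.single (g b) (Poly_Mapping.lookup q b))"
    by (simp add: lookup_add single_add sum.distrib)
  also have "\<dots> = lin_ext g p + lin_ext g q"
    by (subst (1 2) lin_ext_superset[where A = ?A]) auto
  finally show ?thesis .
qed

lemma poly_mapping_sum_single:
  "p = (\<Sum>b\<in>Poly_Mapping.keys p. Poly_Mapping.single b (Poly_Mapping.lookup p b))"
proof (rule poly_mapping_eqI)
  fix k
  have "(\<Sum>b\<in>Poly_Mapping.keys p. Poly_Mapping.lookup p b when b = k) = Poly_Mapping.lookup p k"
    by (cases "k \<in> Poly_Mapping.keys p") (auto simp: when_def in_keys_iff sum.delta')
  then show "Poly_Mapping.lookup p k = Poly_Mapping.lookup
      (\<Sum>b\<in>Poly_Mapping.keys p. Poly_Mapping.single b (Poly_Mapping.lookup p b)) k"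
    by (simp add: lookup_sum lookup_single)
qed

lemma lin_ext_lin_ext:
  fixes f :: "'b \<Rightarrow> 'c"
  shows "lin_ext f (lin_ext g p) = lin_ext (\<lambda>b. f (g b)) p"
proof -
  have *: "lin_ext f (\<Sum>i\<in>I. q i) = (\<Sum>i\<in>I. lin_ext f (q i))" for I :: "'a set" and q :: "_ \<Rightarrow> 'b \<Rightarrow>\<^sub>0 rat"
    by (induction I rule: infinite_finite_induct) (auto simp: lin_ext_add, auto simp: lin_ext_def)
  show ?thesis
    by (simp add: lin_ext_def[of g] * lin_ext_def[of "\<lambda>b. f (g b)"])
qed

lemma bilin_ext_single [simp]:
  "bilin_ext m (Poly_Mapping.single a 1) (Poly_Mapping.single b 1) = m a b"
  by (simp add: bilin_ext_def)

lemma vector_space_scaleQ: "vector_space (scaleQ :: rat \<Rightarrow> ('b \<Rightarrow>\<^sub>0 rat) \<Rightarrow> ('b \<Rightarrow>\<^sub>0 rat))"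
  by unfold_locales (auto intro!: poly_mapping_eqI simp: lookup_add algebra_simps)

lemma vector_space_rat_real: "vector_space (\<lambda>(q :: rat) (x :: real). of_rat q * x)"
  by unfold_locales (auto simp: algebra_simps of_rat_add of_rat_mult)

lemma linear_lin_val:
  "Vector_Spaces.linear scaleQ (\<lambda>(q :: rat) (x :: real). of_rat q * x) (lin_val f)"
  using vector_space_scaleQ vector_space_rat_real
  by (auto simp: Vector_Spaces.linear_def module_hom_def module_hom_axioms_def
        module_iff_vector_space lin_val_add lin_val_scaleQ)

lemma linear_eq_lin_val:
  assumes "Vector_Spaces.linear scaleQ (\<lambda>(q :: rat) (x :: real). of_rat q * x) \<phi>"
  shows "\<phi> = lin_val (\<lambda>b. \<phi> (Poly_Mapping.single b 1))"
proof
  fix p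
  interpret Vector_Spaces.linear scaleQ "\<lambda>(q :: rat) (x :: real). of_rat q * x" \<phi> by fact
  have s: "Poly_Mapping.single b c = scaleQ c (Poly_Mapping.single b 1)" for b c
    by (rule poly_mapping_eqI) (auto simp: lookup_single when_def)
  have "\<phi> p = \<phi> (\<Sum>b\<in>Poly_Mapping.keys p. Poly_Mapping.single b (Poly_Mapping.lookup p b))"
    using poly_mapping_sum_single[of p] by simp
  also have "\<dots> = (\<Sum>b\<in>Poly_Mapping.keys p. \<phi> (Poly_Mapping.single b (Poly_Mapping.lookup p b)))"
    by (rule sum)
  also have "\<dots> = (\<Sum>b\<in>Poly_Mapping.keys p. of_rat (Poly_Mapping.lookup p b) * \<phi> (Poly_Mapping.single b 1))"
    by (subst s, subst scale) auto
  finally show "\<phi> p = lin_val (\<lambda>b. \<phi> (Poly_Mapping.single b 1)) p"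
    by (simp add: lin_val_def)
qed

subsection \<open>Regularized limits\<close>

text \<open>Mere convergence to 0 would not survive multiplication by the unbounded
  \<open>l\<close>. Functions of this kind are closed under products with polynomials in
  \<open>l\<close>, which makes \<open>has_reg\<close> compatible with multiplication.\<close>

definition negl :: "'x filter \<Rightarrow> ('x \<Rightarrow> real) \<Rightarrow> ('x \<Rightarrow> real) \<Rightarrow> bool" where
  "negl F l e \<longleftrightarrow> (\<forall>j::nat. ((\<lambda>x. e x * l x ^ j) \<longlongrightarrow> 0) F)"

definition has_reg :: "'x filter \<Rightarrow> ('x \<Rightarrow> real) \<Rightarrow> ('x \<Rightarrow> real) \<Rightarrow> real poly \<Rightarrow> bool" where
  "has_reg F l f Q \<longleftrightarrow> negl F l (\<lambda>x. f x - poly Q (l x))"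

text \<open>Taking the constant term means setting the divergent quantity to 0, in accordance with
  the value 0 that both regularizations give to the index 1.\<close>

definition reg_val :: "'x filter \<Rightarrow> ('x \<Rightarrow> real) \<Rightarrow> ('x \<Rightarrow> real) \<Rightarrow> real" where
  "reg_val F l f = (THE c. \<exists>Q. has_reg F l f Q \<and> c = poly Q 0)"

lemma negl_tendsto: "negl F l e \<Longrightarrow> (e \<longlongrightarrow> 0) F"
  unfolding negl_def by (drule spec[of _ 0]) simp

lemma negl_zero [simp]: "negl F l (\<lambda>_. 0)"
  by (simp add: negl_def)

lemma negl_add: "negl F l e \<Longrightarrow> negl F l e' \<Longrightarrow> negl F l (\<lambda>x. e x + e' x)"
  by (auto simp: negl_def distrib_right intro!: tendsto_add_zero)

lemma negl_mult_poly:
  assumes "negl F l e" shows "negl F l (\<lambda>x. e x * poly P (l x))"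
  unfolding negl_def
proof
  fix j
  have "((\<lambda>x. e x * poly P (l x) * l x ^ j) \<longlongrightarrow> 0) F"
  proof (induction P arbitrary: j)
    case (pCons a P)
    have "((\<lambda>x. a * (e x * l x ^ j) + e x * poly P (l x) * l x ^ Suc j) \<longlongrightarrow> a * 0 + 0) F"
      using assms by (intro tendsto_intros pCons) (auto simp: negl_def)
    then show ?case by (simp add: algebra_simps)
  qed auto
  then show "((\<lambda>x. e x * poly P (l x) * l x ^ j) \<longlongrightarrow> 0) F" .
qed

lemma negl_mult:
  assumes "negl F l e" "negl F l e'" shows "negl F l (\<lambda>x. e x * e' x)"
  unfolding negl_def
proof
  fix j
  have "((\<lambda>x. e x * (e' x * l x ^ j)) \<longlongrightarrow> 0 * 0) F"
    using assms(2) by (intro tendsto_mult negl_tendsto[OF assms(1)]) (auto simp: negl_def)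
  then show "((\<lambda>x. e x * e' x * l x ^ j) \<longlongrightarrow> 0) F" by (simp add: mult.assoc)
qed

lemma negl_cong:
  assumes "eventually (\<lambda>x. e x = e' x) F" "negl F l e" shows "negl F l e'"
  unfolding negl_def
proof
  fix j
  have "eventually (\<lambda>x. e x * l x ^ j = e' x * l x ^ j) F"
    using assms(1) by eventually_elim simp
  moreover have "((\<lambda>x. e x * l x ^ j) \<longlongrightarrow> 0) F"
    using assms(2) by (simp add: negl_def)
  ultimately show "((\<lambda>x. e' x * l x ^ j) \<longlongrightarrow> 0) F"
    by (rule Lim_transform_eventually[rotated])
qed

lemma has_reg_cong:
  assumes "eventually (\<lambda>x. f x = g x) F" "has_reg F l f Q" shows "has_reg F l g Q"
proof -
  have "eventually (\<lambda>x. f x - poly Q (l x) = g x - poly Q (l x)) F"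
    using assms(1) by eventually_elim simp
  then show ?thesis using assms(2) unfolding has_reg_def by (rule negl_cong)
qed

lemma has_reg_const: "has_reg F l (\<lambda>_. c) [:c:]"
  by (simp add: has_reg_def)

lemma has_reg_log: "has_reg F l l [:0, 1:]"
  by (simp add: has_reg_def)

lemma has_reg_add: "has_reg F l f P \<Longrightarrow> has_reg F l g Q \<Longrightarrow> has_reg F l (\<lambda>x. f x + g x) (P + Q)"
  unfolding has_reg_def by (drule (1) negl_add) (simp add: add_diff_add)

lemma has_reg_mult:
  assumes "has_reg F l f P" "has_reg F l g Q" shows "has_reg F l (\<lambda>x. f x * g x) (P * Q)"
proof -
  let ?e = "\<lambda>x. f x - poly P (l x)" and ?e' = "\<lambda>x. g x - poly Q (l x)"
  have "negl F l (\<lambda>x. (?e x * ?e' x + ?e x * poly Q (l x)) + ?e' x * poly P (l x))"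
    using assms by (intro negl_add negl_mult negl_mult_poly) (auto simp: has_reg_def)
  then show ?thesis
    by (simp add: has_reg_def algebra_simps)
qed

lemma has_reg_sum:
  assumes "\<And>i. i \<in> I \<Longrightarrow> has_reg F l (f i) (Q i)"
  shows "has_reg F l (\<lambda>x. \<Sum>i\<in>I. f i x) (\<Sum>i\<in>I. Q i)"
  using assms
proof (induction I rule: infinite_finite_induct)
  case (insert i I)
  then show ?case by (simp add: has_reg_add)
qed (use has_reg_const[of F l 0] in auto)

lemma poly_tendsto_0_imp_0:
  fixes Q :: "real poly"
  assumes "F \<noteq> bot" "filterlim l at_top F" "((\<lambda>x. poly Q (l x)) \<longlongrightarrow> 0) F"
  shows "Q = 0"
proof (cases "degree Q = 0")
  case True
  then obtain c where Q: "Q = [:c:]" by (rule degree_eq_zeroE)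
  then have "((\<lambda>x. c) \<longlongrightarrow> 0) F" using assms(3) by simp
  then have "c = 0" using assms(1) by (simp add: tendsto_const_iff)
  then show ?thesis using Q by simp
next
  case False
  have "filterlim (poly Q) at_infinity at_infinity"
    by (rule filterlim_poly_at_infinity) (use False in simp)
  then have "filterlim (\<lambda>x. poly Q (l x)) at_infinity F"
    by (rule filterlim_compose) (rule filterlim_at_top_imp_at_infinity[OF assms(2)])
  then show ?thesis
    using not_tendsto_and_filterlim_at_infinity[OF assms(1,3)] by blast
qed

lemma has_reg_unique:
  assumes "F \<noteq> bot" "filterlim l at_top F" "has_reg F l f P" "has_reg F l f Q"
  shows "P = Q"
proof -
  have "has_reg F l (\<lambda>x. f x + (- 1) * f x) (P + [:-1:] * Q)"
    by (intro has_reg_add has_reg_mult has_reg_const assms)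
  then have "negl F l (\<lambda>x. - poly (P - Q) (l x))" by (simp add: has_reg_def)
  then have "((\<lambda>x. - (- poly (P - Q) (l x))) \<longlongrightarrow> - 0) F"
    by (intro tendsto_minus negl_tendsto)
  then have "P - Q = 0" by (intro poly_tendsto_0_imp_0[OF assms(1,2)]) simp
  then show ?thesis by simp
qed

lemma reg_val_eq:
  assumes "F \<noteq> bot" "filterlim l at_top F" "has_reg F l f Q"
  shows "reg_val F l f = poly Q 0"
  unfolding reg_val_def
proof (rule the_equality)
  fix c assume "\<exists>Q. has_reg F l f Q \<and> c = poly Q 0"
  then obtain P where P: "has_reg F l f P" "c = poly P 0" by blast
  show "c = poly Q 0" using has_reg_unique[OF assms(1,2) P(1) assms(3)] P(2) by simp
qed (use assms(3) in blast)

text \<open>\<open>\<tau>\<close> counts the trailing ones of an index (the trailing letters \<open>y\<close> of a word), \<open>ap\<close> appends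
  one more, and \<open>T\<close> consists of truncated sums or polylogarithms, with \<open>T (e [1])\<close> as the divergent
  quantity \<open>l\<close>.\<close>

locale regularization =
  fixes B :: "'b set" and m :: "'b \<Rightarrow> 'b \<Rightarrow> ('b \<Rightarrow>\<^sub>0 rat)" and e :: "nat list \<Rightarrow> 'b"
    and \<tau> :: "'b \<Rightarrow> nat" and ap :: "'b \<Rightarrow> 'b"
    and T :: "'b \<Rightarrow> 'x \<Rightarrow> real" and F :: "'x filter" and l :: "'x \<Rightarrow> real"
  assumes nonbot: "F \<noteq> bot" and l_at_top: "filterlim l at_top F"
    and e1: "e [1] \<in> B" and e_in: "\<And>ks. admissible ks \<Longrightarrow> e ks \<in> B"
    and step: "\<And>b. b \<in> B \<Longrightarrow> \<exists>q. m (e [1]) b = Poly_Mapping.single (ap b) (of_nat (Suc (\<tau> b))) + q \<and>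
                 Poly_Mapping.keys q \<subseteq> {c \<in> B. \<tau> c \<le> \<tau> b}"
    and ap_surj: "\<And>c k. c \<in> B \<Longrightarrow> \<tau> c = Suc k \<Longrightarrow> \<exists>b\<in>B. \<tau> b = k \<and> c = ap b"
    and base: "\<And>c. c \<in> B \<Longrightarrow> \<tau> c = 0 \<Longrightarrow> \<exists>ks. admissible ks \<and> c = e ks"
    and keys_m: "\<And>a b. a \<in> B \<Longrightarrow> b \<in> B \<Longrightarrow> Poly_Mapping.keys (m a b) \<subseteq> B"
    and T_mult: "\<And>a b. a \<in> B \<Longrightarrow> b \<in> B \<Longrightarrow>
                   eventually (\<lambda>x. T a x * T b x = lin_val (\<lambda>u. T u x) (m a b)) F"
    and T_e1: "eventually (\<lambda>x. T (e [1]) x = l x) F"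
    and T_adm: "\<And>ks. admissible ks \<Longrightarrow> negl F l (\<lambda>x. T (e ks) x - mzv ks)"
begin

text \<open>The value 0 outside \<open>B\<close> is forced by the last clause of
  \<open>is_regularization\<close>.\<close>

definition reg :: "('b \<Rightarrow>\<^sub>0 rat) \<Rightarrow> real" where
  "reg = lin_val (\<lambda>b. if b \<in> B then reg_val F l (T b) else 0)"

lemma has_reg_e1: "has_reg F l (T (e [1])) [:0, 1:]"
  by (rule has_reg_cong[OF _ has_reg_log]) (use T_e1 in \<open>simp add: eq_commute\<close>)

lemma has_reg_e: "admissible ks \<Longrightarrow> has_reg F l (T (e ks)) [:mzv ks:]"
  using T_adm by (simp add: has_reg_def)

lemma has_reg_lin_val:
  assumes "\<And>b. b \<in> Poly_Mapping.keys p \<Longrightarrow> has_reg F l (T b) (Q b)"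
  shows "has_reg F l (\<lambda>x. lin_val (\<lambda>u. T u x) p)
           (\<Sum>b\<in>Poly_Mapping.keys p. [:of_rat (Poly_Mapping.lookup p b):] * Q b)"
  unfolding lin_val_def
  by (intro has_reg_sum has_reg_mult has_reg_const assms)

text \<open>Induction on the number of trailing ones: the product of \<open>e [1]\<close> with
  \<open>b\<close> is a positive multiple of \<open>ap b\<close> plus terms with fewer trailing ones
  than \<open>ap b\<close>. Solving for \<open>ap b\<close> gives its expansion, starting from the
  convergent case.\<close>

lemma has_reg_T:
  assumes "b \<in> B" shows "\<exists>Q. has_reg F l (T b) Q"
  using assms
proof (induction "\<tau> b" arbitrary: b rule: less_induct)
  case (less c)
  show ?case
  proof (cases "\<tau> c")
    case 0
    then show ?thesis using base[OF less.prems] has_reg_e by blast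
  next
    case (Suc k)
    then obtain b where b: "b \<in> B" "\<tau> b = k" "c = ap b" using ap_surj[OF less.prems] by blast
    obtain q where q: "m (e [1]) b = Poly_Mapping.single c (of_nat (Suc k)) + q"
      "Poly_Mapping.keys q \<subseteq> {c \<in> B. \<tau> c \<le> k}" using step[OF b(1)] b by auto
    have "\<exists>Q. has_reg F l (T u) Q" if "u \<in> Poly_Mapping.keys q" for u
      using that q(2) Suc less.hyps by auto
    then obtain Q where Q: "\<And>u. u \<in> Poly_Mapping.keys q \<Longrightarrow> has_reg F l (T u) (Q u)" by metis
    obtain Qb where Qb: "has_reg F l (T b) Qb" using less.hyps[of b] b Suc by auto
    have ev: "eventually (\<lambda>x. (T (e [1]) x * T b x + (- 1) * lin_val (\<lambda>u. T u x) q) * (1 / real (Suc k)) = T c x) F"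
      using T_mult[OF e1 b(1)]
    proof eventually_elim
      case (elim x)
      have "lin_val (\<lambda>u. T u x) (m (e [1]) b) = real (Suc k) * T c x + lin_val (\<lambda>u. T u x) q"
        unfolding q(1) by (simp add: lin_val_add del: of_nat_Suc)
      then show ?case using elim by (simp del: of_nat_Suc)
    qed
    show ?thesis
      by (rule exI, rule has_reg_cong[OF ev])
         (rule has_reg_mult has_reg_add has_reg_const has_reg_e1 Qb has_reg_lin_val Q | assumption)+
  qed
qed

lemma reg_single: "reg (Poly_Mapping.single b 1) = (if b \<in> B then reg_val F l (T b) else 0)"
  by (simp add: reg_def)

lemma reg_val_lin_val:
  assumes "Poly_Mapping.keys p \<subseteq> B"
  shows "reg_val F l (\<lambda>x. lin_val (\<lambda>u. T u x) p) = reg p"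
proof -
  from assms obtain Q where Q: "\<And>u. u \<in> Poly_Mapping.keys p \<Longrightarrow> has_reg F l (T u) (Q u)"
    using has_reg_T by (metis subsetD)
  have "reg_val F l (\<lambda>x. lin_val (\<lambda>u. T u x) p) =
      (\<Sum>b\<in>Poly_Mapping.keys p. of_rat (Poly_Mapping.lookup p b) * poly (Q b) 0)"
    by (subst reg_val_eq[OF nonbot l_at_top has_reg_lin_val[OF Q]]) (auto simp: poly_sum)
  also have "\<dots> = reg p"
    using assms unfolding reg_def lin_val_def
    by (intro sum.cong refl) (auto simp: reg_val_eq[OF nonbot l_at_top Q])
  finally show ?thesis .
qed

lemma reg_mult_basis:
  assumes "a \<in> B" "b \<in> B"
  shows "reg (m a b) = reg (Poly_Mapping.single a 1) * reg (Poly_Mapping.single b 1)"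
proof -
  obtain P Q where PQ: "has_reg F l (T a) P" "has_reg F l (T b) Q" using has_reg_T assms by blast
  have "has_reg F l (\<lambda>x. lin_val (\<lambda>u. T u x) (m a b)) (P * Q)"
    by (rule has_reg_cong[OF T_mult[OF assms] has_reg_mult[OF PQ]])
  then show ?thesis
    using assms PQ by (simp add: reg_single reg_val_eq[OF nonbot l_at_top]
        flip: reg_val_lin_val[OF keys_m[OF assms]])
qed

lemma is_regularization_reg: "is_regularization B m e reg"
proof -
  have mult: "reg (bilin_ext m p q) = reg p * reg q"
    if "Poly_Mapping.keys p \<subseteq> B" "Poly_Mapping.keys q \<subseteq> B" for p q
  proof -
    have "reg (bilin_ext m p q) = (\<Sum>a\<in>Poly_Mapping.keys p. \<Sum>b\<in>Poly_Mapping.keys q.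
       of_rat (Poly_Mapping.lookup p a) * of_rat (Poly_Mapping.lookup q b) * reg (m a b))"
      by (simp add: reg_def lin_val_bilin_ext)
    also have "\<dots> = (\<Sum>a\<in>Poly_Mapping.keys p. \<Sum>b\<in>Poly_Mapping.keys q.
       (of_rat (Poly_Mapping.lookup p a) * reg (Poly_Mapping.single a 1))
       * (of_rat (Poly_Mapping.lookup q b) * reg (Poly_Mapping.single b 1)))"
      using that by (intro sum.cong refl) (auto simp: reg_mult_basis subset_iff)
    also have "\<dots> = reg p * reg q"
      by (simp add: reg_def lin_val_def[of _ p] lin_val_def[of _ q] sum_product)
    finally show ?thesis .
  qed
  have "reg (Poly_Mapping.single (e ks) 1) = mzv ks" if "admissible ks" for ks
    using that by (simp add: reg_single e_in reg_val_eq[OF nonbot l_at_top has_reg_e])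
  moreover have "reg (Poly_Mapping.single (e [1]) 1) = 0"
    unfolding reg_single using e1 reg_val_eq[OF nonbot l_at_top has_reg_e1] by simp
  moreover have "Vector_Spaces.linear scaleQ (\<lambda>(q :: rat) (x :: real). of_rat q * x) reg"
    unfolding reg_def by (rule linear_lin_val)
  ultimately show ?thesis
    unfolding is_regularization_def using mult reg_single by simp
qed

text \<open>The same recursion as for existence: as \<open>e [1]\<close> has value 0, its product
  with \<open>b\<close> has value 0, so the value on \<open>ap b\<close> is determined by words with
  fewer trailing ones.\<close>

lemma regularization_unique:
  assumes "is_regularization B m e \<phi>" "is_regularization B m e \<psi>"
  shows "\<phi> = \<psi>"
proof -
  have lin: "\<omega> = lin_val (\<lambda>b. \<omega> (Poly_Mapping.single b 1))" if "is_regularization B m e \<omega>" for \<omega>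
    by (rule linear_eq_lin_val) (use that in \<open>simp add: is_regularization_def\<close>)
  have *: "\<phi> (Poly_Mapping.single b 1) = \<psi> (Poly_Mapping.single b 1)" if "b \<in> B" for b
    using that
  proof (induction "\<tau> b" arbitrary: b rule: less_induct)
    case (less c)
    show ?case
    proof (cases "\<tau> c")
      case 0
      then show ?thesis using base[OF less.prems] assms by (auto simp: is_regularization_def)
    next
      case (Suc k)
      then obtain b where b: "b \<in> B" "\<tau> b = k" "c = ap b" using ap_surj[OF less.prems] by blast
      obtain q where q: "m (e [1]) b = Poly_Mapping.single c (of_nat (Suc k)) + q"
        "Poly_Mapping.keys q \<subseteq> {c \<in> B. \<tau> c \<le> k}" using step[OF b(1)] b by auto
      have val: "real (Suc k) * \<omega> (Poly_Mapping.single c 1)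
            + lin_val (\<lambda>b. \<omega> (Poly_Mapping.single b 1)) q = 0"
        if "is_regularization B m e \<omega>" for \<omega>
      proof -
        have l: "\<omega> p = lin_val (\<lambda>b. \<omega> (Poly_Mapping.single b 1)) p" for p
          by (rule fun_cong[OF lin[OF that]])
        have "\<omega> (bilin_ext m (Poly_Mapping.single (e [1]) 1) (Poly_Mapping.single b 1)) =
            \<omega> (Poly_Mapping.single (e [1]) 1) * \<omega> (Poly_Mapping.single b 1)"
          using that e1 b(1) by (simp add: is_regularization_def del: bilin_ext_single One_nat_def)
        also have "\<omega> (Poly_Mapping.single (e [1]) 1) = 0"
          using that by (simp add: is_regularization_def)
        finally have "\<omega> (m (e [1]) b) = 0" by simp
        then have "lin_val (\<lambda>b. \<omega> (Poly_Mapping.single b 1)) (m (e [1]) b) = 0"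
          unfolding l[symmetric] .
        then show ?thesis unfolding q(1) by (simp add: lin_val_add del: of_nat_Suc)
      qed
      have "lin_val (\<lambda>b. \<phi> (Poly_Mapping.single b 1)) q = lin_val (\<lambda>b. \<psi> (Poly_Mapping.single b 1)) q"
        unfolding lin_val_def
      proof (intro sum.cong refl arg_cong2[where f = "(*)"] less.hyps)
        fix u assume "u \<in> Poly_Mapping.keys q"
        then show "\<tau> u < \<tau> c" "u \<in> B" using q(2) Suc by auto
      qed
      then have "real (Suc k) * \<phi> (Poly_Mapping.single c 1) = real (Suc k) * \<psi> (Poly_Mapping.single c 1)"
        using val[OF assms(1)] val[OF assms(2)] by linarith
      then show ?thesis by (simp del: of_nat_Suc)
    qed
  qed
  have "\<phi> (Poly_Mapping.single b 1) = \<psi> (Poly_Mapping.single b 1)" for b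
    using * assms by (cases "b \<in> B") (auto simp: is_regularization_def)
  then have "lin_val (\<lambda>b. \<phi> (Poly_Mapping.single b 1)) = lin_val (\<lambda>b. \<psi> (Poly_Mapping.single b 1))"
    by simp
  from box_equals[OF this lin[OF assms(1), symmetric] lin[OF assms(2), symmetric]] show ?thesis .
qed

lemma the_regularization: "(THE \<phi>. is_regularization B m e \<phi>) = reg"
  using regularization_unique[OF _ is_regularization_reg] is_regularization_reg by (metis the_equality)

end

subsection \<open>Truncated multiple harmonic sums\<close>

text \<open>The reversed list lets the recursion strip the largest summation variable, which is
  \<open>Suc j\<close>; evaluating the inner sum at \<open>j\<close> makes the inequality between
  the variables strict.\<close>

fun trunc_rev :: "nat list \<Rightarrow> nat \<Rightarrow> real" where
  "trunc_rev [] N = 1"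
| "trunc_rev (k # ks) N = (\<Sum>j<N. trunc_rev ks j / real (Suc j) ^ k)"

definition trunc :: "nat list \<Rightarrow> nat \<Rightarrow> real" where
  "trunc ks = trunc_rev (rev ks)"

lemma trunc_Nil [simp]: "trunc [] N = 1"
  by (simp add: trunc_def)

lemma trunc_snoc: "trunc (ks @ [k]) N = (\<Sum>j<N. trunc ks j / real (Suc j) ^ k)"
  by (simp add: trunc_def)

lemma trunc_snoc_0 [simp]: "trunc (ks @ [k]) 0 = 0"
  by (simp add: trunc_snoc)

lemma trunc_snoc_Suc: "trunc (ks @ [k]) (Suc N) = trunc (ks @ [k]) N + trunc ks N / real (Suc N) ^ k"
  by (simp add: trunc_snoc)

lemma trunc_nonneg: "trunc ks N \<ge> 0"
  by (induction ks arbitrary: N rule: rev_induct) (auto simp: trunc_snoc intro!: sum_nonneg)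

lemma trunc_mono: "M \<le> N \<Longrightarrow> trunc ks M \<le> trunc ks N"
  by (cases ks rule: rev_cases) (auto simp: trunc_snoc trunc_nonneg intro!: sum_mono2)

text \<open>Both sides vanish at 0 and have the same increments in \<open>N\<close>: expanding the
  product of the two increased factors gives the three terms of the recursion, by whether the first
  largest variable, both, or the second takes the new value.\<close>

lemma trunc_harmonic_prod:
  "trunc ks N * trunc ls N = lin_val (\<lambda>u. trunc u N) (harmonic_prod ks ls)"
proof (induction ks ls arbitrary: N rule: harmonic_prod.induct)
  case (3 ks k ls l)
  have "trunc (ks @ [k]) N * trunc (ls @ [l]) N =
      lin_val (\<lambda>u. trunc (u @ [k]) N) (harmonic_prod ks (ls @ [l]))
    + lin_val (\<lambda>u. trunc (u @ [k + l]) N) (harmonic_prod ks ls)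
    + lin_val (\<lambda>u. trunc (u @ [l]) N) (harmonic_prod (ks @ [k]) ls)"
  proof (induction N)
    case 0
    then show ?case by (simp add: lin_val_def)
  next
    case (Suc N)
    have S: "lin_val (\<lambda>u. trunc (u @ [i]) (Suc N)) p =
        lin_val (\<lambda>u. trunc (u @ [i]) N) p + lin_val (\<lambda>u. trunc u N) p / real (Suc N) ^ i" for i p
      by (simp add: lin_val_def trunc_snoc_Suc distrib_left sum.distrib sum_divide_distrib del: of_nat_Suc)
    have expand: "(A + a / p) * (B + b / q) = (X + a * B / p) + (Y + a * b / (p * q)) + (Z + A * b / q)"
      if "A * B = X + Y + Z" for A B X Y Z a b p q :: real
      using that by (simp add: distrib_left distrib_right add_divide_distrib)
    show ?case
      unfolding S unfolding 3[symmetric] trunc_snoc_Suc power_add by (rule expand[OF Suc])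
  qed
  then show ?case by (simp add: lin_val_add lin_val_lin_ext)
qed auto

lemma sum_inverse_sqrt_le: "(\<Sum>j<N. 1 / sqrt (real (Suc j))) \<le> 2 * sqrt (real N)"
proof (induction N)
  case (Suc N)
  have "(sqrt (real (Suc N)) - sqrt (real N)) * (sqrt (real (Suc N)) + sqrt (real N)) = 1"
    by (simp add: algebra_simps)
  moreover have "sqrt (real (Suc N)) + sqrt (real N) \<le> 2 * sqrt (real (Suc N))" by simp
  moreover have "sqrt (real (Suc N)) - sqrt (real N) \<ge> 0" by simp
  ultimately have "1 \<le> (sqrt (real (Suc N)) - sqrt (real N)) * (2 * sqrt (real (Suc N)))"
    by (metis mult_left_mono)
  then have "1 / sqrt (real (Suc N)) \<le> (sqrt (real (Suc N)) - sqrt (real N)) * (2 * sqrt (real (Suc N))) / sqrt (real (Suc N))"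
    by (intro divide_right_mono) auto
  then have "1 / sqrt (real (Suc N)) \<le> 2 * (sqrt (real (Suc N)) - sqrt (real N))"
    by simp
  with Suc show ?case by simp
qed simp

text \<open>The true growth is a power of a logarithm. The square root is coarser but reproduces
  itself: division by \<open>Suc j\<close> leaves 1 / sqrt (j+1), whose sum is again of square root
  size.\<close>

lemma trunc_bound:
  assumes "is_index ks"
  shows "\<exists>C\<ge>0. \<forall>N. trunc ks N \<le> C * sqrt (real (Suc N))"
  using assms
proof (induction ks rule: rev_induct)
  case Nil
  show ?case by (rule exI[of _ 1]) simp
next
  case (snoc k ks)
  then obtain C where C: "C \<ge> 0" "\<And>N. trunc ks N \<le> C * sqrt (real (Suc N))" by (auto simp: is_index_def)
  have k: "k \<ge> 1" using snoc.prems by (auto simp: is_index_def)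
  have "trunc (ks @ [k]) N \<le> (2 * C) * sqrt (real (Suc N))" for N
  proof -
    have "trunc (ks @ [k]) N \<le> (\<Sum>j<N. C * (1 / sqrt (real (Suc j))))"
      unfolding trunc_snoc
    proof (rule sum_mono)
      fix j
      have "trunc ks j / real (Suc j) ^ k \<le> (C * sqrt (real (Suc j))) / real (Suc j) ^ 1"
        using k by (intro frac_le C mult_nonneg_nonneg power_increasing) auto
      also have "\<dots> = C * (1 / sqrt (real (Suc j)))"
        using real_sqrt_mult_self[of "real (Suc j)"] by (simp add: field_simps del: of_nat_Suc)
      finally show "trunc ks j / real (Suc j) ^ k \<le> C * (1 / sqrt (real (Suc j)))" .
    qed
    also have "\<dots> \<le> C * (2 * sqrt (real N))"
      unfolding sum_distrib_left[symmetric] by (intro mult_left_mono sum_inverse_sqrt_le C)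
    also have "\<dots> \<le> C * (2 * sqrt (real (Suc N)))" by (intro mult_left_mono C) auto
    finally show ?thesis by simp
  qed
  with C(1) show ?case by (intro exI[of _ "2 * C"]) auto
qed

text \<open>Exponential decay in \<open>l\<close> beats all its powers. For \<open>l\<close> equal
  to \<open>harm\<close> or \<open>logdiv\<close> the bound amounts to a rate 1 / sqrt n or sqrt (1
  - z), which is what the square root estimates provide.\<close>

lemma negl_bound:
  assumes "filterlim l at_top F" "eventually (\<lambda>x. \<bar>e x\<bar> \<le> C * exp (- l x / 2)) F"
  shows "negl F l e"
  unfolding negl_def
proof
  fix j
  have "filterlim (\<lambda>x. (1/2) * l x) at_top F"
    by (rule filterlim_tendsto_pos_mult_at_top[OF tendsto_const _ assms(1)]) simp
  then have "((\<lambda>x. ((1/2) * l x) ^ j / exp ((1/2) * l x)) \<longlongrightarrow> 0) F"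
    by (rule filterlim_compose[OF tendsto_power_div_exp_0])
  then have lim: "((\<lambda>x. C * 2 ^ j * (((1/2) * l x) ^ j / exp ((1/2) * l x))) \<longlongrightarrow> 0) F"
    by (rule tendsto_mult_right_zero)
  have ev: "eventually (\<lambda>x. norm (e x * l x ^ j) \<le> C * 2 ^ j * (((1/2) * l x) ^ j / exp ((1/2) * l x))) F"
    using assms(2) filterlim_at_top_dense[THEN iffD1, OF assms(1), rule_format, of 0]
  proof eventually_elim
    case (elim x)
    have "norm (e x * l x ^ j) = \<bar>e x\<bar> * l x ^ j" using elim by (simp add: abs_mult)
    also have "\<dots> \<le> C * exp (- l x / 2) * l x ^ j" using elim by (intro mult_right_mono) auto
    also have "\<dots> = C * 2 ^ j * (((1/2) * l x) ^ j / exp ((1/2) * l x))"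
      by (simp add: power_mult_distrib exp_minus field_simps power_divide)
    finally show ?case .
  qed
  show "((\<lambda>x. e x * l x ^ j) \<longlongrightarrow> 0) F" by (rule Lim_null_comparison[OF ev lim])
qed

text \<open>\<open>1 / sqrt\<close> telescopes: \<open>1 / (2 (n+1) sqrt (n+1)) \<le> 1 / sqrt n - 1 / sqrt (n+1)\<close>.\<close>

lemma limit_rate_nat:
  fixes g :: "nat \<Rightarrow> real"
  assumes "\<And>n. g n \<le> g (Suc n)" "\<And>n. g (Suc n) - g n \<le> C / (real (Suc n) * sqrt (real (Suc n)))" "C \<ge> 0"
  shows "\<exists>c. g \<longlonglongrightarrow> c \<and> (\<forall>n>0. \<bar>g n - c\<bar> \<le> 2 * C / sqrt (real n))"
proof -
  have inc: "1 / (real (Suc n) * sqrt (real (Suc n))) \<le> 2 / sqrt (real n) - 2 / sqrt (real (Suc n))" if "n > 0" for n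
  proof -
    define a b where "a = sqrt (real n)" and "b = sqrt (real (Suc n))"
    have ab: "a > 0" "b > 0" "a \<le> b" "b * b = real (Suc n)" "b * b - a * a = 1"
      using that by (auto simp: a_def b_def)
    have "2 / a - 2 / b = 2 * (b - a) / (a * b)" using ab by (simp add: field_simps)
    have "a * (b + a) \<le> b * (2 * b)" using ab by (intro mult_mono) auto
    then have "(b - a) * (a * (b + a)) \<le> (b - a) * (b * (2 * b))" using ab by (intro mult_left_mono) auto
    moreover have "(b - a) * (a * (b + a)) = a * (b * b - a * a)" by (simp add: algebra_simps)
    moreover have "(b - a) * (b * (2 * b)) = 2 * (b - a) * (b * b)" by simp
    ultimately have "a \<le> 2 * (b - a) * (b * b)" using ab(5) by simp
    then have "a / (a * (b * b * b)) \<le> 2 * (b - a) * (b * b) / (a * (b * b * b))"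
      using ab by (intro divide_right_mono) auto
    then have "1 / (b * b * b) \<le> 2 * (b - a) / (a * b)" using ab(1,2) by simp
    also have "\<dots> = 2 / a - 2 / b" using ab by (simp add: field_simps)
    finally show ?thesis using ab(4) by (simp add: a_def b_def del: of_nat_Suc)
  qed
  have dec: "g (Suc n) + 2 * C / sqrt (real (Suc n)) \<le> g n + 2 * C / sqrt (real n)" if "n > 0" for n
  proof -
    have "C * (1 / (real (Suc n) * sqrt (real (Suc n)))) \<le> C * (2 / sqrt (real n) - 2 / sqrt (real (Suc n)))"
      by (intro mult_left_mono inc that assms)
    then show ?thesis using assms(2)[of n] by (simp add: algebra_simps)
  qed
  have le: "g m + 2 * C / sqrt (real m) \<le> g n + 2 * C / sqrt (real n)" if "n > 0" "n \<le> m" for n m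
    using that(2,1) by (induction rule: dec_induct) (auto intro: order_trans[OF dec] simp del: of_nat_Suc)
  have mono: "incseq g" using assms(1) by (rule incseq_SucI)
  have bd: "g n \<le> g 1 + 2 * C" for n
  proof -
    have "g n \<le> g (Suc n)" by (rule assms)
    also have "\<dots> \<le> g (Suc n) + 2 * C / sqrt (real (Suc n))" using assms(3) by simp
    also have "\<dots> \<le> g 1 + 2 * C" using le[of 1 "Suc n"] by simp
    finally show ?thesis .
  qed
  obtain c where c: "g \<longlonglongrightarrow> c" "\<And>n. g n \<le> c"
    using incseq_convergent[OF mono, of "g 1 + 2 * C"] bd by metis
  have "c \<le> g n + 2 * C / sqrt (real n)" if "n > 0" for n
  proof (rule LIMSEQ_le_const2[OF c(1)])
    show "\<exists>N. \<forall>m\<ge>N. g m \<le> g n + 2 * C / sqrt (real n)"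
    proof (intro exI allI impI)
      fix m assume "n \<le> m"
      have "g m \<le> g m + 2 * C / sqrt (real m)" using assms(3) by simp
      also have "\<dots> \<le> g n + 2 * C / sqrt (real n)" by (rule le) fact+
      finally show "g m \<le> g n + 2 * C / sqrt (real n)" .
    qed
  qed
  with c show ?thesis by (intro exI[of _ c]) (auto simp: abs_le_iff algebra_simps)
qed

lemma trunc_eq_sum:
  "trunc ks N = (\<Sum>ns | length ns = length ks \<and> sorted_wrt (<) ns \<and> (\<forall>n\<in>set ns. 1 \<le> n \<and> n \<le> N).
     \<Prod>i<length ks. 1 / real (ns ! i) ^ (ks ! i))"
  (is "_ = sum (?f ks) (?A ks N)")
proof (induction ks arbitrary: N rule: rev_induct)
  case Nil
  have "?A [] N = {[]}" by auto
  then show ?case by simp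
next
  case (snoc k ks)
  have A: "?A (ks @ [k]) N = (\<lambda>(j, ns). ns @ [Suc j]) ` (SIGMA j:{..<N}. ?A ks j)" (is "?L = ?R")
  proof
    show "?L \<subseteq> ?R"
    proof
      fix ms assume ms: "ms \<in> ?L"
      then obtain ns n where [simp]: "ms = ns @ [n]" by (cases ms rule: rev_cases) auto
      obtain j where [simp]: "n = Suc j" using ms by (cases n) auto
      have "(j, ns) \<in> (SIGMA j:{..<N}. ?A ks j)"
        using ms by (auto simp: sorted_wrt_append less_Suc_eq_le)
      then show "ms \<in> ?R" by (intro image_eqI[of _ _ "(j, ns)"]) auto
    qed
    show "?R \<subseteq> ?L" by (fastforce simp: sorted_wrt_append less_Suc_eq_le)
  qed
  have fin: "finite (?A ks j)" for j
    by (rule finite_subset[OF _ finite_lists_length_eq[of "{1..j}" "length ks"]]) auto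
  have "sum (?f (ks @ [k])) (?A (ks @ [k]) N) = (\<Sum>(j, ns)\<in>(SIGMA j:{..<N}. ?A ks j). ?f (ks @ [k]) (ns @ [Suc j]))"
    unfolding A by (subst sum.reindex) (auto simp: inj_on_def case_prod_unfold)
  also have "\<dots> = (\<Sum>(j, ns)\<in>(SIGMA j:{..<N}. ?A ks j). ?f ks ns / real (Suc j) ^ k)"
    by (intro sum.cong refl) (auto simp: nth_append simp del: of_nat_Suc)
  also have "\<dots> = (\<Sum>j<N. \<Sum>ns\<in>?A ks j. ?f ks ns / real (Suc j) ^ k)"
    using fin by (subst sum.Sigma) auto
  also have "\<dots> = trunc (ks @ [k]) N"
    unfolding trunc_snoc snoc sum_divide_distrib ..
  finally show ?case ..
qed

text \<open>\<open>mzv\<close> is an unordered sum over all increasing tuples. Its terms are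
  nonnegative and the truncations exhaust the index set, so finite partial sums are squeezed between
  a late truncation and the limit.\<close>

lemma mzv_eq_limit:
  assumes "trunc ks \<longlonglongrightarrow> c"
  shows "mzv ks = c"
proof -
  define f where "f ns = (\<Prod>i<length ks. 1 / real (ns ! i) ^ (ks ! i))" for ns :: "nat list"
  define A where "A N = {ns. length ns = length ks \<and> sorted_wrt (<) ns \<and> (\<forall>n\<in>set ns. 1 \<le> n \<and> n \<le> N)}" for N :: nat
  let ?S = "{ns :: nat list. length ns = length ks \<and> sorted_wrt (<) ns \<and> (\<forall>n \<in> set ns. 1 \<le> n)}"
  have fin: "finite (A N)" for N
    by (rule finite_subset[OF _ finite_lists_length_eq[of "{1..N}" "length ks"]]) (auto simp: A_def)
  have tr: "trunc ks N = sum f (A N)" for N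
    unfolding trunc_eq_sum A_def f_def ..
  have f0: "f ns \<ge> 0" for ns by (auto simp: f_def intro!: prod_nonneg)
  have ub: "sum f (A N) \<le> c" for N
    unfolding tr[symmetric] by (rule incseq_le[OF _ assms]) (auto simp: incseq_def intro: trunc_mono)
  have "(f has_sum c) ?S"
    unfolding has_sum_def
  proof (rule tendstoI, goal_cases)
    case (1 r)
    then obtain N where N: "\<bar>trunc ks N - c\<bar> < r"
      using assms[THEN LIMSEQ_D, of r] by auto
    show ?case unfolding eventually_finite_subsets_at_top
    proof (intro exI[of _ "A N"] conjI allI impI)
      fix X assume X: "finite X \<and> A N \<subseteq> X \<and> X \<subseteq> ?S"
      \<comment> \<open>A finite set of tuples lies in the truncation at its largest entry; the
        inserted 0 keeps \<open>Max\<close> meaningful when there are no entries.\<close>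
      have X': "X \<subseteq> A (Max (insert 0 (\<Union>(set ` X))))"
        using X by (auto simp: A_def intro!: Max_ge)
      have "sum f X \<le> sum f (A (Max (insert 0 (\<Union>(set ` X)))))"
        using f0 fin X' by (intro sum_mono2) auto
      also have "\<dots> \<le> c" by (rule ub)
      finally have "sum f X \<le> c" .
      moreover have "sum f (A N) \<le> sum f X" using f0 X by (intro sum_mono2) auto
      ultimately show "dist (sum f X) c < r" using N by (simp add: tr dist_real_def)
    qed (auto simp: fin, auto simp: A_def)
  qed
  then show ?thesis unfolding mzv_def f_def[symmetric] by (rule infsumI)
qed

lemma mzv_Nil [simp]: "mzv [] = 1"
proof -
  have "trunc [] = (\<lambda>_. 1)" by (rule ext) simp
  then show ?thesis by (intro mzv_eq_limit) simp
qed

lemma trunc_rate: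
  assumes "admissible ks"
  shows "\<exists>C. \<forall>n>0. \<bar>trunc ks n - mzv ks\<bar> \<le> C / sqrt (real n)"
proof (cases ks rule: rev_cases)
  case Nil
  then show ?thesis by (intro exI[of _ 0]) simp
next
  case (snoc ls k)
  have k: "k \<ge> 2" and ls: "is_index ls" using assms snoc by (auto simp: admissible_def is_index_def)
  obtain C where C: "C \<ge> 0" "\<And>N. trunc ls N \<le> C * sqrt (real (Suc N))" using trunc_bound[OF ls] by blast
  have "trunc ks (Suc n) - trunc ks n \<le> C / (real (Suc n) * sqrt (real (Suc n)))" for n
  proof -
    have "trunc ks (Suc n) - trunc ks n = trunc ls n / real (Suc n) ^ k"
      by (simp add: snoc trunc_snoc_Suc)
    also have "\<dots> \<le> (C * sqrt (real (Suc n))) / real (Suc n) ^ 2"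
      using k by (intro frac_le C mult_nonneg_nonneg power_increasing) auto
    also have "\<dots> = C / (real (Suc n) * sqrt (real (Suc n)))"
      using real_sqrt_mult_self[of "real (Suc n)"] by (simp add: field_simps power2_eq_square del: of_nat_Suc)
    finally show ?thesis .
  qed
  from limit_rate_nat[OF trunc_mono[OF le_SucI[OF order_refl]] this C(1)] obtain c where
    c: "trunc ks \<longlonglongrightarrow> c" "\<And>n. n > 0 \<Longrightarrow> \<bar>trunc ks n - c\<bar> \<le> 2 * C / sqrt (real n)" by blast
  then show ?thesis using mzv_eq_limit[OF c(1)] by blast
qed

lemma trunc_tendsto:
  assumes "admissible ks" shows "trunc ks \<longlonglongrightarrow> mzv ks"
proof -
  obtain C where C: "\<And>n. n > 0 \<Longrightarrow> \<bar>trunc ks n - mzv ks\<bar> \<le> C / sqrt (real n)"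
    using trunc_rate[OF assms] by blast
  have "(\<lambda>n. C / sqrt (real n)) \<longlonglongrightarrow> 0"
    by (intro tendsto_divide_0[OF tendsto_const] filterlim_at_top_imp_at_infinity
          filterlim_compose[OF sqrt_at_top] filterlim_real_sequentially)
  moreover have "eventually (\<lambda>n. norm (trunc ks n - mzv ks) \<le> C / sqrt (real n)) sequentially"
    using eventually_gt_at_top[of 0] by eventually_elim (simp add: C)
  ultimately have "(\<lambda>n. trunc ks n - mzv ks) \<longlonglongrightarrow> 0" by (rule Lim_null_comparison[rotated])
  then show ?thesis by (simp add: LIM_zero_iff)
qed

lemma harm_le_ln: "n > 0 \<Longrightarrow> harm n \<le> 1 + ln (real n)"
proof (induction n)
  case (Suc n)
  show ?case
  proof (cases "n = 0")
    case False
    have "ln (real n / real (Suc n)) \<le> real n / real (Suc n) - 1"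
      using False by (intro ln_le_minus_one) auto
    also have "\<dots> = - (1 / real (Suc n))" by (simp add: field_simps)
    finally have "1 / real (Suc n) \<le> ln (real (Suc n)) - ln (real n)"
      using False by (simp add: ln_div)
    then show ?thesis using Suc False by (simp add: harm_Suc inverse_eq_divide)
  qed (simp add: harm_Suc harm_expand)
qed simp

lemma negl_trunc:
  assumes "admissible ks"
  shows "negl sequentially harm (\<lambda>n. trunc ks n - mzv ks)"
proof -
  obtain C0 where C0: "\<And>n. n > 0 \<Longrightarrow> \<bar>trunc ks n - mzv ks\<bar> \<le> C0 / sqrt (real n)"
    using trunc_rate[OF assms] by blast
  define C where "C = \<bar>C0\<bar>"
  have C: "\<bar>trunc ks n - mzv ks\<bar> \<le> C / sqrt (real n)" if "n > 0" for n
  proof -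
    have "C0 / sqrt (real n) \<le> C / sqrt (real n)" by (intro divide_right_mono) (auto simp: C_def)
    with C0[OF that] show ?thesis by linarith
  qed
  \<comment> \<open>The factor exp (1/2) pays for the 1 in
    \<open>harm n \<le> 1 + ln n\<close>.\<close>
  have "eventually (\<lambda>n. \<bar>trunc ks n - mzv ks\<bar> \<le> (C * exp (1/2)) * exp (- harm n / 2)) sequentially"
    using eventually_gt_at_top[of 0]
  proof eventually_elim
    case (elim n)
    have "exp (harm n / 2) \<le> exp (1/2 + ln (sqrt (real n)))"
      using harm_le_ln[OF elim] elim by (simp add: ln_sqrt)
    also have "\<dots> = exp (1/2) * sqrt (real n)" using elim by (simp add: exp_add)
    finally have "1 / (exp (1/2) * sqrt (real n)) \<le> 1 / exp (harm n / 2)"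
      using elim by (intro divide_left_mono) auto
    then have "1 / sqrt (real n) \<le> exp (1/2) * exp (- harm n / 2)"
      using elim by (simp add: exp_minus field_simps)
    then have "C * (1 / sqrt (real n)) \<le> C * (exp (1/2) * exp (- harm n / 2))"
      by (rule mult_left_mono) (simp add: C_def)
    with C[OF elim] show ?case by simp
  qed
  then show ?thesis by (rule negl_bound[OF harm_at_top])
qed

subsection \<open>The harmonic regularization\<close>

definition trailing :: "'a \<Rightarrow> 'a list \<Rightarrow> nat" where
  "trailing a w = length (takeWhile (\<lambda>x. x = a) (rev w))"

lemma trailing_Nil [simp]: "trailing a [] = 0"
  by (simp add: trailing_def)

lemma trailing_snoc [simp]: "trailing a (w @ [b]) = (if b = a then Suc (trailing a w) else 0)"
  by (simp add: trailing_def)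

lemma is_index_simps [simp]: "is_index []" "is_index (k # ks) \<longleftrightarrow> 0 < k \<and> is_index ks"
  "is_index (ks @ ls) \<longleftrightarrow> is_index ks \<and> is_index ls"
  by (auto simp: is_index_def)

lemma harmonic_prod_Nil [simp]: "harmonic_prod [] ls = Poly_Mapping.single ls 1"
  by (cases ls rule: rev_cases) auto

lemma harmonic_prod_keys:
  assumes "is_index ks" "is_index ls"
  shows "Poly_Mapping.keys (harmonic_prod ks ls) \<subseteq> {u. is_index u}"
  using assms
proof (induction ks ls rule: harmonic_prod.induct)
  case (3 ks k ls l)
  let ?p = "harmonic_prod ks (ls @ [l])" and ?q = "harmonic_prod ks ls" and ?r = "harmonic_prod (ks @ [k]) ls"
  have "Poly_Mapping.keys (harmonic_prod (ks @ [k]) (ls @ [l])) \<subseteq>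
      (\<lambda>w. w @ [k]) ` Poly_Mapping.keys ?p \<union> (\<lambda>w. w @ [k + l]) ` Poly_Mapping.keys ?q
      \<union> (\<lambda>w. w @ [l]) ` Poly_Mapping.keys ?r"
    unfolding harmonic_prod.simps by (intro order_trans[OF keys_add] Un_mono keys_lin_ext order_refl)
  with 3 show ?case by fastforce
qed auto

text \<open>The last entry of each term is \<open>k\<close>, \<open>l\<close> or
  \<open>k + l\<close>, hence above 1. This is what makes the span of the multiple zeta values a
  ring.\<close>

lemma harmonic_prod_admissible:
  assumes "admissible ks" "admissible ls"
  shows "Poly_Mapping.keys (harmonic_prod ks ls) \<subseteq> {u. admissible u}"
proof (cases "ks = [] \<or> ls = []")
  case True
  then show ?thesis using assms by auto
next
  case False
  then obtain ks' k ls' l where [simp]: "ks = ks' @ [k]" "ls = ls' @ [l]"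
    by (metis rev_exhaust)
  let ?p = "harmonic_prod ks' (ls' @ [l])" and ?q = "harmonic_prod ks' ls'" and ?r = "harmonic_prod (ks' @ [k]) ls'"
  have "Poly_Mapping.keys (harmonic_prod ks ls) \<subseteq>
      (\<lambda>w. w @ [k]) ` Poly_Mapping.keys ?p \<union> (\<lambda>w. w @ [k + l]) ` Poly_Mapping.keys ?q
      \<union> (\<lambda>w. w @ [l]) ` Poly_Mapping.keys ?r"
    unfolding \<open>ks = _\<close> \<open>ls = _\<close> harmonic_prod.simps
    by (intro order_trans[OF keys_add] Un_mono keys_lin_ext order_refl)
  moreover have "is_index u" if "u \<in> Poly_Mapping.keys ?p \<union> Poly_Mapping.keys ?q \<union> Poly_Mapping.keys ?r" for u
    using that assms harmonic_prod_keys[of ks' "ls' @ [l]"] harmonic_prod_keys[of ks' ls'] harmonic_prod_keys[of "ks' @ [k]" ls']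
    by (auto simp: admissible_def)
  ultimately show ?thesis using assms by (fastforce simp: admissible_def)
qed

text \<open>A 1 can be inserted into a final run of s ones in s + 1 ways with the same result. An
  insertion further left leaves the run unchanged, and adding 1 to an entry never lengthens
  it.\<close>

lemma harmonic_prod_one:
  assumes "is_index ks"
  shows "\<exists>q. harmonic_prod [1] ks = Poly_Mapping.single (ks @ [1]) (of_nat (Suc (trailing 1 ks))) + q \<and>
     Poly_Mapping.keys q \<subseteq> {u \<in> {u. is_index u}. trailing 1 u \<le> trailing 1 ks}"
  using assms
proof (induction ks rule: rev_induct)
  case Nil
  show ?case by (intro exI[of _ 0]) simp
next
  case (snoc l ls)
  then obtain q where q: "harmonic_prod [1] ls = Poly_Mapping.single (ls @ [1]) (of_nat (Suc (trailing 1 ls))) + q"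
     "Poly_Mapping.keys q \<subseteq> {u \<in> {u. is_index u}. trailing 1 u \<le> trailing 1 ls}" by auto
  have l: "l > 0" "is_index ls" using snoc.prems by auto
  have h: "harmonic_prod [1] (ls @ [l]) = Poly_Mapping.single (ls @ [l] @ [1]) 1
      + Poly_Mapping.single (ls @ [1 + l]) 1 + lin_ext (\<lambda>w. w @ [l]) (harmonic_prod [1] ls)"
    using harmonic_prod.simps(3)[of "[]" 1 ls l]
    by (simp only: append_Nil harmonic_prod_Nil lin_ext_single append_assoc append_Cons)
  show ?case
  proof (cases "l = 1")
    case True
    define q' where "q' = Poly_Mapping.single (ls @ [1 + l]) 1 + lin_ext (\<lambda>w. w @ [l]) q"
    have "harmonic_prod [1] (ls @ [l]) = Poly_Mapping.single ((ls @ [l]) @ [1]) (of_nat (Suc (trailing 1 (ls @ [l])))) + q'"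
    proof -
      let ?w = "ls @ [l] @ [1]"
      have "Poly_Mapping.single ?w (of_nat (Suc (trailing 1 (ls @ [l]))) :: rat)
          = Poly_Mapping.single ?w 1 + Poly_Mapping.single ?w (of_nat (Suc (trailing 1 ls)))"
        using True by (subst single_add[symmetric]) simp
      then show ?thesis
        using True unfolding h q(1) lin_ext_add q'_def by (simp only: lin_ext_single append_assoc add_ac)
    qed
    moreover have "Poly_Mapping.keys q' \<subseteq> Poly_Mapping.keys (Poly_Mapping.single (ls @ [1 + l]) (1::rat)) \<union> (\<lambda>w. w @ [l]) ` Poly_Mapping.keys q"
      unfolding q'_def by (intro order_trans[OF keys_add] Un_mono keys_lin_ext order_refl)
    then have "Poly_Mapping.keys q' \<subseteq> {u \<in> {u. is_index u}. trailing 1 u \<le> trailing 1 (ls @ [l])}"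
      by (rule order_trans) (use q(2) l True in auto)
    ultimately show ?thesis by blast
  next
    case False
    define q' where "q' = Poly_Mapping.single (ls @ [1 + l]) 1 + lin_ext (\<lambda>w. w @ [l]) (harmonic_prod [1] ls)"
    have "harmonic_prod [1] (ls @ [l]) = Poly_Mapping.single ((ls @ [l]) @ [1]) (of_nat (Suc (trailing 1 (ls @ [l])))) + q'"
      using False unfolding h q'_def by (simp add: add.assoc)
    moreover have "Poly_Mapping.keys q' \<subseteq> Poly_Mapping.keys (Poly_Mapping.single (ls @ [1 + l]) (1::rat)) \<union> (\<lambda>w. w @ [l]) ` Poly_Mapping.keys (harmonic_prod [1] ls)"
      unfolding q'_def by (intro order_trans[OF keys_add] Un_mono keys_lin_ext order_refl)
    then have "Poly_Mapping.keys q' \<subseteq> {u \<in> {u. is_index u}. trailing 1 u \<le> trailing 1 (ls @ [l])}"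
      by (rule order_trans) (use harmonic_prod_keys[of "[1]" ls] l False in auto)
    ultimately show ?thesis by blast
  qed
qed

lemma trunc_one: "trunc [1] N = harm N"
  using trunc_snoc[of "[]" 1 N] by (simp add: harm_altdef inverse_eq_divide)

lemma admissible_is_index: "admissible ks \<Longrightarrow> is_index ks"
  by (simp add: admissible_def)

interpretation harmonic: regularization "{ks. is_index ks}" harmonic_prod "\<lambda>ks. ks" "trailing 1"
    "\<lambda>ks. ks @ [1]" trunc sequentially harm
proof (unfold_locales, goal_cases)
  case (5 b)
  then show ?case using harmonic_prod_one[of b] by simp
next
  case (6 c k)
  then obtain b where "c = b @ [1]" by (cases c rule: rev_cases) (auto split: if_splits)
  with 6 show ?case by auto
next
  case (7 c)
  then show ?case by (cases c rule: rev_cases) (auto simp: admissible_def split: if_splits)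
next
  case (8 a b)
  then show ?case using harmonic_prod_keys by auto
qed (auto simp: harm_at_top trunc_harmonic_prod trunc_one[unfolded One_nat_def] negl_trunc admissible_is_index)

lemma zeta_reg_Harmonic: "is_index ks \<Longrightarrow> zeta_reg Harmonic ks = reg_val sequentially harm (trunc ks)"
  by (simp add: harmonic_reg_def harmonic.the_regularization harmonic.reg_single)

subsection \<open>Polylogarithms as formal power series\<close>

unbundle no vec_syntax
unbundle fps_syntax

text \<open>The derivation z d/dz, diagonal on powers of z. With \<open>zgeo\<close> = z / (1 - z),
  the letters x and y stand for the forms dz / z and dz / (1 - z) of iterated integrals.\<close>

definition theta :: "real fps \<Rightarrow> real fps" where
  "theta f = fps_X * fps_deriv f"

text \<open>Division by \<open>real 0\<close> gives 0, so the constant term is discarded and the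
  primitive vanishing at z = 0 is chosen.\<close>

definition theta_inv :: "real fps \<Rightarrow> real fps" where
  "theta_inv f = Abs_fps (\<lambda>N. f $ N / real N)"

definition zgeo :: "real fps" where
  "zgeo = Abs_fps (\<lambda>N. if N = 0 then 0 else 1)"

fun letter_kernel :: "letter \<Rightarrow> real fps" where
  "letter_kernel Lx = 1"
| "letter_kernel Ly = zgeo"

text \<open>\<open>plog_rev\<close> reads the word from its last letter. The argument \<open>m\<close> is the order of a shift
  \<open>n_i \<rightarrow> n_i - t\<close> of all summation variables: the coefficients of \<open>plog m\<close> on the word of an index
  \<open>k\<close> are the \<open>t^m\<close>-coefficients of the sums of \<open>\<Prod>i. 1 / (n_i - t) ^ k_i\<close> with fixed largest \<open>n_i\<close>.\<close>

fun plog_rev :: "letter list \<Rightarrow> nat \<Rightarrow> real fps" where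
  "plog_rev [] m = (if m = 0 then 1 else 0)"
| "plog_rev (c # w) 0 = theta_inv (letter_kernel c * plog_rev w 0)"
| "plog_rev (c # w) (Suc m) = theta_inv (letter_kernel c * plog_rev w (Suc m) + plog_rev (c # w) m)"

definition plog :: "nat \<Rightarrow> letter list \<Rightarrow> real fps" where
  "plog m w = plog_rev (rev w) m"

lemma plog_Nil [simp]: "plog m [] = (if m = 0 then 1 else 0)"
  by (simp add: plog_def)

lemma plog_0_snoc: "plog 0 (w @ [c]) = theta_inv (letter_kernel c * plog 0 w)"
  by (simp add: plog_def)

lemma plog_Suc_snoc: "plog (Suc m) (w @ [c]) = theta_inv (letter_kernel c * plog (Suc m) w + plog m (w @ [c]))"
  by (simp add: plog_def)

lemma theta_nth [simp]: "theta f $ N = real N * f $ N"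
  by (cases N) (simp_all add: theta_def)

lemma theta_inv_nth [simp]: "theta_inv f $ N = f $ N / real N"
  by (simp add: theta_inv_def)

lemma theta_mult: "theta (f * g) = theta f * g + f * theta g"
  by (simp add: theta_def algebra_simps)

lemma theta_add: "theta (f + g) = theta f + theta g"
  by (simp add: theta_def algebra_simps)

lemma theta_theta_inv: "f $ 0 = 0 \<Longrightarrow> theta (theta_inv f) = f"
  by (rule fps_ext) (metis divide_eq_0_iff nonzero_mult_div_cancel_left of_nat_eq_0_iff theta_inv_nth theta_nth times_divide_eq_right mult_zero_left)

lemma theta_inv_add: "theta_inv (f + g) = theta_inv f + theta_inv g"
  by (rule fps_ext) (simp add: add_divide_distrib)

lemma theta_eqD:
  assumes "theta f = theta g" "f $ 0 = g $ 0" shows "f = g"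
proof (rule fps_ext)
  fix N
  show "f $ N = g $ N"
    using assms(2) arg_cong[OF assms(1), of "\<lambda>h. h $ N"] by (cases N) auto
qed

lemma zgeo_mult_nth: "(zgeo * f) $ N = (\<Sum>j<N. f $ j)"
proof -
  have "(zgeo * f) $ N = (\<Sum>i=0..N. (if i = N then 0 else f $ i))"
    by (subst mult.commute, unfold fps_mult_nth zgeo_def, intro sum.cong refl) auto
  also have "\<dots> = (\<Sum>j<N. f $ j)"
    by (rule sum.mono_neutral_cong_right) auto
  finally show ?thesis .
qed

lemma theta_inv_mult:
  assumes "f $ 0 = 0" "g $ 0 = 0"
  shows "theta_inv f * theta_inv g = theta_inv (f * theta_inv g + theta_inv f * g)"
  by (rule theta_eqD) (simp_all add: theta_mult theta_theta_inv assms)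

abbreviation ywords :: "letter list set" where
  "ywords \<equiv> {w. w = [] \<or> hd w = Ly}"

text \<open>Only an initial letter x would leave a constant term, whose primitive is a logarithm of
  z. Excluding it, \<open>theta_inv\<close> really inverts \<open>theta\<close>.\<close>

lemma letter_kernel_plog_0:
  assumes "v @ [a] \<in> ywords" shows "(letter_kernel a * plog 0 v) $ 0 = 0"
proof (cases a)
  case Lx
  then obtain u c where "v = u @ [c]" using assms by (cases v rule: rev_cases) auto
  then show ?thesis using Lx by (simp add: plog_0_snoc)
qed (simp add: zgeo_def)

lemma shuffle_prod_Nil [simp]: "shuffle_prod [] w = Poly_Mapping.single w 1"
  by (cases w) auto

text \<open>The shuffle product is defined by splitting off first letters, while polylogarithms are
  differentiated by removing the last letter; this lemma reconciles the two.\<close>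

lemma shuffle_prod_snoc:
  "shuffle_prod (v @ [a]) (w @ [b]) =
     lin_ext (\<lambda>u. u @ [a]) (shuffle_prod v (w @ [b])) + lin_ext (\<lambda>u. u @ [b]) (shuffle_prod (v @ [a]) w)"
proof (induction "length v + length w" arbitrary: v w rule: less_induct)
  case less
  show ?case
  proof (cases v; cases w)
    assume "v = []" "w = []"
    then show ?thesis by (simp add: add.commute)
  next
    fix c w' assume vw: "v = []" "w = c # w'"
    from less[of "[]" w'] vw show ?thesis
      by (simp add: lin_ext_add lin_ext_lin_ext add_ac)
  next
    fix c v' assume vw: "v = c # v'" "w = []"
    from less[of v' "[]"] vw show ?thesis
      by (simp add: lin_ext_add lin_ext_lin_ext add_ac)
  next
    fix c v' d w' assume vw: "v = c # v'" "w = d # w'"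
    from less[of v' w] less[of v w'] vw show ?thesis
      by (simp add: lin_ext_add lin_ext_lin_ext add_ac)
  qed
qed

lemma shuffle_prod_keys:
  assumes "v \<in> ywords" "w \<in> ywords"
  shows "Poly_Mapping.keys (shuffle_prod v w) \<subseteq> ywords"
proof (cases "v = [] \<or> w = []")
  case True
  then show ?thesis using assms by (elim disjE) auto
next
  case False
  then obtain v' w' where "v = Ly # v'" "w = Ly # w'"
    using assms by (cases v; cases w) auto
  then have "Poly_Mapping.keys (shuffle_prod v w) \<subseteq>
      Cons Ly ` Poly_Mapping.keys (shuffle_prod v' w) \<union> Cons Ly ` Poly_Mapping.keys (shuffle_prod v w')"
    by (simp only: shuffle_prod.simps) (intro order_trans[OF keys_add] Un_mono keys_lin_ext order_refl)
  then show ?thesis by (rule order_trans) auto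
qed

definition plog_lin :: "(letter list \<Rightarrow>\<^sub>0 rat) \<Rightarrow> real fps" where
  "plog_lin p = (\<Sum>b\<in>Poly_Mapping.keys p. fps_const (of_rat (Poly_Mapping.lookup p b)) * plog 0 b)"

lemma plog_lin_nth: "plog_lin p $ N = lin_val (\<lambda>u. plog 0 u $ N) p"
  by (simp add: plog_lin_def fps_sum_nth lin_val_def)

lemma plog_lin_add: "plog_lin (p + q) = plog_lin p + plog_lin q"
  by (rule fps_ext) (simp add: plog_lin_nth lin_val_add)

lemma plog_lin_single [simp]: "plog_lin (Poly_Mapping.single w 1) = plog 0 w"
  by (rule fps_ext) (simp add: plog_lin_nth)

lemma plog_lin_snoc: "plog_lin (lin_ext (\<lambda>u. u @ [c]) p) = theta_inv (letter_kernel c * plog_lin p)"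
proof (rule fps_ext)
  fix N
  show "plog_lin (lin_ext (\<lambda>u. u @ [c]) p) $ N = theta_inv (letter_kernel c * plog_lin p) $ N"
  proof (cases c)
    case Lx
    then show ?thesis
      by (simp add: plog_lin_nth lin_val_lin_ext plog_0_snoc) (simp add: lin_val_def sum_divide_distrib)
  next
    case Ly
    then show ?thesis
      by (simp add: plog_lin_nth lin_val_lin_ext plog_0_snoc zgeo_mult_nth)
         (simp add: lin_val_def sum_divide_distrib sum_distrib_left sum.swap[of _ "{..<N}"])
  qed
qed

text \<open>Integration by parts: the product rule for \<open>theta\<close> removes the last letter
  of one factor or of the other, exactly as the shuffle recursion does.\<close>

lemma plog_mult:
  assumes "v \<in> ywords" "w \<in> ywords"
  shows "plog 0 v * plog 0 w = plog_lin (shuffle_prod v w)"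
  using assms
proof (induction "length v + length w" arbitrary: v w rule: less_induct)
  case less
  show ?case
  proof (cases v rule: rev_cases; cases w rule: rev_cases)
    fix v' a w' b assume vw: "v = v' @ [a]" "w = w' @ [b]"
    have B: "v' \<in> ywords" "w' \<in> ywords"
      using less.prems vw by (cases v'; cases w'; auto)+
    have "plog 0 v * plog 0 w = theta_inv (letter_kernel a * plog 0 v' * plog 0 w + plog 0 v * (letter_kernel b * plog 0 w'))"
      unfolding vw plog_0_snoc
      by (rule theta_inv_mult) (use letter_kernel_plog_0 less.prems vw in auto)
    also have "\<dots> = theta_inv (letter_kernel a * (plog 0 v' * plog 0 w)) + theta_inv (letter_kernel b * (plog 0 v * plog 0 w'))"
      by (simp add: theta_inv_add mult_ac)
    also have "plog 0 v' * plog 0 w = plog_lin (shuffle_prod v' w)"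
      using less.hyps[of v' w] less.prems vw B by simp
    also have "plog 0 v * plog 0 w' = plog_lin (shuffle_prod v w')"
      using less.hyps[of v w'] less.prems vw B by simp
    finally show ?thesis
      unfolding vw shuffle_prod_snoc plog_lin_add plog_lin_snoc .
  qed auto
qed

text \<open>The letter x divides the coefficient by N, and y replaces it by the mean of the N
  preceding ones, so the interval from 0 to 1 is preserved.\<close>

lemma plog_0_nth_bounds: "0 \<le> plog 0 w $ N \<and> plog 0 w $ N \<le> 1"
proof (induction w arbitrary: N rule: rev_induct)
  case Nil
  show ?case by (cases N) auto
next
  case (snoc c w)
  show ?case
  proof (cases "N = 0")
    case False
    then have N: "1 \<le> real N" by simp
    show ?thesis
    proof (cases c)
      case Lx
      have "plog 0 w $ N \<le> real N" using snoc[of N] N by linarith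
      then show ?thesis using Lx snoc[of N] False by (simp add: plog_0_snoc)
    next
      case Ly
      have "(\<Sum>j<N. plog 0 w $ j) \<le> (\<Sum>j<N. 1)" using snoc by (intro sum_mono) auto
      then show ?thesis using Ly snoc False
        by (auto simp: plog_0_snoc zgeo_mult_nth intro!: divide_nonneg_nonneg sum_nonneg)
    qed
  qed (simp add: plog_0_snoc)
qed

lemma fps_conv_radius_bounded:
  fixes f :: "real fps"
  assumes "\<And>N. \<bar>f $ N\<bar> \<le> C"
  shows "fps_conv_radius f \<ge> 1"
  unfolding fps_conv_radius_def
proof (rule conv_radius_geI_ex')
  fix r :: real assume r: "0 < r" "ereal r < 1"
  then have "r < 1" by simp
  have "summable (\<lambda>n. C * r ^ n)" using r \<open>r < 1\<close> by (intro summable_mult summable_geometric) auto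
  then show "summable (\<lambda>n. f $ n * of_real r ^ n)"
    by (rule summable_comparison_test'[where N = 0])
       (use r assms in \<open>auto simp: abs_mult intro!: mult_right_mono\<close>)
qed

lemma fps_conv_radius_plog: "fps_conv_radius (plog 0 w) \<ge> 1"
  by (rule fps_conv_radius_bounded[of _ 1]) (use plog_0_nth_bounds in \<open>auto simp: abs_le_iff intro: order_trans[of _ 0]\<close>)

lemma less_conv_radius: "fps_conv_radius f \<ge> 1 \<Longrightarrow> \<bar>z\<bar> < 1 \<Longrightarrow> ereal (norm (z::real)) < fps_conv_radius f"
  by (metis ereal_less(3) less_le_trans real_norm_def)

lemma conv_radius_ge_1_intros:
  fixes f g :: "real fps"
  shows "fps_conv_radius f \<ge> 1 \<Longrightarrow> fps_conv_radius g \<ge> 1 \<Longrightarrow> fps_conv_radius (f + g) \<ge> 1"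
    and "fps_conv_radius f \<ge> 1 \<Longrightarrow> fps_conv_radius g \<ge> 1 \<Longrightarrow> fps_conv_radius (f - g) \<ge> 1"
    and "fps_conv_radius f \<ge> 1 \<Longrightarrow> fps_conv_radius g \<ge> 1 \<Longrightarrow> fps_conv_radius (f * g) \<ge> 1"
    and "fps_conv_radius (fps_const c) \<ge> (1::ereal)"
  using fps_conv_radius_add[of f g] fps_conv_radius_diff[of f g] fps_conv_radius_mult[of f g]
  by (auto intro: order_trans[rotated])

lemma fps_conv_radius_sum:
  fixes f :: "'i \<Rightarrow> real fps"
  assumes "\<And>i. i \<in> I \<Longrightarrow> fps_conv_radius (f i) \<ge> 1"
  shows "fps_conv_radius (\<Sum>i\<in>I. f i) \<ge> 1"
  using assms by (induction I rule: infinite_finite_induct) (auto intro!: conv_radius_ge_1_intros)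

lemma eval_fps_unit_disc:
  fixes f g :: "real fps"
  assumes "\<bar>z\<bar> < 1" "fps_conv_radius f \<ge> 1"
  shows "fps_conv_radius g \<ge> 1 \<Longrightarrow> eval_fps (f + g) z = eval_fps f z + eval_fps g z"
    and "fps_conv_radius g \<ge> 1 \<Longrightarrow> eval_fps (f - g) z = eval_fps f z - eval_fps g z"
    and "fps_conv_radius g \<ge> 1 \<Longrightarrow> eval_fps (f * g) z = eval_fps f z * eval_fps g z"
    and "eval_fps (f - fps_const c) z = eval_fps f z - c"
    and "eval_fps (fps_const c * f) z = c * eval_fps f z"
proof -
  have f: "ereal (norm z) < fps_conv_radius f" using assms less_conv_radius by blast
  show "eval_fps (f - fps_const c) z = eval_fps f z - c" "eval_fps (fps_const c * f) z = c * eval_fps f z"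
    using f by (subst eval_fps_diff eval_fps_mult; simp)+
  assume "fps_conv_radius g \<ge> 1"
  then have g: "ereal (norm z) < fps_conv_radius g" using assms less_conv_radius by blast
  show "eval_fps (f + g) z = eval_fps f z + eval_fps g z" "eval_fps (f - g) z = eval_fps f z - eval_fps g z"
    "eval_fps (f * g) z = eval_fps f z * eval_fps g z"
    using f g by (rule eval_fps_add eval_fps_diff eval_fps_mult)+
qed

lemma eval_fps_sum:
  fixes f :: "'i \<Rightarrow> real fps"
  assumes "\<And>i. i \<in> I \<Longrightarrow> fps_conv_radius (f i) \<ge> 1" "\<bar>z\<bar> < 1"
  shows "eval_fps (\<Sum>i\<in>I. f i) z = (\<Sum>i\<in>I. eval_fps (f i) z)"
  using assms
proof (induction I rule: infinite_finite_induct)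
  case (insert i I)
  then show ?case by (simp add: eval_fps_unit_disc fps_conv_radius_sum)
qed auto

lemma eval_plog_lin:
  assumes "\<bar>z\<bar> < 1"
  shows "eval_fps (plog_lin p) z = lin_val (\<lambda>u. eval_fps (plog 0 u) z) p"
  unfolding plog_lin_def lin_val_def
  by (subst eval_fps_sum[OF _ assms])
     (auto intro!: conv_radius_ge_1_intros fps_conv_radius_plog sum.cong
        simp: eval_fps_unit_disc fps_conv_radius_plog assms)

subsection \<open>Behaviour at \<open>z = 1\<close>\<close>

definition logdiv :: "real \<Rightarrow> real" where
  "logdiv z = - ln (1 - z)"

lemma eventually_at_left_1: "eventually (\<lambda>z::real. 1/2 < z \<and> z < 1) (at_left 1)"
  by (rule eventually_at_leftI[of "1/2"]) auto

lemma logdiv_at_top: "filterlim logdiv at_top (at_left 1)"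
  unfolding logdiv_def by real_asymp

text \<open>A form of Abel's theorem that needs convergence of the partial sums only, so it also
  applies when the main terms of two divergent series have been subtracted.\<close>

lemma abelian_null:
  fixes f :: "real fps"
  assumes "(\<lambda>N. \<Sum>j\<le>N. f $ j) \<longlonglongrightarrow> 0"
  shows "(eval_fps f \<longlongrightarrow> 0) (at_left 1)"
proof -
  define s where "s N = (\<Sum>j\<le>N. f $ j)" for N
  define g where "g = Abs_fps s"
  have s0: "s \<longlonglongrightarrow> 0" using assms by (simp add: s_def[abs_def])
  then have "Bseq s" using convergent_imp_Bseq convergentI by blast
  then obtain K where K: "K > 0" "\<And>N. \<bar>s N\<bar> \<le> K" unfolding Bseq_def by auto
  have rg: "fps_conv_radius g \<ge> 1"
    by (rule fps_conv_radius_bounded[of _ K]) (simp add: g_def K)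
  \<comment> \<open>Summation by parts: dividing by 1 - z passes to the series of partial sums, of
    which the first \<open>M\<close> are bounded by \<open>K\<close> and the later ones by
    \<open>e\<close>.\<close>
  have fg: "f = (1 - fps_X) * g"
  proof (rule fps_ext)
    fix N show "f $ N = ((1 - fps_X) * g) $ N"
      by (cases N) (auto simp: g_def s_def left_diff_distrib)
  qed
  have ev: "\<bar>eval_fps f z\<bar> \<le> (1 - z) * (real M * K) + e"
    if z: "0 < z" "z < 1" and M: "\<And>N. N \<ge> M \<Longrightarrow> \<bar>s N\<bar> \<le> e" and e: "e > 0" for z M e
  proof -
    have r1: "fps_conv_radius (1 - fps_X :: real fps) \<ge> 1"
      using fps_conv_radius_diff[of 1 "fps_X :: real fps"] by simp
    have "eval_fps f z = (1 - z) * eval_fps g z"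
      unfolding fg using z rg r1 by (simp add: eval_fps_unit_disc eval_fps_diff)
    then have "\<bar>eval_fps f z\<bar> = (1 - z) * \<bar>eval_fps g z\<bar>" using z by (simp add: abs_mult)
    also have "\<bar>eval_fps g z\<bar> \<le> real M * K + e / (1 - z)"
    proof -
      have "(\<lambda>N. if N < M then K else 0) sums (\<Sum>N<M. K)"
        using sums_If_finite_set[of "{..<M}" "\<lambda>_. K"] by simp
      moreover have "(\<lambda>N. e * z ^ N) sums (e * (1 / (1 - z)))"
        using z by (intro sums_mult geometric_sums) auto
      ultimately have S: "(\<lambda>N. (if N < M then K else 0) + e * z ^ N) sums (real M * K + e / (1 - z))"
        using sums_add by fastforce
      have b: "\<bar>s N * z ^ N\<bar> \<le> (if N < M then K else 0) + e * z ^ N" for N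
      proof (cases "N < M")
        case True
        have "\<bar>s N\<bar> * z ^ N \<le> K * 1" using z K by (intro mult_mono power_le_one) auto
        moreover have "e * z ^ N \<ge> 0" using z e by simp
        ultimately show ?thesis using True z by (simp add: abs_mult)
      next
        case False
        then have "\<bar>s N\<bar> * z ^ N \<le> e * z ^ N" using z M by (intro mult_right_mono) auto
        then show ?thesis using False z by (simp add: abs_mult)
      qed
      have sa: "summable (\<lambda>N. \<bar>s N * z ^ N\<bar>)"
        using b by (intro summable_comparison_test'[OF sums_summable[OF S], of 0]) auto
      have "\<bar>eval_fps g z\<bar> = \<bar>suminf (\<lambda>N. s N * z ^ N)\<bar>" by (simp add: eval_fps_def g_def)
      also have "\<dots> \<le> suminf (\<lambda>N. \<bar>s N * z ^ N\<bar>)" by (rule summable_rabs[OF sa])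
      also have "\<dots> \<le> real M * K + e / (1 - z)"
        unfolding sums_unique[OF S] by (rule suminf_le[OF b sa sums_summable[OF S]])
      finally show ?thesis .
    qed
    then have "(1 - z) * \<bar>eval_fps g z\<bar> \<le> (1 - z) * (real M * K + e / (1 - z))"
      using z by (intro mult_left_mono) auto
    also have "\<dots> = (1 - z) * (real M * K) + e" using z by (simp add: field_simps)
    finally show ?thesis .
  qed
  show ?thesis
  proof (rule tendstoI)
    fix e :: real assume e: "e > 0"
    then obtain M where M: "\<And>N. N \<ge> M \<Longrightarrow> \<bar>s N\<bar> < e / 2"
      using s0[THEN LIMSEQ_D, of "e / 2"] by auto
    have "((\<lambda>z. (1 - z) * (real M * K)) \<longlongrightarrow> (1 - 1) * (real M * K)) (at_left 1)"
      by (intro tendsto_intros)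
    then have "eventually (\<lambda>z. (1 - z) * (real M * K) < e / 2) (at_left 1)"
      using e by (intro order_tendstoD(2)[where y = 0]) auto
    with eventually_at_left_1 show "eventually (\<lambda>z. dist (eval_fps f z) 0 < e) (at_left 1)"
    proof eventually_elim
      case (elim z)
      with ev[of z M "e / 2"] M e show ?case by (auto simp: dist_real_def less_imp_le)
    qed
  qed
qed

lemma index_word_append: "index_word (ks @ ls) = index_word ks @ index_word ls"
  by (induction ks) auto

lemma index_word_snoc: "index_word (ks @ [k]) = index_word ks @ [Ly] @ replicate (k - 1) Lx"
  by (simp add: index_word_append)

lemma plog_replicate_x: "plog 0 (w @ replicate j Lx) $ N = plog 0 w $ N / real N ^ j"
proof (induction j arbitrary: N)
  case (Suc j)
  have "w @ replicate (Suc j) Lx = (w @ replicate j Lx) @ [Lx]"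
    by (simp add: replicate_append_same)
  then show ?case using Suc by (simp only: plog_0_snoc) simp
qed simp

text \<open>The exponent of z is the largest summation variable. This is the bridge between the
  truncated sums and the polylogarithms.\<close>

lemma plog_partial_sums:
  assumes "is_index ks"
  shows "(\<Sum>j\<le>N. plog 0 (index_word ks) $ j) = trunc ks N"
  using assms
proof (induction ks arbitrary: N rule: rev_induct)
  case Nil
  show ?case by (simp add: sum.atMost_shift)
next
  case (snoc k ks)
  then have k: "k > 0" and ks: "is_index ks" by auto
  have c: "plog 0 (index_word (ks @ [k])) $ Suc j = trunc ks j / real (Suc j) ^ k" for j
  proof -
    have "plog 0 (index_word (ks @ [k])) $ Suc j = plog 0 (index_word ks @ [Ly]) $ Suc j / real (Suc j) ^ (k - 1)"
      using plog_replicate_x[of "index_word ks @ [Ly]" "k - 1" "Suc j"] by (simp only: index_word_snoc append_assoc)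
    also have "plog 0 (index_word ks @ [Ly]) $ Suc j = trunc ks j / real (Suc j)"
      unfolding plog_0_snoc using snoc.IH[OF ks, of j] by (simp add: zgeo_mult_nth lessThan_Suc_atMost)
    also have "trunc ks j / real (Suc j) / real (Suc j) ^ (k - 1) = trunc ks j / real (Suc j) ^ k"
      using k by (cases k) (auto simp del: of_nat_Suc)
    finally show ?thesis .
  qed
  have c0: "plog 0 (index_word (ks @ [k])) $ 0 = 0"
    using plog_replicate_x[of "index_word ks @ [Ly]" "k - 1" 0]
    by (simp only: index_word_snoc append_assoc[symmetric]) (simp add: plog_0_snoc)
  show ?case by (simp add: sum.atMost_shift c0 c trunc_snoc)
qed

lemma eval_plog_y:
  assumes "\<bar>z\<bar> < 1" shows "eval_fps (plog 0 [Ly]) z = logdiv z"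
proof -
  have nth: "plog 0 [Ly] $ N = 1 / real N" for N
    using plog_0_snoc[of "[]" Ly] by (cases N) (simp_all add: zgeo_def)
  have "(\<lambda>n. - ((- (- z)) ^ n) / real n) sums ln (1 + (- z))"
    using assms by (intro ln_series') simp
  then have "(\<lambda>n. - (- ((- (- z)) ^ n) / real n)) sums - ln (1 + (- z))" by (rule sums_minus)
  then have "(\<lambda>n. z ^ n / real n) sums logdiv z" by (simp add: logdiv_def)
  then show ?thesis by (simp add: eval_fps_def nth sums_iff)
qed

lemma plog_limit:
  assumes "admissible ks"
  shows "(eval_fps (plog 0 (index_word ks)) \<longlongrightarrow> mzv ks) (at_left 1)"
proof -
  let ?w = "index_word ks"
  have "(\<Sum>j\<le>N. (plog 0 ?w - fps_const (mzv ks)) $ j) = trunc ks N - mzv ks" for N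
    using plog_partial_sums[OF admissible_is_index[OF assms], of N] by (simp add: sum_subtractf sum.atMost_shift)
  then have "(eval_fps (plog 0 ?w - fps_const (mzv ks)) \<longlongrightarrow> 0) (at_left 1)"
    using trunc_tendsto[OF assms] by (intro abelian_null) (simp add: LIM_zero)
  then have "((\<lambda>z. eval_fps (plog 0 ?w - fps_const (mzv ks)) z + mzv ks) \<longlongrightarrow> 0 + mzv ks) (at_left 1)"
    by (intro tendsto_intros)
  moreover have "eventually (\<lambda>z. eval_fps (plog 0 ?w - fps_const (mzv ks)) z + mzv ks = eval_fps (plog 0 ?w) z) (at_left 1)"
    using eventually_at_left_1
    by eventually_elim (auto simp: eval_fps_unit_disc fps_conv_radius_plog)
  ultimately show ?thesis by (simp add: tendsto_cong)
qed

lemma eval_plog_nonneg: "0 \<le> z \<Longrightarrow> z < 1 \<Longrightarrow> eval_fps (plog 0 w) z \<ge> 0"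
  unfolding eval_fps_def using plog_0_nth_bounds
  by (intro suminf_nonneg) (auto intro!: summable_fps less_conv_radius fps_conv_radius_plog)

text \<open>The analogue of \<open>trunc_bound\<close>: the letter x does not increase coefficients,
  and y integrates C / (1 - z)^(3/2) to at most 2 C / sqrt (1 - z), so the shape of the bound
  persists for every word.\<close>

lemma plog_sqrt_bound: "\<exists>C\<ge>0. \<forall>z. 0 \<le> z \<longrightarrow> z < 1 \<longrightarrow> eval_fps (plog 0 w) z \<le> C / sqrt (1 - z)"
proof (induction w rule: rev_induct)
  case Nil
  show ?case by (rule exI[of _ 1]) auto
next
  case (snoc c w)
  then obtain C where C: "C \<ge> 0" "\<And>z. 0 \<le> z \<Longrightarrow> z < 1 \<Longrightarrow> eval_fps (plog 0 w) z \<le> C / sqrt (1 - z)" by blast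
  show ?case
  proof (cases c)
    case Lx
    have "eval_fps (plog 0 (w @ [c])) z \<le> eval_fps (plog 0 w) z" if z: "0 \<le> z" "z < 1" for z
      unfolding eval_fps_def
    proof (rule suminf_le)
      fix n
      have "plog 0 (w @ [c]) $ n \<le> plog 0 w $ n"
        using plog_0_nth_bounds[of w n] by (cases n) (auto simp: Lx plog_0_snoc divide_le_eq mult_right_le_one_le distrib_left)
      then show "plog 0 (w @ [c]) $ n * z ^ n \<le> plog 0 w $ n * z ^ n"
        using z by (intro mult_right_mono) auto
    qed (use z in \<open>auto intro!: summable_fps less_conv_radius fps_conv_radius_plog\<close>)
    with C show ?thesis by (meson order_trans)
  next
    case Ly
    define f where "f = plog 0 w"
    \<comment> \<open>The first summand has derivative C / (1 - z)^(3/2), which dominates the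
      derivative of the polylogarithm; hence \<open>h\<close> increases from a nonnegative
      value.\<close>
    define h where "h z = 2 * C / sqrt (1 - z) - eval_fps (plog 0 (w @ [c])) z" for z
    define g where "g = Abs_fps (\<lambda>_. 1 :: real)"
    have d: "fps_deriv (plog 0 (w @ [c])) = g * f"
    proof (rule fps_ext)
      fix n
      have "fps_deriv (plog 0 (w @ [c])) $ n = (\<Sum>j<Suc n. f $ j)"
        by (simp add: plog_0_snoc Ly zgeo_mult_nth f_def del: of_nat_Suc)
      also have "\<dots> = (g * f) $ n"
        by (subst mult.commute) (simp add: fps_mult_nth g_def atLeast0AtMost lessThan_Suc_atMost)
      finally show "fps_deriv (plog 0 (w @ [c])) $ n = (g * f) $ n" .
    qed
    have "fps_conv_radius g \<ge> 1" by (rule fps_conv_radius_bounded[of _ 1]) (simp add: g_def)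
    then have evd: "eval_fps (fps_deriv (plog 0 (w @ [c]))) z = eval_fps f z / (1 - z)" if "0 \<le> z" "z < 1" for z
    proof -
      have "eval_fps g z = 1 / (1 - z)" using that by (simp add: g_def eval_fps_def suminf_geometric)
      then show ?thesis
        unfolding d using that \<open>fps_conv_radius g \<ge> 1\<close>
        by (simp add: eval_fps_unit_disc fps_conv_radius_plog f_def)
    qed
    have "eval_fps (plog 0 (w @ [c])) z \<le> 2 * C / sqrt (1 - z)" if z: "0 \<le> z" "z < 1" for z
    proof -
      have "h 0 \<le> h z"
      proof (rule DERIV_nonneg_imp_nondecreasing[OF z(1)])
        fix x assume x: "0 \<le> x" "x \<le> z"
        let ?y = "C / ((1 - x) * sqrt (1 - x)) - eval_fps f x / (1 - x)"
        have x1: "x < 1" using x z by simp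
        have "(eval_fps (plog 0 (w @ [c])) has_field_derivative eval_fps f x / (1 - x)) (at x)"
          unfolding evd[OF x(1) x1, symmetric]
          by (intro has_field_derivative_eval_fps less_conv_radius fps_conv_radius_plog) (use x x1 in simp)
        then have "(h has_field_derivative ?y) (at x)"
          unfolding h_def using x1
          by (auto intro!: derivative_eq_intros simp: field_simps)
        moreover have "?y \<ge> 0"
        proof -
          have "eval_fps f x / (1 - x) \<le> C / sqrt (1 - x) / (1 - x)"
            using C(2)[OF x(1) x1] x1 unfolding f_def by (intro divide_right_mono) auto
          then show ?thesis by (simp add: mult.commute)
        qed
        ultimately show "\<exists>y. (h has_field_derivative y) (at x) \<and> y \<ge> 0" by blast
      qed
      moreover have "h 0 \<ge> 0" using C(1) by (simp add: h_def eval_fps_at_0 plog_0_snoc)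
      ultimately show ?thesis by (simp add: h_def)
    qed
    then show ?thesis using C(1) by (intro exI[of _ "2 * C"]) auto
  qed
qed

text \<open>The continuous counterpart of \<open>limit_rate_nat\<close>: integrating the bound on
  the derivative from z to 1 gives 2 C sqrt (1 - z).\<close>

lemma limit_rate_left:
  fixes f f' :: "real \<Rightarrow> real"
  assumes "\<And>z. 1/2 < z \<Longrightarrow> z < 1 \<Longrightarrow> (f has_real_derivative f' z) (at z)"
    and "\<And>z. 1/2 < z \<Longrightarrow> z < 1 \<Longrightarrow> 0 \<le> f' z \<and> f' z \<le> C / sqrt (1 - z)"
    and "(f \<longlongrightarrow> c) (at_left 1)" "1/2 < z" "z < 1"
  shows "\<bar>f z - c\<bar> \<le> 2 * C * sqrt (1 - z)"
proof -
  define h where "h z = f z + 2 * C * sqrt (1 - z)" for z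
  have ev: "eventually (\<lambda>s. z < s \<and> s < 1) (at_left 1)"
    by (rule eventually_at_leftI[of z]) (use assms in auto)
  have "f z \<le> f s" if "z < s" "s < 1" for s
  proof (rule DERIV_nonneg_imp_nondecreasing[of z s f])
    fix x assume "z \<le> x" "x \<le> s"
    then have x: "1/2 < x" "x < 1" using that assms(4) by linarith+
    then show "\<exists>y. (f has_real_derivative y) (at x) \<and> y \<ge> 0"
      using assms(1)[OF x] assms(2)[OF x] by blast
  qed (use that in simp)
  then have "f z \<le> c"
    by (intro tendsto_lowerbound[OF assms(3)] eventually_mono[OF ev]) auto
  moreover have "h s \<le> h z" if s: "z < s" "s < 1" for s
  proof (rule DERIV_nonpos_imp_nonincreasing[of z s h])
    fix x assume x: "z \<le> x" "x \<le> s"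
    then have x': "1/2 < x" "x < 1" using s assms by auto
    have "(h has_real_derivative f' x - C / sqrt (1 - x)) (at x)"
      unfolding h_def using assms(1)[OF x'] x' by (auto intro!: derivative_eq_intros simp: field_simps)
    then show "\<exists>y. (h has_real_derivative y) (at x) \<and> y \<le> 0"
      using assms(2)[OF x'] by (intro exI[of _ "f' x - C / sqrt (1 - x)"]) auto
  qed (use s in auto)
  moreover have "(h \<longlongrightarrow> c + 2 * C * sqrt (1 - 1)) (at_left 1)"
    unfolding h_def by (intro tendsto_intros assms)
  ultimately have "c \<le> h z"
    by (intro tendsto_upperbound[of h c "at_left 1"] eventually_mono[OF ev]) auto
  with \<open>f z \<le> c\<close> show ?thesis by (simp add: h_def abs_le_iff)
qed

lemma index_word_ywords: "index_word ks \<in> ywords"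
  by (cases ks) auto

text \<open>A nonempty admissible word ends in x, so the derivative is a polylogarithm divided by z.
  It has an integrable singularity of square root type at 1, which yields a rate; restricting to z >
  1/2 bounds 1 / z by 2.\<close>

lemma negl_plog:
  assumes "admissible ks"
  shows "negl (at_left 1) logdiv (\<lambda>z. eval_fps (plog 0 (index_word ks)) z - mzv ks)"
proof (cases ks rule: rev_cases)
  case Nil
  then show ?thesis by simp
next
  case (snoc ls k)
  have k: "k \<ge> 2" using assms snoc by (simp add: admissible_def)
  obtain j where j: "k = Suc (Suc j)" using k by (metis add_2_eq_Suc le_Suc_ex)
  define w where "w = index_word ls @ [Ly] @ replicate j Lx"
  have w: "index_word ks = w @ [Lx]"
    by (simp add: snoc index_word_snoc w_def j replicate_append_same)
  have "w @ [Lx] \<in> ywords" unfolding w[symmetric] by (rule index_word_ywords)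
  then have w0: "plog 0 w $ 0 = 0" using letter_kernel_plog_0[of w Lx] by simp
  obtain C where C: "C \<ge> 0" "\<And>z. 0 \<le> z \<Longrightarrow> z < 1 \<Longrightarrow> eval_fps (plog 0 w) z \<le> C / sqrt (1 - z)"
    using plog_sqrt_bound[of w] by blast
  have "theta (plog 0 (w @ [Lx])) = plog 0 w"
    unfolding plog_0_snoc by (simp add: theta_theta_inv w0)
  then have th: "fps_X * fps_deriv (plog 0 (w @ [Lx])) = plog 0 w" by (simp add: theta_def)
  have rd: "fps_conv_radius (fps_deriv (plog 0 (w @ [Lx]))) \<ge> 1"
    using fps_conv_radius_deriv fps_conv_radius_plog by (rule order_trans[rotated])
  have evd: "eval_fps (fps_deriv (plog 0 (w @ [Lx]))) z = eval_fps (plog 0 w) z / z" if "0 < z" "z < 1" for z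
    using that rd unfolding th[symmetric] by (simp add: eval_fps_unit_disc)
  have bound: "\<bar>eval_fps (plog 0 (w @ [Lx])) z - mzv ks\<bar> \<le> 2 * (2 * C) * sqrt (1 - z)" if "1/2 < z" "z < 1" for z
  proof (rule limit_rate_left[OF _ _ _ that])
    show "(eval_fps (plog 0 (w @ [Lx])) \<longlongrightarrow> mzv ks) (at_left 1)"
      using plog_limit[OF assms] w by simp
    fix x :: real assume x: "1/2 < x" "x < 1"
    then have x0: "0 < x" by simp
    show "(eval_fps (plog 0 (w @ [Lx])) has_real_derivative eval_fps (plog 0 w) x / x) (at x)"
      unfolding evd[OF x0 x(2), symmetric]
      by (intro has_field_derivative_eval_fps less_conv_radius fps_conv_radius_plog) (use x in simp)
    have n: "eval_fps (plog 0 w) x \<ge> 0" by (rule eval_plog_nonneg) (use x in auto)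
    have "eval_fps (plog 0 w) x / x \<le> (C / sqrt (1 - x)) / (1/2)"
      using x C n by (intro frac_le) auto
    also have "\<dots> = 2 * C / sqrt (1 - x)" by simp
    finally have "eval_fps (plog 0 w) x / x \<le> 2 * C / sqrt (1 - x)" .
    with n x show "0 \<le> eval_fps (plog 0 w) x / x \<and> eval_fps (plog 0 w) x / x \<le> 2 * C / sqrt (1 - x)" by simp
  qed
  show ?thesis
  proof (rule negl_bound[OF logdiv_at_top])
    show "eventually (\<lambda>z. \<bar>eval_fps (plog 0 (index_word ks)) z - mzv ks\<bar> \<le> (4 * C) * exp (- logdiv z / 2)) (at_left 1)"
      using eventually_at_left_1
    proof eventually_elim
      case (elim z)
      have "exp (- logdiv z / 2) = sqrt (1 - z)"
        using elim by (simp add: logdiv_def flip: ln_sqrt)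
      then show ?case using bound[of z] elim w by simp
    qed
  qed
qed

subsection \<open>The shuffle regularization\<close>

lemma ywords_index_word:
  assumes "w \<in> ywords" shows "\<exists>ks. is_index ks \<and> w = index_word ks"
  using assms
proof (induction w rule: rev_induct)
  case Nil
  show ?case by (intro exI[of _ "[]"]) simp
next
  case (snoc c w)
  then have "w \<in> ywords" by (cases w) auto
  then obtain ks where ks: "is_index ks" "w = index_word ks" using snoc.IH by blast
  show ?case
  proof (cases c)
    case Ly
    then show ?thesis using ks by (intro exI[of _ "ks @ [1]"]) (simp add: index_word_snoc)
  next
    case Lx
    then obtain ls l where l: "ks = ls @ [l]"
      using ks snoc.prems by (cases ks rule: rev_cases) auto
    then have "l > 0" using ks by simp
    then have "replicate l Lx = replicate (l - 1) Lx @ [Lx]"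
      by (metis Suc_pred' replicate_Suc replicate_append_same)
    then show ?thesis using ks l Lx
      by (intro exI[of _ "ls @ [Suc l]"]) (simp add: index_word_snoc)
  qed
qed

text \<open>As for the harmonic product: the final run of s letters y admits s + 1 equal insertions,
  and any other insertion leaves the run unchanged.\<close>

lemma shuffle_prod_y:
  assumes "w \<in> ywords"
  shows "\<exists>q. shuffle_prod [Ly] w = Poly_Mapping.single (w @ [Ly]) (of_nat (Suc (trailing Ly w))) + q \<and>
     Poly_Mapping.keys q \<subseteq> {u \<in> ywords. trailing Ly u \<le> trailing Ly w}"
  using assms
proof (induction w rule: rev_induct)
  case Nil
  show ?case by (intro exI[of _ 0]) simp
next
  case (snoc b w)
  have w: "w \<in> ywords" using snoc.prems by (cases w) auto
  then obtain q where q: "shuffle_prod [Ly] w = Poly_Mapping.single (w @ [Ly]) (of_nat (Suc (trailing Ly w))) + q"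
     "Poly_Mapping.keys q \<subseteq> {u \<in> ywords. trailing Ly u \<le> trailing Ly w}" using snoc by blast
  have h: "shuffle_prod [Ly] (w @ [b]) = Poly_Mapping.single (w @ [b] @ [Ly]) 1 + lin_ext (\<lambda>w. w @ [b]) (shuffle_prod [Ly] w)"
    using shuffle_prod_snoc[of "[]" Ly w b] by simp
  show ?case
  proof (cases "b = Ly")
    case True
    define q' where "q' = lin_ext (\<lambda>w. w @ [b]) q"
    let ?w = "w @ [b] @ [Ly]"
    have "Poly_Mapping.single ?w (of_nat (Suc (trailing Ly (w @ [b]))) :: rat)
        = Poly_Mapping.single ?w 1 + Poly_Mapping.single ?w (of_nat (Suc (trailing Ly w)))"
      using True by (subst single_add[symmetric]) simp
    then have "shuffle_prod [Ly] (w @ [b]) = Poly_Mapping.single ((w @ [b]) @ [Ly]) (of_nat (Suc (trailing Ly (w @ [b])))) + q'"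
      using True unfolding h q(1) lin_ext_add q'_def by (simp only: lin_ext_single append_assoc add_ac)
    moreover have "Poly_Mapping.keys q' \<subseteq> (\<lambda>w. w @ [b]) ` Poly_Mapping.keys q"
      unfolding q'_def by (rule keys_lin_ext)
    then have "Poly_Mapping.keys q' \<subseteq> {u \<in> ywords. trailing Ly u \<le> trailing Ly (w @ [b])}"
      by (rule order_trans) (use q(2) True in \<open>auto simp: hd_append split: if_splits\<close>)
    ultimately show ?thesis by blast
  next
    case False
    then have wne: "w \<noteq> []" using snoc.prems by auto
    define q' where "q' = lin_ext (\<lambda>w. w @ [b]) (shuffle_prod [Ly] w)"
    have "shuffle_prod [Ly] (w @ [b]) = Poly_Mapping.single ((w @ [b]) @ [Ly]) (of_nat (Suc (trailing Ly (w @ [b])))) + q'"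
      using False unfolding h q'_def by simp
    moreover have sub: "Poly_Mapping.keys q' \<subseteq> (\<lambda>w. w @ [b]) ` Poly_Mapping.keys (shuffle_prod [Ly] w)"
      unfolding q'_def by (rule keys_lin_ext)
    \<comment> \<open>The empty word has to be excluded, since appending x to it would leave
      \<open>ywords\<close>.\<close>
    have ne: "[] \<notin> Poly_Mapping.keys (shuffle_prod [Ly] w)"
    proof -
      obtain c w' where c: "w = c # w'" using wne by (cases w) auto
      have "Poly_Mapping.keys (shuffle_prod [Ly] w) \<subseteq>
          Cons Ly ` Poly_Mapping.keys (shuffle_prod [] w) \<union> Cons c ` Poly_Mapping.keys (shuffle_prod [Ly] w')"
        unfolding c shuffle_prod.simps
        by (intro order_trans[OF keys_add] Un_mono keys_lin_ext order_refl)
      then show ?thesis by auto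
    qed
    have "Poly_Mapping.keys q' \<subseteq> {u \<in> ywords. trailing Ly u \<le> trailing Ly (w @ [b])}"
    proof
      fix u assume "u \<in> Poly_Mapping.keys q'"
      then obtain x where x: "u = x @ [b]" "x \<in> Poly_Mapping.keys (shuffle_prod [Ly] w)" using sub by blast
      have "x \<in> ywords" using shuffle_prod_keys[of "[Ly]" w] w x(2) by auto
      moreover have "x \<noteq> []" using ne x(2) by auto
      ultimately show "u \<in> {u \<in> ywords. trailing Ly u \<le> trailing Ly (w @ [b])}"
        using False x(1) by simp
    qed
    ultimately show ?thesis by blast
  qed
qed

interpretation shuffle: regularization ywords shuffle_prod index_word "trailing Ly"
    "\<lambda>w. w @ [Ly]" "\<lambda>w. eval_fps (plog 0 w)" "at_left 1" logdiv
proof (unfold_locales, goal_cases)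
  case (5 b)
  then show ?case using shuffle_prod_y[of b] by simp
next
  case (6 c k)
  then obtain b where b: "c = b @ [Ly]" by (cases c rule: rev_cases) (auto split: if_splits)
  with 6 have "b \<in> ywords" by (cases b) auto
  with b 6 show ?case by auto
next
  case (7 c)
  then obtain ks where ks: "is_index ks" "c = index_word ks" using ywords_index_word by blast
  have "admissible ks"
  proof (cases ks rule: rev_cases)
    case (snoc ls l)
    have "l \<noteq> 1"
    proof
      assume "l = 1"
      then have "c = index_word ls @ [Ly]" by (simp add: ks(2) snoc index_word_snoc)
      with 7(2) show False by simp
    qed
    then show ?thesis using ks snoc by (auto simp: admissible_def)
  qed (simp add: admissible_def)
  with ks show ?case by blast
next
  case (8 a b)
  then show ?case by (rule shuffle_prod_keys)
next
  case (9 a b)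
  show ?case using eventually_at_left_1
  proof eventually_elim
    case (elim z)
    then have "eval_fps (plog 0 a) z * eval_fps (plog 0 b) z = eval_fps (plog 0 a * plog 0 b) z"
      by (simp add: eval_fps_unit_disc fps_conv_radius_plog)
    also have "\<dots> = lin_val (\<lambda>u. eval_fps (plog 0 u) z) (shuffle_prod a b)"
      unfolding plog_mult[OF 9] using elim by (intro eval_plog_lin) auto
    finally show ?case .
  qed
next
  case 10
  show ?case using eventually_at_left_1 by eventually_elim (simp add: eval_plog_y)
next
  case (4 ks)
  show ?case by (rule index_word_ywords)
qed (auto simp: logdiv_at_top negl_plog)

lemma zeta_reg_Shuffle: "zeta_reg Shuffle ks = reg_val (at_left 1) logdiv (eval_fps (plog 0 (index_word ks)))"
  using index_word_ywords[of ks] by (simp add: shuffle_reg_def shuffle.the_regularization shuffle.reg_single)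

subsection \<open>Regularized values of power series\<close>

text \<open>The condition on the radius makes evaluation in the unit disc compatible with sums and
  products, so that \<open>fps_reg\<close> is a ring homomorphism on these series.\<close>

definition regular :: "real fps \<Rightarrow> bool" where
  "regular f \<longleftrightarrow> fps_conv_radius f \<ge> 1 \<and> (\<exists>Q. has_reg (at_left 1) logdiv (eval_fps f) Q)"

definition fps_reg :: "real fps \<Rightarrow> real" where
  "fps_reg f = reg_val (at_left 1) logdiv (eval_fps f)"

lemma fps_reg_eq: "has_reg (at_left 1) logdiv (eval_fps f) Q \<Longrightarrow> fps_reg f = poly Q 0"
  unfolding fps_reg_def by (rule reg_val_eq[OF shuffle.nonbot logdiv_at_top])

lemma eventually_left_unit_disc: "eventually (\<lambda>z::real. \<bar>z\<bar> < 1) (at_left 1)"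
  using eventually_at_left_1 by eventually_elim auto

lemma has_reg_eval_add:
  assumes "fps_conv_radius f \<ge> 1" "fps_conv_radius g \<ge> 1"
    "has_reg (at_left 1) logdiv (eval_fps f) P" "has_reg (at_left 1) logdiv (eval_fps g) Q"
  shows "has_reg (at_left 1) logdiv (eval_fps (f + g)) (P + Q)"
proof (rule has_reg_cong[OF _ has_reg_add[OF assms(3,4)]])
  show "eventually (\<lambda>z. eval_fps f z + eval_fps g z = eval_fps (f + g) z) (at_left 1)"
    using eventually_left_unit_disc by eventually_elim (simp add: eval_fps_unit_disc assms)
qed

lemma has_reg_eval_mult:
  assumes "fps_conv_radius f \<ge> 1" "fps_conv_radius g \<ge> 1"
    "has_reg (at_left 1) logdiv (eval_fps f) P" "has_reg (at_left 1) logdiv (eval_fps g) Q"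
  shows "has_reg (at_left 1) logdiv (eval_fps (f * g)) (P * Q)"
proof (rule has_reg_cong[OF _ has_reg_mult[OF assms(3,4)]])
  show "eventually (\<lambda>z. eval_fps f z * eval_fps g z = eval_fps (f * g) z) (at_left 1)"
    using eventually_left_unit_disc by eventually_elim (simp add: eval_fps_unit_disc assms)
qed

lemma has_reg_eval_const: "has_reg (at_left 1) logdiv (eval_fps (fps_const c)) [:c:]"
  by (rule has_reg_cong[OF _ has_reg_const]) simp

lemma regular_const [intro]: "regular (fps_const c)"
  using has_reg_eval_const conv_radius_ge_1_intros(4) by (auto simp: regular_def)

lemma regular_add [intro]: "regular f \<Longrightarrow> regular g \<Longrightarrow> regular (f + g)"
  unfolding regular_def using has_reg_eval_add conv_radius_ge_1_intros(1) by blast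

lemma regular_mult [intro]: "regular f \<Longrightarrow> regular g \<Longrightarrow> regular (f * g)"
  unfolding regular_def using has_reg_eval_mult conv_radius_ge_1_intros(3) by blast

lemma regular_0 [intro, simp]: "regular 0" and regular_1 [intro, simp]: "regular 1"
  using regular_const[of 0] regular_const[of 1] by simp_all

lemma fps_reg_const [simp]: "fps_reg (fps_const c) = c"
  using fps_reg_eq[OF has_reg_eval_const] by simp

lemma fps_reg_0 [simp]: "fps_reg 0 = 0" and fps_reg_1 [simp]: "fps_reg 1 = 1"
  using fps_reg_const[of 0] fps_reg_const[of 1] by simp_all

lemma fps_reg_add: "regular f \<Longrightarrow> regular g \<Longrightarrow> fps_reg (f + g) = fps_reg f + fps_reg g"
  unfolding regular_def using fps_reg_eq has_reg_eval_add by fastforce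

lemma fps_reg_mult: "regular f \<Longrightarrow> regular g \<Longrightarrow> fps_reg (f * g) = fps_reg f * fps_reg g"
  unfolding regular_def using fps_reg_eq has_reg_eval_mult by fastforce

lemma regular_sum [intro]: "(\<And>i. i \<in> I \<Longrightarrow> regular (f i)) \<Longrightarrow> regular (\<Sum>i\<in>I. f i)"
  by (induction I rule: infinite_finite_induct) auto

lemma fps_reg_sum: "(\<And>i. i \<in> I \<Longrightarrow> regular (f i)) \<Longrightarrow> fps_reg (\<Sum>i\<in>I. f i) = (\<Sum>i\<in>I. fps_reg (f i))"
  by (induction I rule: infinite_finite_induct) (auto simp: fps_reg_add regular_sum)

lemma regular_plog_0: "w \<in> ywords \<Longrightarrow> regular (plog 0 w)"
  unfolding regular_def using fps_conv_radius_plog shuffle.has_reg_T by blast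

lemma fps_reg_plog_0: "fps_reg (plog 0 (index_word ks)) = zeta_reg Shuffle ks"
  by (simp add: fps_reg_def zeta_reg_Shuffle del: zeta_reg.simps)

text \<open>The recursion of the \<open>t\<close>-expansion of \<open>s(t) / (M - t)^(i+1)\<close>.\<close>

lemma shift_recursion:
  fixes c :: "nat \<Rightarrow> nat \<Rightarrow> real"
  assumes "\<And>m. c 0 m = (S m + (if m = 0 then 0 else c 0 (m - 1))) / M"
    and "\<And>i m. c (Suc i) m = (c i m + (if m = 0 then 0 else c (Suc i) (m - 1))) / M"
  shows "c i m = (\<Sum>l\<le>m. real ((i + l) choose l) / M ^ (Suc i + l) * S (m - l))"
proof (induction i arbitrary: m)
  case 0
  show ?case
  proof (induction m)
    case (Suc m)
    have "c 0 (Suc m) = S (Suc m) / M + c 0 m / M" using assms(1)[of "Suc m"] by (simp add: add_divide_distrib)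
    then show ?case
      unfolding sum.atMost_Suc_shift Suc sum_divide_distrib by (simp add: mult_ac)
  qed (use assms(1)[of 0] in simp)
next
  case (Suc i)
  show ?case
  proof (induction m)
    case 0
    show ?case using assms(2)[of i 0] Suc[of 0] by simp
  next
    case (Suc m)
    have "c (Suc i) (Suc m) = c i (Suc m) / M + c (Suc i) m / M"
      using assms(2)[of i "Suc m"] by (simp add: add_divide_distrib)
    also have "\<dots> = S (Suc m) / M ^ Suc (Suc i) +
       ((\<Sum>l\<le>m. real ((i + Suc l) choose Suc l) / M ^ (Suc (Suc i) + Suc l) * S (m - l))
       + (\<Sum>l\<le>m. real ((Suc i + l) choose l) / M ^ (Suc (Suc i) + Suc l) * S (m - l)))"
      unfolding Suc.IH \<open>\<And>m. c i m = _\<close> sum.atMost_Suc_shift sum_divide_distrib add_divide_distrib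
      by (simp add: mult_ac)
    also have "\<dots> = S (Suc m) / M ^ Suc (Suc i) +
       (\<Sum>l\<le>m. real ((Suc i + Suc l) choose Suc l) / M ^ (Suc (Suc i) + Suc l) * S (m - l))"
      unfolding sum.distrib[symmetric] by (simp add: add_divide_distrib distrib_right add_ac)
    finally show ?case unfolding sum.atMost_Suc_shift by simp
  qed
qed

lemma plog_snoc_nth:
  "plog m (w @ [a]) $ N = ((letter_kernel a * plog m w) $ N + (if m = 0 then 0 else plog (m - 1) (w @ [a]) $ N)) / real N"
  by (cases m) (simp_all add: plog_0_snoc plog_Suc_snoc)

text \<open>The block y x^(k-1) contributes 1 / (M - t)^k at M = N + 1, whose t^l-coefficient is the
  binomial coefficient divided by M^(k+l). The remaining orders go to the earlier variables.\<close>

lemma plog_index_word_snoc_nth: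
  assumes "k > 0"
  shows "plog m (index_word (ks @ [k])) $ Suc N = (\<Sum>l\<le>m. real ((k + l - 1) choose l) / real (Suc N) ^ (k + l)
           * (\<Sum>j\<le>N. plog (m - l) (index_word ks) $ j))"
    and "plog m (index_word (ks @ [k])) $ 0 = 0"
proof -
  obtain i where k: "k = Suc i" using assms gr0_implies_Suc by blast
  define v where "v = index_word ks"
  have snoc: "v @ Ly # replicate (Suc i) Lx = (v @ Ly # replicate i Lx) @ [Lx]" for i
    by (simp add: replicate_append_same)
  have "plog m (v @ Ly # replicate i Lx) $ Suc N =
      (\<Sum>l\<le>m. real ((i + l) choose l) / real (Suc N) ^ (Suc i + l) * (\<Sum>j\<le>N. plog (m - l) v $ j))"
  proof (rule shift_recursion[where c = "\<lambda>i m. plog m (v @ Ly # replicate i Lx) $ Suc N"], goal_cases)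
    case (1 m)
    show ?case using plog_snoc_nth[of m v Ly "Suc N"] by (simp add: zgeo_mult_nth lessThan_Suc_atMost)
  next
    case (2 i m)
    show ?case unfolding snoc by (subst plog_snoc_nth) simp
  qed
  then show "plog m (index_word (ks @ [k])) $ Suc N = (\<Sum>l\<le>m. real ((k + l - 1) choose l) / real (Suc N) ^ (k + l)
           * (\<Sum>j\<le>N. plog (m - l) (index_word ks) $ j))"
    by (simp add: k index_word_snoc v_def)
  have "index_word (ks @ [k]) \<noteq> []" by (simp add: index_word_snoc)
  then obtain w a where "index_word (ks @ [k]) = w @ [a]" by (metis rev_exhaust)
  then show "plog m (index_word (ks @ [k])) $ 0 = 0" by (simp add: plog_snoc_nth)
qed

abbreviation shifts :: "nat \<Rightarrow> nat \<Rightarrow> nat list set" where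
  "shifts r m \<equiv> {ls. length ls = r \<and> sum_list ls = m}"

lemma finite_shifts: "finite (shifts r m)"
  by (rule finite_subset[OF _ finite_lists_length_eq[of "{..m}" r]]) (auto simp: member_le_sum_list)

lemma shifts_Suc: "shifts (Suc r) m = (\<lambda>(l, ls). ls @ [l]) ` (SIGMA l:{..m}. shifts r (m - l))"
proof
  show "shifts (Suc r) m \<subseteq> (\<lambda>(l, ls). ls @ [l]) ` (SIGMA l:{..m}. shifts r (m - l))"
  proof
    fix ls assume ls: "ls \<in> shifts (Suc r) m"
    then obtain ls' l where "ls = ls' @ [l]" by (cases ls rule: rev_cases) auto
    with ls show "ls \<in> (\<lambda>(l, ls). ls @ [l]) ` (SIGMA l:{..m}. shifts r (m - l))"
      by (intro image_eqI[of _ _ "(l, ls')"]) auto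
  qed
qed auto

definition shift_weight :: "nat list \<Rightarrow> nat list \<Rightarrow> real" where
  "shift_weight ks ls = (\<Prod>i<length ks. real ((ks ! i + ls ! i - 1) choose (ls ! i)))"

lemma shift_weight_snoc:
  "length ls = length ks \<Longrightarrow>
     shift_weight (ks @ [k]) (ls @ [l]) = shift_weight ks ls * real ((k + l - 1) choose l)"
  by (simp add: shift_weight_def nth_append)

text \<open>Expanding every factor 1 / (n_i - t)^(k_i) distributes the order \<open>m\<close> over
  the entries with exactly the weights of \<open>zeta_shift\<close>, which thereby becomes the
  regularized value of one series.\<close>

lemma plog_index_word:
  assumes "is_index ks"
  shows "plog m (index_word ks) =
    (\<Sum>ls\<in>shifts (length ks) m. fps_const (shift_weight ks ls) * plog 0 (index_word (map2 (+) ks ls)))"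
  using assms
proof (induction ks arbitrary: m rule: rev_induct)
  case Nil
  have "shifts 0 m = (if m = 0 then {[]} else {})" by auto
  then show ?case by (simp add: shift_weight_def)
next
  case (snoc k ks)
  then have k: "k > 0" and ks: "is_index ks" by auto
  let ?R = "\<Sum>ls\<in>shifts (length (ks @ [k])) m. fps_const (shift_weight (ks @ [k]) ls) * plog 0 (index_word (map2 (+) (ks @ [k]) ls))"
  have R: "?R = (\<Sum>l\<le>m. \<Sum>ls\<in>shifts (length ks) (m - l). fps_const (shift_weight ks ls * real ((k + l - 1) choose l))
       * plog 0 (index_word (map2 (+) ks ls @ [k + l])))"
  proof -
    have "?R = (\<Sum>(l, ls)\<in>(SIGMA l:{..m}. shifts (length ks) (m - l)). fps_const (shift_weight (ks @ [k]) (ls @ [l])) * plog 0 (index_word (map2 (+) (ks @ [k]) (ls @ [l]))))"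
      by (simp only: length_append list.size One_nat_def add_Suc_right add_0_right shifts_Suc)
         (subst sum.reindex, auto simp: inj_on_def case_prod_unfold)
    also have "\<dots> = (\<Sum>(l, ls)\<in>(SIGMA l:{..m}. shifts (length ks) (m - l)). fps_const (shift_weight ks ls * real ((k + l - 1) choose l))
       * plog 0 (index_word (map2 (+) ks ls @ [k + l])))"
      by (intro sum.cong refl) (auto simp: shift_weight_snoc)
    also have "\<dots> = (\<Sum>l\<le>m. \<Sum>ls\<in>shifts (length ks) (m - l). fps_const (shift_weight ks ls * real ((k + l - 1) choose l))
       * plog 0 (index_word (map2 (+) ks ls @ [k + l])))"
      by (rule sum.Sigma[symmetric]) (auto simp: finite_shifts)
    finally show ?thesis .
  qed
  show ?case unfolding R
  proof (rule fps_ext)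
    fix N
    show "plog m (index_word (ks @ [k])) $ N = (\<Sum>l\<le>m. \<Sum>ls\<in>shifts (length ks) (m - l).
       fps_const (shift_weight ks ls * real ((k + l - 1) choose l)) * plog 0 (index_word (map2 (+) ks ls @ [k + l]))) $ N"
    proof (cases N)
      case 0
      then show ?thesis using k by (simp add: fps_sum_nth plog_index_word_snoc_nth(2))
    next
      case (Suc M)
      have "real ((k + l - 1) choose l) / real (Suc M) ^ (k + l) * (\<Sum>j\<le>M. plog (m - l) (index_word ks) $ j)
          = (\<Sum>ls\<in>shifts (length ks) (m - l). shift_weight ks ls * real ((k + l - 1) choose l)
              * plog 0 (index_word (map2 (+) ks ls @ [k + l])) $ Suc M)" for l
      proof -
        have "(\<Sum>j\<le>M. plog (m - l) (index_word ks) $ j) =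
            (\<Sum>ls\<in>shifts (length ks) (m - l). \<Sum>j\<le>M. shift_weight ks ls * plog 0 (index_word (map2 (+) ks ls)) $ j)"
          by (subst sum.swap) (simp add: snoc.IH[OF ks] fps_sum_nth)
        moreover have "plog 0 (index_word (us @ [k + l])) $ Suc M = (\<Sum>j\<le>M. plog 0 (index_word us) $ j) / real (Suc M) ^ (k + l)" for us
          using k by (subst plog_index_word_snoc_nth(1)) simp_all
        ultimately show ?thesis
          by (simp add: sum_distrib_left sum_divide_distrib mult_ac del: of_nat_Suc)
      qed
      then show ?thesis
        using k by (simp only: Suc plog_index_word_snoc_nth(1)[OF k] fps_sum_nth fps_mult_left_const_nth)
    qed
  qed
qed

lemma regular_plog: "w \<in> ywords \<Longrightarrow> regular (plog m w)"
proof -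
  assume "w \<in> ywords"
  then obtain ks where ks: "is_index ks" "w = index_word ks" using ywords_index_word by blast
  show ?thesis unfolding ks(2) plog_index_word[OF ks(1)]
    by (intro regular_sum regular_mult regular_const regular_plog_0 index_word_ywords)
qed

lemma fps_reg_plog:
  assumes "is_index ks"
  shows "fps_reg (plog m (index_word ks)) = zeta_shift Shuffle m ks"
  unfolding plog_index_word[OF assms] zeta_shift_def
  by (subst fps_reg_sum)
     (auto simp: fps_reg_mult regular_const regular_plog_0[OF index_word_ywords] fps_reg_plog_0
        shift_weight_def mult.commute simp del: zeta_reg.simps)

subsection \<open>Both regularizations agree on indices with at most one trailing one\<close>

lemma zeta_reg_admissible: "admissible ks \<Longrightarrow> zeta_reg b ks = mzv ks"
proof (cases b)
  case Harmonic
  assume "admissible ks"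
  then show ?thesis
    using reg_val_eq[OF harmonic.nonbot harmonic.l_at_top harmonic.has_reg_e[of ks]]
    by (simp add: Harmonic zeta_reg_Harmonic admissible_is_index del: zeta_reg.simps)
next
  case Shuffle
  assume "admissible ks"
  then show ?thesis
    using reg_val_eq[OF shuffle.nonbot shuffle.l_at_top shuffle.has_reg_e[of ks]]
    by (simp add: Shuffle zeta_reg_Shuffle del: zeta_reg.simps)
qed

text \<open>The truncated sum is c1 * harm + c0 up to a null sequence. As \<open>harm\<close>
  consists of the partial sums of the coefficients of \<open>logdiv\<close>, Abel summation turns
  this into the expansion c1 * logdiv + c0 of the polylogarithm. Powers of \<open>harm\<close> and
  \<open>logdiv\<close> do not correspond in this way, hence the restriction to one trailing
  1.\<close>

lemma zeta_reg_trailing_one: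
  assumes "admissible ks"
  shows "zeta_reg Harmonic (ks @ [1]) = zeta_reg Shuffle (ks @ [1])"
proof -
  have t0: "trailing 1 u = 0 \<longleftrightarrow> admissible u" if "is_index u" for u
    using that by (cases u rule: rev_cases) (auto simp: admissible_def)
  have ind: "is_index ks" using assms by (rule admissible_is_index)
  obtain q where q: "harmonic_prod [1] ks = Poly_Mapping.single (ks @ [1]) 1 + q"
    "Poly_Mapping.keys q \<subseteq> {u. admissible u}"
    using harmonic_prod_one[OF ind] t0[OF ind] assms t0 by fastforce
  define c1 where "c1 = mzv ks"
  define Q0 where "Q0 = (\<Sum>b\<in>Poly_Mapping.keys q. [:of_rat (Poly_Mapping.lookup q b):] * [:mzv b:])"
  define c0 where "c0 = - poly Q0 0"
  have Q0: "Q0 = [:- c0:]"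
  proof -
    have "Q0 = (\<Sum>b\<in>Poly_Mapping.keys q. [:of_rat (Poly_Mapping.lookup q b) * mzv b:])"
      by (simp add: Q0_def mult.commute)
    also have "\<dots> = [:\<Sum>b\<in>Poly_Mapping.keys q. of_rat (Poly_Mapping.lookup q b) * mzv b:]"
      by (induction rule: infinite_finite_induct) auto
    finally show ?thesis by (simp add: c0_def)
  qed
  have "has_reg sequentially harm (\<lambda>N. lin_val (\<lambda>u. trunc u N) q) Q0"
    unfolding Q0_def by (rule harmonic.has_reg_lin_val) (use q(2) harmonic.has_reg_e in auto)
  then have "has_reg sequentially harm (\<lambda>N. harm N * trunc ks N + (-1) * lin_val (\<lambda>u. trunc u N) q)
      ([:0, 1:] * [:c1:] + [:-1:] * Q0)"
    unfolding c1_def by (intro has_reg_add has_reg_mult has_reg_const has_reg_log harmonic.has_reg_e assms)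
  moreover have "harm N * trunc ks N + (-1) * lin_val (\<lambda>u. trunc u N) q = trunc (ks @ [1]) N" for N
    using trunc_harmonic_prod[of "[1]" N ks] unfolding q(1) by (simp add: lin_val_add trunc_one[unfolded One_nat_def])
  moreover have "[:0, 1:] * [:c1:] + [:-1:] * Q0 = [:c0, c1:]" by (simp add: Q0)
  ultimately have h: "has_reg sequentially harm (trunc (ks @ [1])) [:c0, c1:]" by simp
  then have H: "zeta_reg Harmonic (ks @ [1]) = c0"
    using reg_val_eq[OF harmonic.nonbot harmonic.l_at_top h] ind
    by (simp add: zeta_reg_Harmonic del: zeta_reg.simps)
  define w where "w = index_word (ks @ [1])"
  have w: "w \<in> ywords" unfolding w_def by (rule index_word_ywords)
  define f where "f = plog 0 w - (fps_const c1 * plog 0 [Ly] + fps_const c0)"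
  have "(\<Sum>j\<le>N. f $ j) = trunc (ks @ [1]) N - poly [:c0, c1:] (harm N)" for N
  proof -
    have "(\<Sum>j\<le>N. f $ j) = (\<Sum>j\<le>N. plog 0 w $ j) - c1 * (\<Sum>j\<le>N. plog 0 [Ly] $ j) - c0"
      by (simp add: f_def sum_subtractf sum.distrib sum_distrib_left sum.atMost_shift algebra_simps)
    then show ?thesis
      using plog_partial_sums[of "ks @ [1]" N] plog_partial_sums[of "[1]" N] ind
      by (simp add: w_def trunc_one[unfolded One_nat_def] mult.commute)
  qed
  then have "(\<lambda>N. \<Sum>j\<le>N. f $ j) \<longlonglongrightarrow> 0"
    using negl_tendsto[OF h[unfolded has_reg_def]] by simp
  then have f0: "(eval_fps f \<longlongrightarrow> 0) (at_left 1)" by (rule abelian_null)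
  obtain Q where Q: "has_reg (at_left 1) logdiv (eval_fps (plog 0 w)) Q" using shuffle.has_reg_T[OF w] by blast
  have "((\<lambda>z. eval_fps f z - (eval_fps (plog 0 w) z - poly Q (logdiv z))) \<longlongrightarrow> 0 - 0) (at_left 1)"
    by (intro tendsto_diff f0 negl_tendsto[OF Q[unfolded has_reg_def]])
  moreover have "eventually (\<lambda>z. eval_fps f z - (eval_fps (plog 0 w) z - poly Q (logdiv z)) = poly (Q - [:c0, c1:]) (logdiv z)) (at_left 1)"
    using eventually_left_unit_disc
  proof eventually_elim
    case (elim z)
    have "eval_fps f z = eval_fps (plog 0 w) z - (c1 * logdiv z + c0)"
      unfolding f_def using elim
      by (simp add: eval_fps_unit_disc conv_radius_ge_1_intros fps_conv_radius_plog eval_plog_y)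
    then show ?case by (simp add: algebra_simps)
  qed
  ultimately have "((\<lambda>z. poly (Q - [:c0, c1:]) (logdiv z)) \<longlongrightarrow> 0) (at_left 1)"
    by (simp add: tendsto_cong)
  then have "Q - [:c0, c1:] = 0" by (rule poly_tendsto_0_imp_0[OF shuffle.nonbot logdiv_at_top])
  then have "Q = [:c0, c1:]" by simp
  then have "zeta_reg Shuffle (ks @ [1]) = c0"
    using fps_reg_eq[OF Q] by (simp add: w_def fps_reg_plog_0 del: zeta_reg.simps)
  with H show ?thesis by simp
qed

lemma zeta_reg_eq_Shuffle:
  assumes "admissible ks \<or> (\<exists>ls. admissible ls \<and> ks = ls @ [1])"
  shows "zeta_reg b ks = zeta_reg Shuffle ks"
  using assms zeta_reg_trailing_one by (cases b) (auto simp: zeta_reg_admissible simp del: zeta_reg.simps)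

subsection \<open>The algebra of multiple zeta values\<close>

interpretation rat_real: vector_space "\<lambda>(q :: rat) (x :: real). of_rat q * x"
  by (rule vector_space_rat_real)

lemma mzv_in_space: "admissible ks \<Longrightarrow> mzv ks \<in> mzv_space"
  unfolding mzv_space_def by (intro rat_real.span_base) auto

lemma mzv_space_0: "0 \<in> mzv_space"
  unfolding mzv_space_def by (rule rat_real.span_zero)

lemma mzv_space_add: "x \<in> mzv_space \<Longrightarrow> y \<in> mzv_space \<Longrightarrow> x + y \<in> mzv_space"
  unfolding mzv_space_def by (rule rat_real.span_add)

lemma mzv_space_scale: "x \<in> mzv_space \<Longrightarrow> of_rat q * x \<in> mzv_space"
  unfolding mzv_space_def by (rule rat_real.span_scale)

lemma mzv_space_sum: "(\<And>i. i \<in> I \<Longrightarrow> f i \<in> mzv_space) \<Longrightarrow> (\<Sum>i\<in>I. f i) \<in> mzv_space"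
  unfolding mzv_space_def by (rule rat_real.span_sum)

text \<open>Multiplicativity is read off from the harmonic regularization, which agrees with
  \<open>mzv\<close> on all indices that occur.\<close>

lemma mzv_mult_in_space:
  assumes "admissible ks" "admissible ls"
  shows "mzv ks * mzv ls \<in> mzv_space"
proof -
  have z: "harmonic.reg (Poly_Mapping.single u 1) = mzv u" if "admissible u" for u
    using that reg_val_eq[OF harmonic.nonbot harmonic.l_at_top harmonic.has_reg_e[of u]]
    by (simp add: harmonic.reg_single admissible_is_index)
  have "mzv ks * mzv ls = harmonic.reg (harmonic_prod ks ls)"
    using harmonic.reg_mult_basis[of ks ls] assms by (simp add: z admissible_is_index)
  also have "\<dots> = (\<Sum>u\<in>Poly_Mapping.keys (harmonic_prod ks ls). of_rat (Poly_Mapping.lookup (harmonic_prod ks ls) u) * mzv u)"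
    unfolding harmonic.reg_def lin_val_def
    using harmonic_prod_admissible[OF assms] z
    by (intro sum.cong refl) (auto simp: harmonic.reg_single admissible_is_index subset_iff)
  also have "\<dots> \<in> mzv_space"
    using harmonic_prod_admissible[OF assms] by (intro mzv_space_sum mzv_space_scale mzv_in_space) auto
  finally show ?thesis .
qed

lemma mzv_space_induct [consumes 1, case_names zero scale_add]:
  assumes "x \<in> mzv_space" "P 0"
    and "\<And>q ks y. admissible ks \<Longrightarrow> y \<in> mzv_space \<Longrightarrow> P y \<Longrightarrow> P (of_rat q * mzv ks + y)"
  shows "P x"
proof -
  have "x \<in> mzv_space \<and> P x"
    using assms(1) unfolding mzv_space_def
  proof (induction rule: rat_real.span_induct_alt)
    case base
    show ?case using assms(2) rat_real.span_zero by simp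
  next
    case (step c u v)
    then obtain ks where ks: "admissible ks" "u = mzv ks" by auto
    have "u \<in> mzv_space" using ks mzv_in_space by simp
    then have "of_rat c * u + v \<in> mzv_space"
      using step(2) by (intro mzv_space_add mzv_space_scale) (simp_all add: mzv_space_def)
    then show ?case using assms(3)[OF ks(1), of v c] step(2) ks by (simp add: mzv_space_def)
  qed
  then show ?thesis ..
qed

lemma mzv_space_mult:
  assumes "x \<in> mzv_space" "y \<in> mzv_space"
  shows "x * y \<in> mzv_space"
proof -
  have *: "mzv ks * y \<in> mzv_space" if "admissible ks" for ks
    using assms(2)
  proof (induction rule: mzv_space_induct)
    case (scale_add q ls y)
    then have "of_rat q * (mzv ks * mzv ls) + mzv ks * y \<in> mzv_space"
      using that by (intro mzv_space_add mzv_space_scale mzv_mult_in_space)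
    then show ?case by (simp add: algebra_simps)
  qed (simp add: mzv_space_0)
  show ?thesis
    using assms(1)
  proof (induction rule: mzv_space_induct)
    case (scale_add q ls x)
    then have "of_rat q * (mzv ls * y) + x * y \<in> mzv_space"
      by (intro mzv_space_add mzv_space_scale *)
    then show ?case by (simp add: algebra_simps)
  qed (simp add: mzv_space_0)
qed

lemma mzv_space_rat: "of_rat q \<in> mzv_space"
  using mzv_space_scale[OF mzv_in_space[of "[]"], of q] by (simp add: admissible_def)

lemma mzv_single_sums:
  assumes "k > 1" shows "(\<lambda>n. 1 / real (Suc n) ^ k) sums mzv [k]"
proof -
  have "trunc [k] N = (\<Sum>n<N. 1 / real (Suc n) ^ k)" for N
    using trunc_snoc[of "[]" k N] by simp
  then have "trunc [k] = (\<lambda>N. \<Sum>n<N. 1 / real (Suc n) ^ k)" by blast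
  then show ?thesis
    using trunc_tendsto[of "[k]"] assms unfolding sums_def by (simp add: admissible_def)
qed

lemma zeta0_eq_mzv: "k > 1 \<Longrightarrow> zeta0 k = mzv [k]"
  using mzv_single_sums[of k] by (simp add: zeta0_def sums_iff)

lemma mzv_2: "mzv [2] = pi\<^sup>2 / 6"
  using mzv_single_sums[of 2] inverse_squares_sums by (simp add: sums_iff add.commute)

lemma pi2_in_space: "pi\<^sup>2 \<in> mzv_space"
proof -
  have "pi\<^sup>2 = of_rat 6 * mzv [2]" by (simp add: mzv_2)
  also have "\<dots> \<in> mzv_space" by (intro mzv_space_scale mzv_in_space) (simp add: admissible_def)
  finally show ?thesis .
qed

lemma pi2_idealI: "z \<in> mzv_space \<Longrightarrow> pi\<^sup>2 * z \<in> pi2_ideal"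
  by (auto simp: pi2_ideal_def)

lemma pi2_ideal_mult: "x \<in> pi2_ideal \<Longrightarrow> y \<in> mzv_space \<Longrightarrow> x * y \<in> pi2_ideal"
  by (auto simp: pi2_ideal_def mult.assoc intro!: mzv_space_mult)

lemma pi2_ideal_add: "x \<in> pi2_ideal \<Longrightarrow> y \<in> pi2_ideal \<Longrightarrow> x + y \<in> pi2_ideal"
  by (auto simp: pi2_ideal_def distrib_left[symmetric] intro!: mzv_space_add)

lemma pi2_ideal_0: "0 \<in> pi2_ideal"
  using pi2_idealI[OF mzv_space_0] by simp

lemma pi2_ideal_sum: "(\<And>i. i \<in> I \<Longrightarrow> f i \<in> pi2_ideal) \<Longrightarrow> (\<Sum>i\<in>I. f i) \<in> pi2_ideal"
  by (induction I rule: infinite_finite_induct) (auto simp: pi2_ideal_0 pi2_ideal_add)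

lemma pi2_ideal_subset: "x \<in> pi2_ideal \<Longrightarrow> x \<in> mzv_space"
  by (auto simp: pi2_ideal_def intro: mzv_space_mult pi2_in_space)

subsection \<open>Generating functions of polylogarithms\<close>

definition spread :: "nat \<Rightarrow> (nat \<Rightarrow> 'a :: idom) \<Rightarrow> 'a fps" where
  "spread k g = Abs_fps g oo fps_X ^ k"

lemma spread_nth: "k > 0 \<Longrightarrow> spread k g $ n = (if k dvd n then g (n div k) else 0)"
proof -
  assume k: "k > 0"
  have "spread k g $ n = (\<Sum>i=0..n. if n = k * i then g i else 0)"
    unfolding spread_def fps_compose_nth power_mult[symmetric]
    by (intro sum.cong refl) (simp add: fps_X_power_nth)
  also have "\<dots> = (if k dvd n then g (n div k) else 0)"
  proof (cases "k dvd n")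
    case True
    then obtain j where j: "n = k * j" by blast
    have "(\<Sum>i=0..n. if n = k * i then g i else 0) = (\<Sum>i=0..n. if i = j then g i else 0)"
      using j k by (intro sum.cong refl) auto
    also have "\<dots> = g j" using j k by (simp add: sum.delta)
    finally show ?thesis using j k by simp
  qed (auto intro!: sum.neutral)
  finally show ?thesis .
qed

lemma spread_mult:
  assumes "k > 0"
  shows "spread k f * spread k g = spread k (\<lambda>n. \<Sum>i\<le>n. f i * g (n - i))"
proof -
  have "spread k f * spread k g = (Abs_fps f * Abs_fps g) oo fps_X ^ k"
    unfolding spread_def using assms by (subst fps_compose_mult_distrib) auto
  also have "Abs_fps f * Abs_fps g = Abs_fps (\<lambda>n. \<Sum>i\<le>n. f i * g (n - i))"
    by (rule fps_ext) (simp add: fps_mult_nth atLeast0AtMost)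
  finally show ?thesis by (simp add: spread_def)
qed

lemma spread_cmult: "k > 0 \<Longrightarrow> fps_const c * spread k g = spread k (\<lambda>n. c * g n)"
  by (rule fps_ext) (simp add: spread_nth)

lemma spread_shift: "k > 0 \<Longrightarrow> fps_X ^ k * spread k g = spread k (\<lambda>n. if n = 0 then 0 else g (n - 1))"
proof (rule fps_ext)
  fix n assume k: "k > 0"
  show "(fps_X ^ k * spread k g) $ n = spread k (\<lambda>n. if n = 0 then 0 else g (n - 1)) $ n"
  proof (cases "n < k")
    case True
    then show ?thesis using k by (auto simp: fps_X_power_mult_nth spread_nth dvd_def)
  next
    case False
    then obtain m where n: "n = k + m" by (metis le_Suc_ex not_less)
    then show ?thesis using k by (auto simp: fps_X_power_mult_nth spread_nth)
  qed
qed

text \<open>In a series over series the outer variable \<open>fps_X\<close> marks the length of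
  words and the inner one is z; the derivation acts on z alone, and \<open>at0\<close> sets z = 0 to
  read off initial values.\<close>

definition Dth :: "real fps fps \<Rightarrow> real fps fps" where
  "Dth F = Abs_fps (\<lambda>n. theta (F $ n))"

lemma Dth_nth [simp]: "Dth F $ n = theta (F $ n)"
  by (simp add: Dth_def)

lemma theta_0 [simp]: "theta 0 = 0" and theta_1 [simp]: "theta 1 = 0" and theta_const [simp]: "theta (fps_const c) = 0"
  by (simp_all add: theta_def)

lemma theta_minus: "theta (- f) = - theta f"
  by (simp add: theta_def)

lemma theta_sum: "theta (\<Sum>i\<in>I. f i) = (\<Sum>i\<in>I. theta (f i))"
  by (induction I rule: infinite_finite_induct) (auto simp: theta_add)

lemma Dth_add: "Dth (F + G) = Dth F + Dth G"
  by (rule fps_ext) (simp add: theta_add)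

lemma Dth_minus: "Dth (- F) = - Dth F"
  by (rule fps_ext) (simp add: theta_minus)

lemma Dth_diff: "Dth (F - G) = Dth F - Dth G"
  using Dth_add[of F "- G"] by (simp add: Dth_minus)

lemma Dth_mult: "Dth (F * G) = Dth F * G + F * Dth G"
  by (rule fps_ext) (simp add: fps_mult_nth theta_sum theta_mult sum.distrib)

lemma Dth_1 [simp]: "Dth 1 = 0"
  by (rule fps_ext) (simp add: fps_one_nth)

lemma Dth_X [simp]: "Dth fps_X = 0"
  by (rule fps_ext) (simp add: fps_X_def)

lemma theta_numeral: "theta (numeral k) = 0"
  by (rule fps_ext) (simp add: fps_numeral_nth)

lemma Dth_numeral [simp]: "Dth (numeral k) = 0"
  by (rule fps_ext) (simp add: fps_numeral_nth theta_numeral)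

definition at0 :: "real fps fps \<Rightarrow> real fps" where
  "at0 F = Abs_fps (\<lambda>n. F $ n $ 0)"

lemma at0_nth [simp]: "at0 F $ n = F $ n $ 0"
  by (simp add: at0_def)

lemma at0_add: "at0 (F + G) = at0 F + at0 G" and at0_diff: "at0 (F - G) = at0 F - at0 G"
  and at0_minus: "at0 (- F) = - at0 F"
  by (rule fps_ext; simp)+

lemma at0_mult: "at0 (F * G) = at0 F * at0 G"
  by (rule fps_ext) (simp add: fps_mult_nth fps_sum_nth)

lemma at0_1 [simp]: "at0 1 = 1" and at0_X [simp]: "at0 fps_X = fps_X"
  by (rule fps_ext; simp add: fps_X_def)+

lemma at0_numeral [simp]: "at0 (numeral k) = numeral k"
  by (rule fps_ext) (simp add: fps_numeral_nth)

lemma at0_power: "at0 (F ^ k) = at0 F ^ k"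
  by (induction k) (auto simp: at0_mult)

lemma Dth_eq_0_imp:
  assumes "Dth F = 0" "at0 F = 0" shows "F = 0"
proof (rule fps_ext)
  fix n
  have "theta (F $ n) = theta 0" using arg_cong[OF assms(1), of "\<lambda>G. G $ n"] by simp
  then show "F $ n = 0 $ n" using arg_cong[OF assms(2), of "\<lambda>G. G $ n"] by (simp add: theta_eqD)
qed

abbreviation Zg :: "real fps fps" where
  "Zg \<equiv> fps_const zgeo"

text \<open>Each equation carries a factor X, so every coefficient has a derivative built from the
  preceding coefficients only. Inductively it is constant in z, and it vanishes at z = 0.\<close>

lemma system_unique:
  assumes "Dth F = fps_X * G" "Dth G = - 2 * fps_X * H" "Dth H = fps_X * Zg * K" "Dth K = 2 * fps_X * Zg * F"
    and "at0 F = 0" "at0 G = 0" "at0 H = 0" "at0 K = 0"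
  shows "F = 0 \<and> G = 0 \<and> H = 0 \<and> K = 0"
proof -
  have z: "f = 0" if "theta f = 0" "f $ 0 = 0" for f
    by (rule theta_eqD) (use that in simp_all)
  have c: "F $ n $ 0 = 0" "G $ n $ 0 = 0" "H $ n $ 0 = 0" "K $ n $ 0 = 0" for n
    using assms(5-8)[THEN arg_cong, of "\<lambda>f. f $ n"] by simp_all
  have two: "- 2 * fps_X * H = fps_X * - (H + H)" "2 * fps_X * Zg * F = fps_X * (Zg * F + Zg * F)"
    "fps_X * Zg * K = fps_X * (Zg * K)"
    by (simp_all only: mult_2[symmetric] mult_ac mult_minus_left mult_minus_right)
  have d: "theta (F $ n) = (fps_X * G) $ n" "theta (G $ n) = (fps_X * - (H + H)) $ n"
    "theta (H $ n) = (fps_X * (Zg * K)) $ n" "theta (K $ n) = (fps_X * (Zg * F + Zg * F)) $ n" for n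
    using assms(1-4)[unfolded two, THEN arg_cong, of "\<lambda>f. f $ n"] by (simp_all only: Dth_nth)
  have "F $ n = 0 \<and> G $ n = 0 \<and> H $ n = 0 \<and> K $ n = 0" for n
  proof (induction n)
    case 0
    have "theta (F $ 0) = 0" "theta (G $ 0) = 0" "theta (H $ 0) = 0" "theta (K $ 0) = 0"
      unfolding d by simp_all
    then show ?case using z[OF _ c(1)] z[OF _ c(2)] z[OF _ c(3)] z[OF _ c(4)] by blast
  next
    case (Suc n)
    have "theta (F $ Suc n) = 0" "theta (G $ Suc n) = 0" "theta (H $ Suc n) = 0" "theta (K $ Suc n) = 0"
      unfolding d using Suc by simp_all
    then show ?case using z[OF _ c(1)] z[OF _ c(2)] z[OF _ c(3)] z[OF _ c(4)] by blast
  qed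
  then show ?thesis by (simp add: fps_eq_iff)
qed

text \<open>The generating function of the words p^n s with weight c^n; the exponent of
  \<open>fps_X\<close> counts the letters of the full periods and ignores the suffix
  \<open>s\<close>.\<close>

definition fam :: "real \<Rightarrow> letter list \<Rightarrow> nat \<Rightarrow> letter list \<Rightarrow> real fps fps" where
  "fam c p m s = spread (length p) (\<lambda>n. fps_const (c ^ n) * plog m (concat (replicate n p) @ s))"

lemma plog_nth_0: "plog m w $ 0 = (if w = [] \<and> m = 0 then 1 else 0)"
proof (cases w rule: rev_cases)
  case (snoc v a)
  have "plog m w $ 0 = 0" unfolding snoc by (subst plog_snoc_nth) simp
  then show ?thesis using snoc by simp
qed auto

lemma theta_plog_snoc:
  assumes "w @ [a] \<in> ywords"
  shows "theta (plog m (w @ [a])) = letter_kernel a * plog m w + (if m = 0 then 0 else plog (m - 1) (w @ [a]))"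
proof -
  have "letter_kernel a $ 0 * plog m w $ 0 = 0"
  proof (cases a)
    case Lx
    then have "w \<noteq> []" using assms by auto
    then show ?thesis using Lx by (simp add: plog_nth_0)
  qed (simp add: zgeo_def)
  then have "(letter_kernel a * plog m w + (if m = 0 then 0 else plog (m - 1) (w @ [a]))) $ 0 = 0"
    by (cases "m = 0") (simp_all add: plog_nth_0[of _ "w @ [a]"])
  from theta_theta_inv[OF this] show ?thesis
    by (cases m) (simp_all only: plog_0_snoc plog_Suc_snoc if_True if_False add_0_right nat.distinct diff_Suc_1 simp_thms)
qed

lemma concat_replicate_ywords:
  assumes "p \<in> ywords" "s \<in> ywords" shows "concat (replicate n p) @ s \<in> ywords"
  using assms by (induction n) (auto simp: hd_append)

lemma Dth_fam_snoc:
  assumes "p \<in> ywords" "p \<noteq> []" "s @ [a] \<in> ywords"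
  shows "Dth (fam c p m (s @ [a])) =
    fps_const (letter_kernel a) * fam c p m s + (if m = 0 then 0 else fam c p (m - 1) (s @ [a]))"
proof -
  have l: "length p > 0" using assms(2) by simp
  have "theta (fps_const (c ^ n) * plog m (concat (replicate n p) @ s @ [a])) =
     letter_kernel a * (fps_const (c ^ n) * plog m (concat (replicate n p) @ s))
     + (if m = 0 then 0 else fps_const (c ^ n) * plog (m - 1) (concat (replicate n p) @ s @ [a]))" for n
    using theta_plog_snoc[of "concat (replicate n p) @ s" a m] concat_replicate_ywords[OF assms(1,3), of n]
    by (simp add: theta_mult algebra_simps)
  then have "Dth (fam c p m (s @ [a])) $ n =
      (fps_const (letter_kernel a) * fam c p m s + (if m = 0 then 0 else fam c p (m - 1) (s @ [a]))) $ n" for n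
    using l by (simp add: fam_def spread_nth)
  then show ?thesis by (rule fps_ext)
qed

lemma concat_replicate_Suc: "concat (replicate (Suc n) p) = concat (replicate n p) @ p"
  by (induction n) auto

text \<open>Removing the last letter breaks up the last period, which costs c X^|p|. The empty word
  has derivative 0, but for m = 1 the lower order family contributes its constant coefficient 1,
  which has to be subtracted again.\<close>

lemma Dth_fam_Nil:
  assumes "p = q @ [a]" "p \<in> ywords"
  shows "Dth (fam c p m []) =
    fps_const (fps_const c) * fps_X ^ length p * fps_const (letter_kernel a) * fam c p m q
    + (if m = 0 then 0 else fam c p (m - 1) []) - (if m = 1 then 1 else 0)"
proof (rule fps_ext)
  fix n
  have l: "length p > 0" using assms(1) by simp
  have r: "fps_const (fps_const c) * fps_X ^ length p * fps_const (letter_kernel a) * fam c p m q =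
      spread (length p) (\<lambda>n. if n = 0 then 0 else fps_const c * letter_kernel a * (fps_const (c ^ (n - 1)) * plog m (concat (replicate (n - 1) p) @ q)))"
  proof -
    have "fps_const (fps_const c) * fps_X ^ length p * fps_const (letter_kernel a) * fam c p m q =
        fps_X ^ length p * (fps_const (fps_const c * letter_kernel a) * fam c p m q)"
      by (simp only: fps_const_mult[symmetric] mult_ac)
    then show ?thesis using l by (simp only: fam_def spread_cmult spread_shift)
  qed
  show "Dth (fam c p m []) $ n = (fps_const (fps_const c) * fps_X ^ length p * fps_const (letter_kernel a) * fam c p m q
    + (if m = 0 then 0 else fam c p (m - 1) []) - (if m = 1 then 1 else 0)) $ n"
  proof (cases "length p dvd n")
    case False
    then have "n \<noteq> 0" by (cases n) auto
    then show ?thesis unfolding r using l False by (simp add: fam_def spread_nth)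
  next
    case True
    then obtain j where n: "n = length p * j" by blast
    show ?thesis
    proof (cases j)
      case 0
      then show ?thesis unfolding r using l n by (auto simp: fam_def spread_nth)
    next
      case (Suc i)
      have rep: "concat (replicate (Suc i) p) = (concat (replicate i p) @ q) @ [a]"
        unfolding concat_replicate_Suc by (simp add: assms(1))
      have yw: "(concat (replicate i p) @ q) @ [a] \<in> ywords"
        using concat_replicate_ywords[OF assms(2,2), of i] assms(1) by simp
      have th: "theta (plog m (concat (replicate i p) @ q @ [a])) =
          letter_kernel a * plog m (concat (replicate i p) @ q) + (if m = 0 then 0 else plog (m - 1) (concat (replicate i p) @ q @ [a]))"
        using theta_plog_snoc[OF yw] by simp
      have "n > 0" using n Suc l by simp
      then have "(if m = 1 then 1 else 0 :: real fps fps) $ n = 0" by simp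
      moreover have "n div length p = Suc i" using n Suc l by simp
      ultimately show ?thesis
        unfolding r using l True
        by (simp add: fam_def spread_nth theta_mult rep th del: replicate.simps) (simp add: algebra_simps flip: fps_const_mult)
    qed
  qed
qed

lemma at0_fam:
  assumes "p \<noteq> []" shows "at0 (fam c p m s) = (if s = [] \<and> m = 0 then 1 else 0)"
proof (rule fps_ext)
  fix n
  have l: "length p > 0" using assms by simp
  show "at0 (fam c p m s) $ n = (if s = [] \<and> m = 0 then 1 else 0) $ n"
  proof (cases n)
    case 0
    then show ?thesis using l by (simp add: fam_def spread_nth plog_nth_0)
  next
    case (Suc k)
    have "concat (replicate (n div length p) p) \<noteq> []" if "length p dvd n"
      using that l Suc assms by (auto elim!: dvdE intro: gr0I)
    then show ?thesis using l Suc by (auto simp: fam_def spread_nth plog_nth_0)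
  qed
qed

section \<open>The tensor product system and its minors\<close>

lemmas Dth_rules = Dth_add Dth_diff Dth_minus Dth_mult
lemmas at0_rules = at0_add at0_diff at0_minus at0_mult at0_power

lemma fps_const_const_neg4: "fps_const (fps_const (- 4 :: real)) = - 4"
  by (simp add: fps_numeral_fps_const flip: fps_const_neg)

lemma fps_const_const_neg1: "fps_const (fps_const (- 1 :: real)) = - 1"
  by (simp flip: fps_const_neg)

text \<open>\<open>F\<^sub>i, K\<^sub>i, H\<^sub>i, G\<^sub>i\<close> are the four kinds of prefixes of the periodic words \<open>yyxxyyxx...\<close>, preceded by
  \<open>x^i\<close> for \<open>i = 0, 1, 2\<close> and by \<open>yxx\<close> for \<open>i = 3\<close>. They solve the tensor product of two differential
  systems of rank two, solved by \<open>(P, Q), (Pt, Qt)\<close> and by \<open>(P', Q'), (Pt', Qt')\<close>, whose parameters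
  differ by a factor \<open>sqrt (-1)\<close>.\<close>

lemma tensor_system:
  fixes P Q Pt Qt P' Q' Pt' Qt' :: "real fps fps"
  assumes d: "Dth P = fps_X * Q" "Dth Q = fps_X * Zg * P"
      "Dth Pt = fps_X * (Qt - P)" "Dth Qt = fps_X * Zg * Pt - fps_X * Q"
    and d': "Dth P' = - fps_X * Q'" "Dth Q' = fps_X * Zg * P'"
      "Dth Pt' = fps_X * (P' - Qt')" "Dth Qt' = fps_X * Zg * Pt' + fps_X * Q'"
    and z: "at0 P = 1" "at0 Q = 0" "at0 Pt = 0" "at0 Qt = 1"
      "at0 P' = 1" "at0 Q' = 0" "at0 Pt' = 0" "at0 Qt' = 1"
    and s0: "Dth F0 = fps_X * G0" "Dth G0 = - 2 * fps_X * H0" "Dth H0 = fps_X * Zg * K0" "Dth K0 = 2 * fps_X * Zg * F0"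
      "at0 F0 = 1" "at0 G0 = 0" "at0 H0 = 0" "at0 K0 = 0"
    and s1: "Dth F1 = fps_X * G1 - fps_X * F0" "Dth G1 = - 2 * fps_X * H1 - fps_X * G0"
      "Dth H1 = fps_X * Zg * K1 - fps_X * H0" "Dth K1 = 2 * fps_X * Zg * F1 - fps_X * K0"
      "at0 F1 = 0" "at0 G1 = 1" "at0 H1 = 0" "at0 K1 = 0"
    and s2: "Dth F2 = fps_X * G2 + fps_X * (2 * F1)" "Dth G2 = - 2 * fps_X * H2 + fps_X * (2 * G1)"
      "Dth H2 = fps_X * Zg * K2 + fps_X * (2 * H1)" "Dth K2 = 2 * fps_X * Zg * F2 + fps_X * (2 * K1)"
      "at0 F2 = 0" "at0 G2 = 0" "at0 H2 = 1" "at0 K2 = 0"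
    and s3: "Dth F3 = fps_X * G3" "Dth G3 = - 2 * fps_X * H3" "Dth H3 = fps_X * Zg * K3" "Dth K3 = 2 * fps_X * Zg * F3"
      "at0 F3 = 0" "at0 G3 = 0" "at0 H3 = 0" "at0 K3 = 1"
  shows "2 * (K3 * F0 - F3 * K0) = P * P + P' * P'"
    and "4 * (K3 * F1 - F3 * K1) = 2 * (P * Pt - P' * Pt')"
    and "2 * (K3 * F2 - F3 * K2) = - (Pt * Pt + Pt' * Pt')"
proof -
  \<comment> \<open>The inhomogeneous terms for \<open>(Pt, Qt)\<close> form - X times
    \<open>(P, Q)\<close> and drop out of the Wronskian; for the primed pair it is + X.\<close>
  have "Dth (P * Qt - Q * Pt - 1) = 0" by (simp add: Dth_rules d algebra_simps)
  then have "P * Qt - Q * Pt - 1 = 0" by (rule Dth_eq_0_imp) (simp add: at0_rules z)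
  then have det: "P * Qt - Q * Pt = 1" by simp
  have "Dth (P' * Qt' - Q' * Pt' - 1) = 0" by (simp add: Dth_rules d' algebra_simps)
  then have "P' * Qt' - Q' * Pt' - 1 = 0" by (rule Dth_eq_0_imp) (simp add: at0_rules z)
  then have det': "P' * Qt' - Q' * Pt' = 1" by simp
  have "F0 - P * P' = 0 \<and> G0 - (Q * P' - P * Q') = 0 \<and> H0 - Q * Q' = 0 \<and> K0 - (P * Q' + Q * P') = 0"
    by (rule system_unique; simp add: Dth_rules at0_rules d d' z s0 algebra_simps)
  then have e0: "F0 = P * P'" "G0 = Q * P' - P * Q'" "H0 = Q * Q'" "K0 = P * Q' + Q * P'" by auto
  have "2 * F1 - (Pt * P' - P * Pt') = 0 \<and> 2 * G1 - (Qt * P' - Pt * Q' - Q * Pt' + P * Qt') = 0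
      \<and> 2 * H1 - (Qt * Q' - Q * Qt') = 0 \<and> 2 * K1 - (Pt * Q' + Qt * P' - P * Qt' - Q * Pt') = 0"
    by (rule system_unique; simp add: Dth_rules at0_rules d d' z s1 e0 algebra_simps)
  then have e1: "2 * F1 = Pt * P' - P * Pt'" "2 * G1 = Qt * P' - Pt * Q' - Q * Pt' + P * Qt'"
      "2 * H1 = Qt * Q' - Q * Qt'" "2 * K1 = Pt * Q' + Qt * P' - P * Qt' - Q * Pt'" by auto
  have "F2 - Pt * Pt' = 0 \<and> G2 - (Qt * Pt' - Pt * Qt') = 0 \<and> H2 - Qt * Qt' = 0 \<and> K2 - (Pt * Qt' + Qt * Pt') = 0"
    by (rule system_unique; simp add: Dth_rules at0_rules d d' z s2[unfolded e1] algebra_simps)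
  then have e2: "F2 = Pt * Pt'" "K2 = Pt * Qt' + Qt * Pt'" by auto
  \<comment> \<open>The inhomogeneous terms of \<open>Pt\<close> and \<open>Pt'\<close> have
    opposite signs, so they cancel in this sum, which solves the homogeneous system; in the
    difference used for \<open>F1\<close> they add up.\<close>
  have "2 * F3 - (Pt * P' + P * Pt') = 0 \<and> 2 * G3 - (Qt * P' - Pt * Q' + Q * Pt' - P * Qt') = 0
      \<and> 2 * H3 - (Qt * Q' + Q * Qt') = 0 \<and> 2 * K3 - (Pt * Q' + Qt * P' + P * Qt' + Q * Pt') = 0"
    by (rule system_unique; simp add: Dth_rules at0_rules d d' z s3 algebra_simps)
  then have e3: "2 * F3 = Pt * P' + P * Pt'" "2 * K3 = Pt * Q' + Qt * P' + P * Qt' + Q * Pt'" by auto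
  have "2 * (K3 * F0 - F3 * K0) = (2 * K3) * F0 - (2 * F3) * K0" by (simp add: algebra_simps)
  \<comment> \<open>The two mixed terms cancel and the remaining four group into the Wronskians of
    the two factors.\<close>
  also have "\<dots> = (P' * P') * (P * Qt - Q * Pt) + (P * P) * (P' * Qt' - Q' * Pt')"
    unfolding e3 e0 by (simp add: algebra_simps)
  finally show "2 * (K3 * F0 - F3 * K0) = P * P + P' * P'" by (simp add: det det')
  have "4 * (K3 * F1 - F3 * K1) = (2 * K3) * (2 * F1) - (2 * F3) * (2 * K1)" by (simp add: algebra_simps)
  also have "\<dots> = 2 * ((P * Pt) * (P' * Qt' - Q' * Pt') - (P' * Pt') * (P * Qt - Q * Pt))"
    unfolding e3 e1 by (simp add: algebra_simps)
  finally show "4 * (K3 * F1 - F3 * K1) = 2 * (P * Pt - P' * Pt')" by (simp add: det det')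
  have "2 * (K3 * F2 - F3 * K2) = (2 * K3) * F2 - (2 * F3) * K2" by (simp add: algebra_simps)
  also have "\<dots> = - ((Pt * Pt) * (P' * Qt' - Q' * Pt') + (Pt' * Pt') * (P * Qt - Q * Pt))"
    unfolding e3 e2 by (simp add: algebra_simps)
  finally show "2 * (K3 * F2 - F3 * K2) = - (Pt * Pt + Pt' * Pt')" by (simp add: det det')
qed

abbreviation yx :: "letter list" where "yx \<equiv> [Ly, Lx]"
abbreviation yyxx :: "letter list" where "yyxx \<equiv> [Ly, Ly, Lx, Lx]"
abbreviation yxxy :: "letter list" where "yxxy \<equiv> [Ly, Lx, Lx, Ly]"

lemma fam_snoc_rules:
  "hd p = Ly \<Longrightarrow> p \<noteq> [] \<Longrightarrow> Dth (fam c p m [Ly]) = Zg * fam c p m [] + (if m = 0 then 0 else fam c p (m - 1) [Ly])"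
  "hd p = Ly \<Longrightarrow> p \<noteq> [] \<Longrightarrow> Dth (fam c p m [Ly, Ly]) = Zg * fam c p m [Ly] + (if m = 0 then 0 else fam c p (m - 1) [Ly, Ly])"
  "hd p = Ly \<Longrightarrow> p \<noteq> [] \<Longrightarrow> Dth (fam c p m [Ly, Lx]) = fam c p m [Ly] + (if m = 0 then 0 else fam c p (m - 1) [Ly, Lx])"
  "hd p = Ly \<Longrightarrow> p \<noteq> [] \<Longrightarrow> Dth (fam c p m [Ly, Ly, Lx]) = fam c p m [Ly, Ly] + (if m = 0 then 0 else fam c p (m - 1) [Ly, Ly, Lx])"
  "hd p = Ly \<Longrightarrow> p \<noteq> [] \<Longrightarrow> Dth (fam c p m [Ly, Lx, Lx]) = fam c p m [Ly, Lx] + (if m = 0 then 0 else fam c p (m - 1) [Ly, Lx, Lx])"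
  using Dth_fam_snoc[of p "[]" Ly c m] Dth_fam_snoc[of p "[Ly]" Ly c m] Dth_fam_snoc[of p "[Ly]" Lx c m]
    Dth_fam_snoc[of p "[Ly, Ly]" Lx c m] Dth_fam_snoc[of p "[Ly, Lx]" Lx c m]
  by simp_all

lemma fam_period_rules:
  "Dth (fam c yx m []) = fps_const (fps_const c) * fps_X ^ 2 * fam c yx m [Ly]
    + (if m = 0 then 0 else fam c yx (m - 1) []) - (if m = 1 then 1 else 0)"
  "Dth (fam c yyxx m []) = fps_const (fps_const c) * fps_X ^ 4 * fam c yyxx m [Ly, Ly, Lx]
    + (if m = 0 then 0 else fam c yyxx (m - 1) []) - (if m = 1 then 1 else 0)"
  "Dth (fam c yxxy m []) = fps_const (fps_const c) * fps_X ^ 4 * Zg * fam c yxxy m [Ly, Lx, Lx]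
    + (if m = 0 then 0 else fam c yxxy (m - 1) []) - (if m = 1 then 1 else 0)"
  using Dth_fam_Nil[of yx "[Ly]" Lx c m] Dth_fam_Nil[of yyxx "[Ly, Ly, Lx]" Lx c m] Dth_fam_Nil[of yxxy "[Ly, Lx, Lx]" Ly c m]
  by (simp_all add: eval_nat_numeral)

text \<open>These are identities between functions of z, before any regularization. Products of
  polylogarithms regularize multiplicatively, so the values at z = 1 follow afterwards.\<close>

lemma polylog_identities:
  defines "F \<equiv> \<lambda>m. fam (-4) yyxx m []" and "K \<equiv> \<lambda>m. fam (-4) yyxx m [Ly]"
    and "V \<equiv> fam (-4) yxxy 0 []" and "W \<equiv> fam (-4) yxxy 0 [Ly, Lx, Lx]"
    and "E \<equiv> fam 1 yx 0 []" and "E' \<equiv> fam (-1) yx 0 []" and "D \<equiv> fam 1 yx 1 []" and "D' \<equiv> fam (-1) yx 1 []"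
  shows "2 * (V * F 0 + 4 * fps_X ^ 4 * (W * K 0)) = E * E + E' * E'"
    and "4 * (V * F 1 + 4 * fps_X ^ 4 * (W * K 1)) = 2 * (E * D + E' * D')"
    and "4 * (V * F 2 + 4 * fps_X ^ 4 * (W * K 2)) = D * D + D' * D'"
proof -
  define H G where "H m = fam (-4) yyxx m [Ly, Ly]" and "G m = fam (-4) yyxx m [Ly, Ly, Lx]" for m
  define B B' where "B m = fam 1 yx m [Ly]" and "B' m = fam (-1) yx m [Ly]" for m
  define V1 V2 where "V1 = fam (-4) yxxy 0 [Ly]" and "V2 = fam (-4) yxxy 0 [Ly, Lx]"
  have dE: "Dth E = fps_X ^ 2 * B 0" "Dth E' = - (fps_X ^ 2 * B' 0)"
    "Dth D = fps_X ^ 2 * B 1 + E - 1" "Dth D' = - (fps_X ^ 2 * B' 1) + E' - 1"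
    by (simp_all add: E_def E'_def D_def D'_def B_def B'_def fam_period_rules fps_const_const_neg1)
  have dB: "Dth (B 0) = Zg * E" "Dth (B' 0) = Zg * E'" "Dth (B 1) = Zg * D + B 0" "Dth (B' 1) = Zg * D' + B' 0"
    by (simp_all add: E_def E'_def D_def D'_def B_def B'_def fam_snoc_rules)
  have dF: "Dth (F m) = - 4 * fps_X ^ 4 * G m + (if m = 0 then 0 else F (m - 1)) - (if m = 1 then 1 else 0)"
    "Dth (K m) = Zg * F m + (if m = 0 then 0 else K (m - 1))"
    "Dth (H m) = Zg * K m + (if m = 0 then 0 else H (m - 1))"
    "Dth (G m) = H m + (if m = 0 then 0 else G (m - 1))" for m
    by (simp_all add: F_def K_def H_def G_def fam_period_rules fam_snoc_rules fps_const_const_neg4)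
  have dV: "Dth V = - 4 * fps_X ^ 4 * Zg * W" "Dth V1 = Zg * V" "Dth V2 = V1" "Dth W = V2"
    by (simp_all add: V_def W_def V1_def V2_def fam_period_rules fam_snoc_rules fps_const_const_neg4)
  have zs: "at0 E = 1" "at0 E' = 1" "at0 D = 0" "at0 D' = 0" "at0 (B m) = 0" "at0 (B' m) = 0"
    "at0 (F m) = (if m = 0 then 1 else 0)" "at0 (K m) = 0" "at0 (H m) = 0" "at0 (G m) = 0"
    "at0 V = 1" "at0 V1 = 0" "at0 V2 = 0" "at0 W = 0" for m
    by (simp_all add: E_def E'_def D_def D'_def B_def B'_def F_def K_def H_def G_def V_def W_def V1_def V2_def at0_fam)
  \<comment> \<open>In the families the powers of X sit in the equation closing a period; the
    rescaling here gives each letter one factor X and splits -4 into -2 and 2. The summands 1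
    compensate the \<open>- 1\<close> that occurs at order one, and the extra factors X and X^2 of
    the higher orders are cancelled at the end.\<close>
  note ts = tensor_system[of E "fps_X * B 0" "- fps_X * D" "1 - fps_X ^ 2 * B 1"
     E' "fps_X * B' 0" "fps_X * D'" "1 + fps_X ^ 2 * B' 1"
     "F 0" "- 4 * fps_X ^ 3 * G 0" "2 * fps_X ^ 2 * H 0" "2 * fps_X * K 0"
     "- fps_X * F 1" "1 + 4 * fps_X ^ 4 * G 1" "- 2 * fps_X ^ 3 * H 1" "- 2 * fps_X ^ 2 * K 1"
     "- 2 * fps_X ^ 2 * F 2" "8 * fps_X ^ 5 * G 2" "1 - 4 * fps_X ^ 4 * H 2" "- 4 * fps_X ^ 3 * K 2"
     "- 2 * fps_X ^ 3 * W" "- 2 * fps_X ^ 2 * V2" "fps_X * V1" V]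
  have "2 * (V * F 0 - (- 2 * fps_X ^ 3 * W) * (2 * fps_X * K 0)) = E * E + E' * E'"
    by (rule ts(1); simp add: Dth_rules at0_rules dE dB dF dV zs dB[unfolded One_nat_def] algebra_simps eval_nat_numeral)
  then show "2 * (V * F 0 + 4 * fps_X ^ 4 * (W * K 0)) = E * E + E' * E'"
    by (simp add: algebra_simps eval_nat_numeral)
  have "4 * (V * (- fps_X * F 1) - (- 2 * fps_X ^ 3 * W) * (- 2 * fps_X ^ 2 * K 1))
      = 2 * (E * (- fps_X * D) - E' * (fps_X * D'))"
    by (rule ts(2); simp add: Dth_rules at0_rules dE dB dF dV zs dB[unfolded One_nat_def] algebra_simps eval_nat_numeral)
  then have "fps_X * (4 * (V * F 1 + 4 * fps_X ^ 4 * (W * K 1))) = fps_X * (2 * (E * D + E' * D'))"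
    by (simp add: algebra_simps eval_nat_numeral)
  then show "4 * (V * F 1 + 4 * fps_X ^ 4 * (W * K 1)) = 2 * (E * D + E' * D')"
    by (subst (asm) mult_left_cancel) simp_all
  have "2 * (V * (- 2 * fps_X ^ 2 * F 2) - (- 2 * fps_X ^ 3 * W) * (- 4 * fps_X ^ 3 * K 2))
      = - ((- fps_X * D) * (- fps_X * D) + (fps_X * D') * (fps_X * D'))"
    by (rule ts(3); simp add: Dth_rules at0_rules dE dB dF dV zs dB[unfolded One_nat_def] algebra_simps eval_nat_numeral)
  then have "fps_X ^ 2 * (4 * (V * F 2 + 4 * fps_X ^ 4 * (W * K 2))) = fps_X ^ 2 * (D * D + D' * D')"
    by (simp add: algebra_simps eval_nat_numeral)
  then show "4 * (V * F 2 + 4 * fps_X ^ 4 * (W * K 2)) = D * D + D' * D'"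
    by (subst (asm) mult_left_cancel) simp_all
qed

section \<open>Passing to regularized values coefficient by coefficient\<close>

definition all_regular :: "real fps fps \<Rightarrow> bool" where
  "all_regular F \<longleftrightarrow> (\<forall>n. regular (F $ n))"

definition coeff_reg :: "real fps fps \<Rightarrow> real fps" where
  "coeff_reg F = Abs_fps (\<lambda>n. fps_reg (F $ n))"

lemma coeff_reg_add: "all_regular F \<Longrightarrow> all_regular G \<Longrightarrow> coeff_reg (F + G) = coeff_reg F + coeff_reg G"
  by (rule fps_ext) (simp add: coeff_reg_def all_regular_def fps_reg_add)

lemma coeff_reg_mult: "all_regular F \<Longrightarrow> all_regular G \<Longrightarrow> coeff_reg (F * G) = coeff_reg F * coeff_reg G"
  by (rule fps_ext) (simp add: coeff_reg_def all_regular_def fps_mult_nth fps_reg_sum fps_reg_mult regular_mult)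

lemma all_regular_add: "all_regular F \<Longrightarrow> all_regular G \<Longrightarrow> all_regular (F + G)"
  by (auto simp: all_regular_def)

lemma all_regular_mult: "all_regular F \<Longrightarrow> all_regular G \<Longrightarrow> all_regular (F * G)"
  by (auto simp: all_regular_def fps_mult_nth)

lemma regular_numeral: "regular (numeral k)" and fps_reg_numeral: "fps_reg (numeral k) = numeral k"
  by (simp_all only: fps_numeral_fps_const regular_const fps_reg_const)

lemma all_regular_numeral: "all_regular (numeral k)" and coeff_reg_numeral: "coeff_reg (numeral k) = numeral k"
  by (auto simp: all_regular_def fps_numeral_nth regular_numeral)
     (rule fps_ext, simp add: coeff_reg_def fps_numeral_nth fps_reg_numeral)

lemma all_regular_X_power: "all_regular (fps_X ^ k)" and coeff_reg_X_power: "coeff_reg (fps_X ^ k) = fps_X ^ k"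
  by (auto simp: all_regular_def fps_X_power_nth) (rule fps_ext, simp add: coeff_reg_def fps_X_power_nth)

lemma all_regular_fam:
  assumes "p \<noteq> []" "hd p = Ly" "s = [] \<or> hd s = Ly"
  shows "all_regular (fam c p m s)"
proof -
  have "concat (replicate n p) @ s \<in> ywords" for n
    by (rule concat_replicate_ywords) (use assms in auto)
  then show ?thesis using assms(1) unfolding all_regular_def fam_def
    by (simp add: spread_nth) (intro allI impI regular_mult regular_const regular_plog; simp)
qed

lemma coeff_reg_fam:
  assumes "p \<noteq> []" "hd p = Ly" "s = [] \<or> hd s = Ly"
  shows "coeff_reg (fam c p m s) = spread (length p) (\<lambda>n. c ^ n * fps_reg (plog m (concat (replicate n p) @ s)))"
proof (rule fps_ext)
  fix n
  have "concat (replicate (n div length p) p) @ s \<in> ywords"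
    by (rule concat_replicate_ywords) (use assms in auto)
  then have "regular (plog m (concat (replicate (n div length p) p) @ s))" by (rule regular_plog)
  then show "coeff_reg (fam c p m s) $ n = spread (length p) (\<lambda>n. c ^ n * fps_reg (plog m (concat (replicate n p) @ s))) $ n"
    using assms(1) by (simp add: coeff_reg_def fam_def spread_nth fps_reg_mult regular_const)
qed

lemma spread_mult_nth: "k > 0 \<Longrightarrow> (spread k f * spread k g) $ (k * n) = (\<Sum>i\<le>n. f i * g (n - i))"
  by (simp add: spread_mult spread_nth)

lemma spread_geometric_mult_nth:
  fixes c :: real
  assumes "k > 0"
  shows "(spread k (\<lambda>n. c ^ n * f n) * spread k (\<lambda>n. c ^ n * g n)) $ (k * n) = c ^ n * (\<Sum>i\<le>n. f i * g (n - i))"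
proof -
  have *: "c ^ i * f i * (c ^ (n - i) * g (n - i)) = c ^ n * (f i * g (n - i))" if "i \<le> n" for i
  proof -
    have "c ^ n = c ^ i * c ^ (n - i)" using that by (simp flip: power_add)
    then show ?thesis by simp
  qed
  show ?thesis
    unfolding spread_mult_nth[OF assms] sum_distrib_left by (intro sum.cong refl *) simp
qed

text \<open>Values of {3,1}^n and ({3,1}^n, 3), which are the prefixes of a power of 3,1, and in
  order \<open>m\<close> those of {1,3}^n and ({1,3}^n, 1), which are the reversed tails.\<close>

definition zeta_31 :: "nat \<Rightarrow> real" where "zeta_31 n = fps_reg (plog 0 (concat (replicate n yxxy)))"
definition zeta_31_3 :: "nat \<Rightarrow> real" where "zeta_31_3 n = fps_reg (plog 0 (concat (replicate n yxxy) @ [Ly, Lx, Lx]))"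
definition zeta_13 :: "nat \<Rightarrow> nat \<Rightarrow> real" where "zeta_13 m n = fps_reg (plog m (concat (replicate n yyxx)))"
definition zeta_13_1 :: "nat \<Rightarrow> nat \<Rightarrow> real" where "zeta_13_1 m n = fps_reg (plog m (concat (replicate n yyxx) @ [Ly]))"
definition zeta_2 :: "nat \<Rightarrow> real" where "zeta_2 n = fps_reg (plog 0 (concat (replicate n yx)))"
definition zeta1_2 :: "nat \<Rightarrow> real" where "zeta1_2 n = fps_reg (plog 1 (concat (replicate n yx)))"

text \<open>The first sum collects the cuts between periods, the second those between 3 and 1. In
  the latter the entries after the cut have odd sum, whence the minus sign.\<close>

definition sym_31 :: "nat \<Rightarrow> nat \<Rightarrow> real" where
  "sym_31 m n = (\<Sum>i\<le>n. zeta_31 i * zeta_13 m (n - i)) - (\<Sum>i<n. zeta_31_3 i * zeta_13_1 m (n - 1 - i))"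

lemma coeff_reg_sym_31:
  "coeff_reg (fam (-4) yxxy 0 [] * fam (-4) yyxx m [] + 4 * fps_X ^ 4 * (fam (-4) yxxy 0 [Ly, Lx, Lx] * fam (-4) yyxx m [Ly])) $ (4 * n)
     = (- 4) ^ n * sym_31 m n"
proof -
  define V F W K where "V = spread 4 (\<lambda>n. (- 4) ^ n * zeta_31 n)" and "F = spread 4 (\<lambda>n. (- 4) ^ n * zeta_13 m n)"
    and "W = spread 4 (\<lambda>n. (- 4) ^ n * zeta_31_3 n)" and "K = spread 4 (\<lambda>n. (- 4) ^ n * zeta_13_1 m n)"
  have "coeff_reg (fam (-4) yxxy 0 [] * fam (-4) yyxx m [] + 4 * fps_X ^ 4 * (fam (-4) yxxy 0 [Ly, Lx, Lx] * fam (-4) yyxx m [Ly]))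
      = V * F + 4 * fps_X ^ 4 * (W * K)"
  proof -
    have "coeff_reg (fam (-4) yxxy 0 []) = V" "coeff_reg (fam (-4) yyxx m []) = F"
        "coeff_reg (fam (-4) yxxy 0 [Ly, Lx, Lx]) = W" "coeff_reg (fam (-4) yyxx m [Ly]) = K"
      by (simp_all add: coeff_reg_fam V_def F_def W_def K_def zeta_31_def zeta_13_def zeta_31_3_def zeta_13_1_def numeral_eq_Suc)
    then show ?thesis
      by (simp add: coeff_reg_add coeff_reg_mult all_regular_mult all_regular_add all_regular_fam
        all_regular_numeral all_regular_X_power coeff_reg_numeral coeff_reg_X_power)
  qed
  moreover have "(V * F) $ (4 * n) = (- 4) ^ n * (\<Sum>i\<le>n. zeta_31 i * zeta_13 m (n - i))"
    unfolding V_def F_def by (rule spread_geometric_mult_nth) simp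
  \<comment> \<open>The factor X^4 shifts the index by one, and 4 (-4)^k = - (-4)^(k+1) supplies the
    sign of the odd cuts.\<close>
  moreover have "(4 * fps_X ^ 4 * (W * K)) $ (4 * n) = - ((- 4) ^ n * (\<Sum>i<n. zeta_31_3 i * zeta_13_1 m (n - 1 - i)))"
  proof (cases n)
    case 0
    then show ?thesis by (simp add: fps_X_power_mult_nth mult.assoc)
  next
    case (Suc k)
    have "(4 * fps_X ^ 4 * (W * K)) $ (4 * n) = 4 * (W * K) $ (4 * k)"
      by (simp add: Suc fps_X_power_mult_nth mult.assoc numeral_fps_const)
    also have "(W * K) $ (4 * k) = (- 4) ^ k * (\<Sum>i\<le>k. zeta_31_3 i * zeta_13_1 m (k - i))"
      unfolding W_def K_def by (rule spread_geometric_mult_nth) simp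
    finally show ?thesis by (simp add: Suc lessThan_Suc_atMost)
  qed
  ultimately show ?thesis by (simp add: sym_31_def right_diff_distrib)
qed

text \<open>The exponent 4n belongs to index 2n, where the sign (-1)^(2n) is 1, so both products
  contribute the same amount.\<close>

lemma spread_sign_sum_nth:
  fixes f g :: "nat \<Rightarrow> real"
  shows "(spread 2 (\<lambda>n. 1 ^ n * f n) * spread 2 (\<lambda>n. 1 ^ n * g n)
     + spread 2 (\<lambda>n. (- 1) ^ n * f n) * spread 2 (\<lambda>n. (- 1) ^ n * g n)) $ (4 * n) = 2 * (\<Sum>i\<le>2*n. f i * g (2 * n - i))"
  using spread_geometric_mult_nth[of 2 1 f g "2 * n"] spread_geometric_mult_nth[of 2 "-1" f g "2 * n"]
  by (simp add: fps_add_nth)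

lemma sym_31_evaluation:
  "(- 4) ^ n * sym_31 0 n = (\<Sum>i\<le>2*n. zeta_2 i * zeta_2 (2 * n - i))"
  "(- 4) ^ n * sym_31 1 n = (\<Sum>i\<le>2*n. zeta_2 i * zeta1_2 (2 * n - i))"
  "2 * ((- 4) ^ n * sym_31 2 n) = (\<Sum>i\<le>2*n. zeta1_2 i * zeta1_2 (2 * n - i))"
proof -
  note regs = coeff_reg_add coeff_reg_mult all_regular_mult all_regular_add all_regular_fam
        all_regular_numeral all_regular_X_power coeff_reg_numeral coeff_reg_X_power
  let ?L = "\<lambda>m. fam (-4) yxxy 0 [] * fam (-4) yyxx m [] + 4 * fps_X ^ 4 * (fam (-4) yxxy 0 [Ly, Lx, Lx] * fam (-4) yyxx m [Ly])"
  have rL: "all_regular (?L m)" for m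
    by (simp add: regs)
  have E: "coeff_reg (fam c yx 0 []) = spread 2 (\<lambda>n. c ^ n * zeta_2 n)" for c
    by (simp add: coeff_reg_fam zeta_2_def numeral_2_eq_2)
  have D: "coeff_reg (fam c yx 1 []) = spread 2 (\<lambda>n. c ^ n * zeta1_2 n)" for c
    by (simp add: coeff_reg_fam zeta1_2_def numeral_2_eq_2)
  have num: "(numeral k * f) $ j = numeral k * f $ j" for k j and f :: "real fps"
    by (simp add: numeral_fps_const)
  have "coeff_reg (2 * ?L 0) = coeff_reg (fam 1 yx 0 [] * fam 1 yx 0 [] + fam (-1) yx 0 [] * fam (-1) yx 0 [])"
    by (rule arg_cong[OF polylog_identities(1)])
  then have "2 * coeff_reg (?L 0) = spread 2 (\<lambda>n. 1 ^ n * zeta_2 n) * spread 2 (\<lambda>n. 1 ^ n * zeta_2 n)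
     + spread 2 (\<lambda>n. (- 1) ^ n * zeta_2 n) * spread 2 (\<lambda>n. (- 1) ^ n * zeta_2 n)"
    by (subst (asm) coeff_reg_mult[OF all_regular_numeral rL]) (simp add: regs E del: power_one)
  from arg_cong[OF this, of "\<lambda>f. f $ (4 * n)"] show "(- 4) ^ n * sym_31 0 n = (\<Sum>i\<le>2*n. zeta_2 i * zeta_2 (2 * n - i))"
    unfolding num coeff_reg_sym_31 spread_sign_sum_nth by simp
  have "coeff_reg (4 * ?L 1) = coeff_reg (2 * (fam 1 yx 0 [] * fam 1 yx 1 [] + fam (-1) yx 0 [] * fam (-1) yx 1 []))"
    by (rule arg_cong[OF polylog_identities(2)])
  then have "4 * coeff_reg (?L 1) = 2 * (spread 2 (\<lambda>n. 1 ^ n * zeta_2 n) * spread 2 (\<lambda>n. 1 ^ n * zeta1_2 n)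
     + spread 2 (\<lambda>n. (- 1) ^ n * zeta_2 n) * spread 2 (\<lambda>n. (- 1) ^ n * zeta1_2 n))"
    by (subst (asm) coeff_reg_mult[OF all_regular_numeral rL]) (simp add: regs E D[unfolded One_nat_def] del: power_one)
  from arg_cong[OF this, of "\<lambda>f. f $ (4 * n)"] show "(- 4) ^ n * sym_31 1 n = (\<Sum>i\<le>2*n. zeta_2 i * zeta1_2 (2 * n - i))"
    unfolding num coeff_reg_sym_31 spread_sign_sum_nth by simp
  have "coeff_reg (4 * ?L 2) = coeff_reg (fam 1 yx 1 [] * fam 1 yx 1 [] + fam (-1) yx 1 [] * fam (-1) yx 1 [])"
    by (rule arg_cong[OF polylog_identities(3)])
  then have "4 * coeff_reg (?L 2) = spread 2 (\<lambda>n. 1 ^ n * zeta1_2 n) * spread 2 (\<lambda>n. 1 ^ n * zeta1_2 n)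
     + spread 2 (\<lambda>n. (- 1) ^ n * zeta1_2 n) * spread 2 (\<lambda>n. (- 1) ^ n * zeta1_2 n)"
    by (subst (asm) coeff_reg_mult[OF all_regular_numeral rL]) (simp add: regs D[unfolded One_nat_def] del: power_one)
  from arg_cong[OF this, of "\<lambda>f. f $ (4 * n)"] show "2 * ((- 4) ^ n * sym_31 2 n) = (\<Sum>i\<le>2*n. zeta1_2 i * zeta1_2 (2 * n - i))"
    unfolding num coeff_reg_sym_31 spread_sign_sum_nth by (simp add: mult_ac)
qed

subsection \<open>The symmetric values of \<open>{3,1}^n\<close>\<close>

lemma index_word_periodic:
  "index_word (concat (replicate n [2])) = concat (replicate n yx)"
  "index_word (concat (replicate n [1, 3])) = concat (replicate n yyxx)"
  "index_word (concat (replicate n [3, 1])) = concat (replicate n yxxy)"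
  by (induction n) (auto simp: numeral_eq_Suc)

lemma is_index_replicate: "is_index p \<Longrightarrow> is_index (concat (replicate n p))"
  by (induction n) auto

lemma admissible_replicate: "admissible p \<Longrightarrow> admissible (concat (replicate n p))"
proof (cases n)
  case (Suc m)
  assume "admissible p"
  then show ?thesis unfolding Suc concat_replicate_Suc
    using is_index_replicate[of p m] is_index_replicate[of p "Suc m"] by (auto simp: admissible_def last_append)
qed (simp add: admissible_def)

lemma map2_admissible:
  assumes "admissible ks" "length ls = length ks"
  shows "admissible (map2 (+) ks ls)"
proof (cases ks rule: rev_cases)
  case (snoc ks' k)
  then obtain ls' l where l: "ls = ls' @ [l]" "length ls' = length ks'"
    using assms(2) by (cases ls rule: rev_cases) auto
  have "is_index (map2 (+) ks' ls')"
    using assms(1) snoc by (auto simp: admissible_def is_index_def dest: set_zip_leftD)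
  then show ?thesis using assms(1) snoc l by (simp add: admissible_def)
qed (simp add: admissible_def)

text \<open>A zero shift keeps a trailing 1 and a positive shift makes the index admissible, so no
  shifted index has two trailing ones.\<close>

lemma zeta_shift_eq_Shuffle:
  assumes "admissible ks \<or> (\<exists>ks'. admissible ks' \<and> ks = ks' @ [1])"
  shows "zeta_shift b m ks = zeta_shift Shuffle m ks"
  unfolding zeta_shift_def
proof (intro sum.cong refl arg_cong2[where f = "(*)"] zeta_reg_eq_Shuffle)
  fix ls assume "ls \<in> {ls. length ls = length ks \<and> sum_list ls = m}"
  then have len: "length ls = length ks" by simp
  from assms show "admissible (map2 (+) ks ls) \<or> (\<exists>us. admissible us \<and> map2 (+) ks ls = us @ [1])"
  proof
    assume "admissible ks"
    then show ?thesis using map2_admissible len by blast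
  next
    assume "\<exists>ks'. admissible ks' \<and> ks = ks' @ [1]"
    then obtain ks' where ks: "admissible ks'" "ks = ks' @ [1]" by blast
    then obtain ls' l where l: "ls = ls' @ [l]" "length ls' = length ks'"
      using len by (cases ls rule: rev_cases) auto
    have a: "admissible (map2 (+) ks' ls')" using map2_admissible ks l by blast
    show ?thesis
    proof (cases "l = 0")
      case True
      then show ?thesis using a ks l by auto
    next
      case False
      have "admissible (map2 (+) ks' ls' @ [1 + l])"
        using a False by (simp add: admissible_def)
      then show ?thesis using ks l by simp
    qed
  qed
qed

lemma zeta_reg_31: "zeta_reg b (concat (replicate n [3, 1])) = zeta_31 n"
proof -
  have "zeta_reg b (concat (replicate n [3, 1])) = zeta_reg Shuffle (concat (replicate n [3, 1]))"
  proof (rule zeta_reg_eq_Shuffle, cases n)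
    case (Suc k)
    have "admissible (concat (replicate k [3, 1]) @ [3])"
      by (simp add: admissible_def is_index_replicate)
    then show "admissible (concat (replicate n [3, 1])) \<or> (\<exists>ls. admissible ls \<and> concat (replicate n [3, 1]) = ls @ [1])"
      unfolding Suc concat_replicate_Suc by (intro disjI2 exI[of _ "concat (replicate k [3, 1]) @ [3]"]) simp
  qed (simp add: admissible_def)
  then show ?thesis by (simp add: zeta_31_def fps_reg_plog_0 del: zeta_reg.simps flip: index_word_periodic)
qed

lemma zeta_reg_31_3: "zeta_reg b (concat (replicate n [3, 1]) @ [3]) = zeta_31_3 n"
proof -
  have "zeta_reg b (concat (replicate n [3, 1]) @ [3]) = zeta_reg Shuffle (concat (replicate n [3, 1]) @ [3])"
    by (rule zeta_reg_eq_Shuffle) (simp add: admissible_def is_index_replicate)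
  also have "\<dots> = fps_reg (plog 0 (index_word (concat (replicate n [3, 1]) @ [3])))"
    by (simp add: fps_reg_plog_0 del: zeta_reg.simps)
  also have "index_word (concat (replicate n [3, 1]) @ [3]) = concat (replicate n yxxy) @ [Ly, Lx, Lx]"
    by (simp only: index_word_snoc index_word_periodic) (simp add: numeral_eq_Suc)
  finally show ?thesis by (simp add: zeta_31_3_def)
qed

lemma zeta_shift_13: "zeta_shift b m (concat (replicate n [1, 3])) = zeta_13 m n"
proof -
  have "admissible (concat (replicate n [1, 3]))" by (rule admissible_replicate) (simp add: admissible_def)
  then have "zeta_shift b m (concat (replicate n [1, 3])) = zeta_shift Shuffle m (concat (replicate n [1, 3]))"
    by (intro zeta_shift_eq_Shuffle) simp
  then show ?thesis
    by (simp add: zeta_13_def is_index_replicate flip: index_word_periodic fps_reg_plog)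
qed

lemma zeta_shift_13_1: "zeta_shift b m (concat (replicate n [1, 3]) @ [1]) = zeta_13_1 m n"
proof -
  have "admissible (concat (replicate n [1, 3]))" by (rule admissible_replicate) (simp add: admissible_def)
  then have "zeta_shift b m (concat (replicate n [1, 3]) @ [1]) = zeta_shift Shuffle m (concat (replicate n [1, 3]) @ [1])"
    by (intro zeta_shift_eq_Shuffle) blast
  also have "\<dots> = fps_reg (plog m (index_word (concat (replicate n [1, 3]) @ [1])))"
    by (rule fps_reg_plog[symmetric]) (simp add: is_index_replicate)
  also have "index_word (concat (replicate n [1, 3]) @ [1]) = concat (replicate n yyxx) @ [Ly]"
    by (simp only: index_word_snoc index_word_periodic) simp
  finally show ?thesis by (simp add: zeta_13_1_def)
qed

lemma sum_even_odd: "(\<Sum>i\<le>2 * n. g i) = (\<Sum>i\<le>n. g (2 * i)) + (\<Sum>i<n. g (2 * i + 1 :: nat) :: real)"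
  by (induction n) auto

lemma rev_concat_replicate: "rev (concat (replicate n p)) = concat (replicate n (rev p))"
  by (induction n) (simp_all only: concat_replicate_Suc rev_append, simp_all add: concat_replicate_Suc[symmetric])

text \<open>Every prefix and every reversed tail of {3,1}^n has at most one trailing 1, so the
  right-hand side does not depend on \<open>b\<close>.\<close>

lemma zeta_Shat_nth: "fps_nth (zeta_Shat b (concat (replicate n [3, 1]))) m = sym_31 m n"
proof -
  let ?ks = "concat (replicate n [3, 1 :: nat])"
  define g where "g i = (- 1) ^ sum_list (drop i ?ks) * zeta_reg b (take i ?ks) * zeta_shift b m (rev (drop i ?ks))" for i
  have len: "length (concat (replicate k [3, 1 :: nat])) = 2 * k" for k by (induction k) auto
  have sl: "sum_list (concat (replicate k [3, 1 :: nat])) = 4 * k" for k by (induction k) auto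
  have split: "?ks = concat (replicate i [3, 1]) @ concat (replicate (n - i) [3, 1])" if "i \<le> n" for i
    using that by (simp flip: concat_append replicate_add)
  have even: "g (2 * i) = zeta_31 i * zeta_13 m (n - i)" if "i \<le> n" for i
  proof -
    have "take (2 * i) ?ks = concat (replicate i [3, 1])" "drop (2 * i) ?ks = concat (replicate (n - i) [3, 1])"
      using split[OF that] len[of i] by (simp_all del: One_nat_def)
    then show ?thesis
      by (simp add: g_def sl rev_concat_replicate zeta_reg_31 zeta_shift_13 power_mult del: zeta_reg.simps One_nat_def)
  qed
  have odd: "g (2 * i + 1) = - (zeta_31_3 i * zeta_13_1 m (n - 1 - i))" if "i < n" for i
  proof -
    obtain k where k: "n - i = Suc k" "n - 1 - i = k" using \<open>i < n\<close> by (metis Suc_diff_Suc diff_Suc_1 diff_commute)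
    have "?ks = (concat (replicate i [3, 1]) @ [3]) @ (1 # concat (replicate k [3, 1]))"
      using split[of i] that k by (simp del: One_nat_def)
    then have "take (2 * i + 1) ?ks = concat (replicate i [3, 1]) @ [3]" "drop (2 * i + 1) ?ks = 1 # concat (replicate k [3, 1])"
      using len[of i] by (simp_all add: take_Cons' drop_Cons' del: One_nat_def)
    then show ?thesis
      by (simp add: g_def sl rev_concat_replicate zeta_reg_31_3 zeta_shift_13_1 power_mult k(2)[unfolded diff_diff_left] del: zeta_reg.simps One_nat_def)
  qed
  have "fps_nth (zeta_Shat b ?ks) m = (\<Sum>i=0..length ?ks. g i)"
    by (simp add: zeta_Shat_def fps_sum_nth g_def)
  also have "\<dots> = (\<Sum>i\<le>2 * n. g i)" by (simp add: len atLeast0AtMost del: One_nat_def)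
  also have "\<dots> = (\<Sum>i\<le>n. zeta_31 i * zeta_13 m (n - i)) + (\<Sum>i<n. - (zeta_31_3 i * zeta_13_1 m (n - 1 - i)))"
    unfolding sum_even_odd using even odd by (intro arg_cong2[where f = "(+)"] sum.cong refl) auto
  finally show ?thesis by (simp add: sym_31_def sum_negf)
qed

subsection \<open>Evaluation modulo \<open>\<pi>\<^sup>2\<close>\<close>

lemma index_word_twos: "concat (replicate n yx) = index_word (replicate n 2)"
  using index_word_periodic(1)[of n] by simp

lemma is_index_twos: "is_index (replicate n 2)" and admissible_twos: "admissible (replicate n 2)"
  by (cases "n = 0"; simp add: is_index_def admissible_def)+

lemma replicate_Suc_snoc: "replicate (Suc n) a = replicate n a @ [a]"
  by (simp add: replicate_append_same)

lemma zeta_2_eq_mzv: "zeta_2 n = mzv (replicate n 2)"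
  unfolding zeta_2_def index_word_twos fps_reg_plog_0 by (rule zeta_reg_admissible[OF admissible_twos])

lemma zeta_2_0: "zeta_2 0 = 1"
  by (simp add: zeta_2_eq_mzv)

text \<open>The truncated sums behind \<open>zeta1_2\<close>; being finite, they allow the
  logarithmic derivative to be computed by induction on \<open>N\<close>.\<close>

definition ztrunc :: "nat \<Rightarrow> nat \<Rightarrow> real" where
  "ztrunc n N = (\<Sum>j\<le>N. plog 1 (index_word (replicate n 2)) $ j)"

lemma trunc_twos_Suc:
  "trunc (replicate (Suc n) 2) (Suc N) = trunc (replicate (Suc n) 2) N + trunc (replicate n 2) N / real (Suc N) ^ 2"
  "trunc (replicate (Suc n) 2) 0 = 0"
  unfolding replicate_Suc_snoc by (simp_all add: trunc_snoc_Suc)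

lemma ztrunc_Suc:
  "ztrunc (Suc n) (Suc N) = ztrunc (Suc n) N + ztrunc n N / real (Suc N) ^ 2
     + 2 * trunc (replicate n 2) N / real (Suc N) ^ 3"
proof -
  have "ztrunc (Suc n) (Suc N) = ztrunc (Suc n) N + plog 1 (index_word (replicate n 2 @ [2])) $ Suc N"
    unfolding ztrunc_def replicate_Suc_snoc by simp
  also have "plog 1 (index_word (replicate n 2 @ [2])) $ Suc N
      = ztrunc n N / real (Suc N) ^ 2 + 2 * trunc (replicate n 2) N / real (Suc N) ^ 3"
  proof -
    have two: "(\<Sum>l\<le>1. h l) = h 0 + h (1 :: nat)" for h :: "nat \<Rightarrow> real" by simp
    show ?thesis unfolding plog_index_word_snoc_nth(1)[OF zero_less_numeral] two
      by (simp add: ztrunc_def plog_partial_sums is_index_twos del: of_nat_Suc)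
  qed
  finally show ?thesis by simp
qed

lemma ztrunc_0: "ztrunc n 0 = 0" "ztrunc 0 N = 0"
  by (simp_all add: ztrunc_def plog_nth_0)

definition twos_gf :: "nat \<Rightarrow> real fps" where "twos_gf N = Abs_fps (\<lambda>n. trunc (replicate n 2) N)"

lemma twos_gf_Suc: "twos_gf (Suc N) = twos_gf N * (1 + fps_const (1 / real (Suc N) ^ 2) * fps_X)"
proof (rule fps_ext)
  fix n
  show "twos_gf (Suc N) $ n = (twos_gf N * (1 + fps_const (1 / real (Suc N) ^ 2) * fps_X)) $ n"
    by (cases n) (simp_all add: twos_gf_def trunc_twos_Suc distrib_left mult.commute[of _ fps_X] mult.left_commute[of _ fps_X]
        del: of_nat_Suc replicate.simps(2))
qed

lemma twos_gf_0: "twos_gf 0 = 1"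
proof (rule fps_ext)
  fix n show "twos_gf 0 $ n = 1 $ n"
    by (cases n) (simp_all add: twos_gf_def trunc_twos_Suc del: replicate.simps(2))
qed

text \<open>In the limit: the logarithmic derivative at \<open>t = 0\<close> of the product of the \<open>1 + X / (k - t)^2\<close>.\<close>

lemma ztrunc_gf:
  "Abs_fps (\<lambda>n. ztrunc n N) = 2 * fps_X * twos_gf N * Abs_fps (\<lambda>k. (- 1) ^ k * (\<Sum>j<N. 1 / real (Suc j) ^ (2 * k + 3)))"
proof (induction N)
  case 0
  show ?case by (rule fps_ext) (simp add: ztrunc_0 fps_mult_nth)
next
  case (Suc N)
  define M where "M = real (Suc N)"
  have M: "M > 0" by (simp add: M_def)
  define c where "c = 1 / M ^ 2"
  define r where "r = Abs_fps (\<lambda>k. (- 1) ^ k / M ^ (2 * k + 3))"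
  define S where "S N = Abs_fps (\<lambda>k. (- 1) ^ k * (\<Sum>j<N. 1 / real (Suc j) ^ (2 * k + 3)))" for N
  have "Abs_fps (\<lambda>n. ztrunc n (Suc N)) = Abs_fps (\<lambda>n. ztrunc n N) * (1 + fps_const c * fps_X) + fps_const (2 / M ^ 3) * fps_X * twos_gf N"
  proof (rule fps_ext)
    fix n
    show "Abs_fps (\<lambda>n. ztrunc n (Suc N)) $ n = (Abs_fps (\<lambda>n. ztrunc n N) * (1 + fps_const c * fps_X) + fps_const (2 / M ^ 3) * fps_X * twos_gf N) $ n"
      by (cases n) (simp_all add: ztrunc_0 ztrunc_Suc c_def M_def twos_gf_def distrib_left mult.assoc mult.commute[of _ fps_X] mult.left_commute[of _ fps_X]
        del: of_nat_Suc replicate.simps(2))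
  qed
  also have "\<dots> = 2 * fps_X * twos_gf (Suc N) * (S N + r)"
  proof -
    \<comment> \<open>\<open>r\<close> is the geometric expansion of M^(-3) / (1 + X / M^2), the
      contribution of the new factor of the product.\<close>
    have "r * (1 + fps_const c * fps_X) = fps_const (1 / M ^ 3)"
    proof (rule fps_ext)
      fix n show "(r * (1 + fps_const c * fps_X)) $ n = fps_const (1 / M ^ 3) $ n"
        using M by (cases n) (simp_all add: r_def c_def distrib_left mult.commute[of _ fps_X] mult.left_commute[of _ fps_X] power_add power2_eq_square)
    qed
    then have "2 * fps_X * twos_gf (Suc N) * r = 2 * fps_X * twos_gf N * fps_const (1 / M ^ 3)"
      unfolding twos_gf_Suc M_def[symmetric] c_def[symmetric] by (metis mult.assoc mult.commute)
    also have "\<dots> = fps_const (2 / M ^ 3) * fps_X * twos_gf N"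
    proof -
      have "fps_const (2 / M ^ 3) = 2 * fps_const (1 / M ^ 3)"
        by (simp add: numeral_fps_const)
      then show ?thesis by (simp add: mult_ac)
    qed
    finally have r: "2 * fps_X * twos_gf (Suc N) * r = fps_const (2 / M ^ 3) * fps_X * twos_gf N" .
    have "2 * fps_X * twos_gf N * S N * (1 + fps_const c * fps_X) = 2 * fps_X * twos_gf (Suc N) * S N"
      unfolding twos_gf_Suc M_def[symmetric] c_def[symmetric] by (simp only: mult_ac)
    then show ?thesis unfolding Suc[folded S_def] distrib_left[of "2 * fps_X * twos_gf (Suc N)"] r by simp
  qed
  also have "S N + r = S (Suc N)"
    by (rule fps_ext) (simp add: S_def r_def M_def algebra_simps)
  finally show ?case by (simp add: S_def)
qed

lemma ztrunc_Suc_eq: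
  "ztrunc (Suc n) N = 2 * (\<Sum>i\<le>n. trunc (replicate i 2) N * ((- 1) ^ (n - i) * (\<Sum>j<N. 1 / real (Suc j) ^ (2 * (n - i) + 3))))"
proof -
  define S where "S = Abs_fps (\<lambda>k. (- 1) ^ k * (\<Sum>j<N. 1 / real (Suc j) ^ (2 * k + 3)))"
  have "ztrunc (Suc n) N = (2 * fps_X * twos_gf N * S) $ Suc n"
    using arg_cong[OF ztrunc_gf[of N], of "\<lambda>f. f $ Suc n"] by (simp add: S_def)
  also have "\<dots> = 2 * (twos_gf N * S) $ n"
    by (simp add: mult.assoc numeral_fps_const)
  finally show ?thesis by (simp add: fps_mult_nth twos_gf_def S_def atLeast0AtMost)
qed

lemma ztrunc_tendsto: "ztrunc n \<longlonglongrightarrow> zeta1_2 n"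
proof -
  have adm: "admissible (map2 (+) (replicate n 2) ls)" if "length ls = n" for ls
    using that by (intro map2_admissible admissible_twos) simp
  have "ztrunc n N = (\<Sum>ls\<in>shifts n 1. shift_weight (replicate n 2) ls * trunc (map2 (+) (replicate n 2) ls) N)" for N
    unfolding ztrunc_def plog_index_word[OF is_index_twos]
    by (simp add: fps_sum_nth) (subst sum.swap, intro sum.cong refl,
        simp add: sum_distrib_left[symmetric] plog_partial_sums admissible_is_index adm)
  then have "ztrunc n = (\<lambda>N. \<Sum>ls\<in>shifts n 1. shift_weight (replicate n 2) ls * trunc (map2 (+) (replicate n 2) ls) N)"
    by blast
  moreover have "(\<lambda>N. \<Sum>ls\<in>shifts n 1. shift_weight (replicate n 2) ls * trunc (map2 (+) (replicate n 2) ls) N)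
      \<longlonglongrightarrow> (\<Sum>ls\<in>shifts n 1. shift_weight (replicate n 2) ls * mzv (map2 (+) (replicate n 2) ls))"
    by (intro tendsto_sum tendsto_mult tendsto_const trunc_tendsto adm) simp
  moreover have "(\<Sum>ls\<in>shifts n 1. shift_weight (replicate n 2) ls * mzv (map2 (+) (replicate n 2) ls)) = zeta1_2 n"
    unfolding zeta1_2_def index_word_twos fps_reg_plog[OF is_index_twos] zeta_shift_def
    by (simp add: zeta_reg_admissible adm shift_weight_def mult.commute del: zeta_reg.simps)
  ultimately show ?thesis by simp
qed

lemma zeta1_2_0: "zeta1_2 0 = 0"
  using LIMSEQ_unique[OF ztrunc_tendsto[of 0], of 0] by (simp add: ztrunc_0[abs_def])

lemma zeta1_2_Suc: "zeta1_2 (Suc n) = 2 * (\<Sum>i\<le>n. zeta_2 i * ((- 1) ^ (n - i) * zeta0 (2 * (n - i) + 3)))"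
proof (rule LIMSEQ_unique[OF ztrunc_tendsto])
  have z: "(\<lambda>N. \<Sum>j<N. 1 / real (Suc j) ^ (2 * k + 3)) \<longlonglongrightarrow> zeta0 (2 * k + 3)" for k
    using mzv_single_sums[of "2 * k + 3"] zeta0_eq_mzv[of "2 * k + 3"] by (simp add: sums_def del: of_nat_Suc)
  show "ztrunc (Suc n) \<longlonglongrightarrow> 2 * (\<Sum>i\<le>n. zeta_2 i * ((- 1) ^ (n - i) * zeta0 (2 * (n - i) + 3)))"
    unfolding ztrunc_Suc_eq[abs_def] zeta_2_eq_mzv
    by (intro tendsto_intros z trunc_tendsto admissible_twos)
qed

text \<open>Each further entry costs at most a factor zeta(2) = pi^2 / 6, which is below 3. A bound
  uniform in \<open>N\<close> is what the interchange of limits in the sine product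
  requires.\<close>

lemma trunc_twos_bound: "trunc (replicate n 2) N \<le> 3 ^ n"
proof (induction n arbitrary: N)
  case (Suc n)
  have "trunc [2] N \<le> mzv [2]"
    by (rule incseq_le[OF _ trunc_tendsto]) (auto simp: incseq_def admissible_def intro: trunc_mono)
  also have "\<dots> \<le> 3"
  proof -
    have "pi * pi \<le> 4 * 4" using pi_less_4 by (intro mult_mono) auto
    then show ?thesis by (simp add: mzv_2 power2_eq_square)
  qed
  finally have b: "(\<Sum>j<N. 1 / real (Suc j) ^ 2) \<le> 3" using trunc_snoc[of "[]" 2 N] by simp
  have "trunc (replicate (Suc n) 2) N = (\<Sum>j<N. trunc (replicate n 2) j / real (Suc j) ^ 2)"
    unfolding replicate_Suc_snoc trunc_snoc ..
  also have "\<dots> \<le> (\<Sum>j<N. 3 ^ n * (1 / real (Suc j) ^ 2))"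
    by (intro sum_mono) (use Suc in \<open>simp add: divide_right_mono\<close>)
  also have "\<dots> \<le> 3 ^ n * 3"
    unfolding sum_distrib_left[symmetric] by (intro mult_left_mono b) auto
  finally show ?case by simp
qed simp

lemma eval_twos_gf:
  assumes "\<bar>y\<bar> < 1"
  shows "fps_conv_radius (twos_gf N) \<ge> 1 \<and> eval_fps (twos_gf N) y = (\<Prod>k=1..N. 1 + y / real k ^ 2)"
proof (induction N)
  case 0
  then show ?case by (simp add: twos_gf_0)
next
  case (Suc N)
  have r: "fps_conv_radius (fps_const c * fps_X :: real fps) \<ge> 1" for c
    by (intro conv_radius_ge_1_intros) simp
  then have r1: "fps_conv_radius (1 + fps_const c * fps_X :: real fps) \<ge> 1" for c
    by (intro conv_radius_ge_1_intros) simp_all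
  have "eval_fps (1 + fps_const c * fps_X) y = 1 + c * y" for c
    using assms r by (subst eval_fps_unit_disc(1)) (simp_all add: eval_fps_unit_disc(5))
  then show ?case
    unfolding twos_gf_Suc using Suc assms r1
    by (simp add: eval_fps_unit_disc conv_radius_ge_1_intros del: of_nat_Suc)
qed

text \<open>Dividing by the lowest power of X leaves a series with nonzero constant term that
  vanishes to the right of 0, against continuity. One side is enough, as the arguments will be
  squares.\<close>

lemma fps_eq_0I:
  fixes f :: "real fps"
  assumes "fps_conv_radius f > 0" "r > 0" "\<And>y. 0 < y \<Longrightarrow> y < r \<Longrightarrow> eval_fps f y = 0"
  shows "f = 0"
proof (rule ccontr)
  assume "f \<noteq> 0"
  define m where "m = subdegree f"
  define g where "g = fps_shift m f"
  have g0: "g $ 0 \<noteq> 0" using \<open>f \<noteq> 0\<close> by (simp add: g_def m_def)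
  have rg: "fps_conv_radius g > 0" using assms(1) by (simp add: g_def)
  obtain R where R: "R > 0" "ereal R < fps_conv_radius f"
    using assms(1) ereal_dense2[of 0 "fps_conv_radius f"] by auto
  have gz: "eval_fps g y = 0" if "0 < y" "y < min r R" for y
  proof -
    have "ereal (norm y) < ereal R" using that by simp
    then have "ereal (norm y) < fps_conv_radius f" using R(2) by (rule less_trans)
    then show ?thesis using that assms(3)[of y] unfolding g_def m_def by (subst eval_fps_shift) auto
  qed
  have "eventually (\<lambda>y. 0 < y \<and> y < min r R) (at_right 0)"
    using R assms(2) by (intro eventually_at_rightI[of 0 "min r R"]) auto
  then have "eventually (\<lambda>y. eval_fps g y = 0) (at_right 0)"
    by (rule eventually_mono) (elim conjE, rule gz)
  then have "(eval_fps g \<longlongrightarrow> 0) (at_right 0)" by (rule tendsto_eventually)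
  moreover have "continuous (at 0 within {0<..}) (eval_fps g)"
    by (rule DERIV_continuous[OF has_field_derivative_eval_fps]) (use rg in \<open>simp add: zero_ereal_def\<close>)
  then have "(eval_fps g \<longlongrightarrow> g $ 0) (at_right 0)"
    by (simp add: continuous_within eval_fps_at_0)
  ultimately have "g $ 0 = 0"
    using tendsto_unique[OF trivial_limit_at_right_real] by blast
  with g0 show False by simp
qed

text \<open>Euler's argument: the truncated generating function at - x^2 is the finite product of
  the 1 - x^2 / k^2, which tends to sin (pi x) / (pi x); then coefficients are compared.\<close>

lemma zeta_2_eq_pi_power: "zeta_2 n = pi ^ (2 * n) / fact (2 * n + 1)"
proof -
  \<comment> \<open>For x at most 1/2 one has 3 x^2 at most 3/4, which gives the geometric majorant
    for Tannery's theorem.\<close>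
  have zs: "(\<lambda>k. zeta_2 k * (- (x ^ 2)) ^ k) sums (sin (pi * x) / (pi * x))" if x: "0 < x" "x \<le> 1/2" for x
  proof -
    have x2: "x\<^sup>2 \<le> 1/4" using x power_mono[of x "1/2" 2] by (simp add: power_divide)
    let ?a = "\<lambda>k N. trunc (replicate k 2) N * (- (x ^ 2)) ^ k"
    have bound: "norm (?a k N) \<le> (3/4) ^ k" for k N
    proof -
      have "norm (?a k N) = trunc (replicate k 2) N * (x\<^sup>2) ^ k"
        by (simp add: abs_mult power_abs trunc_nonneg)
      also have "\<dots> \<le> 3 ^ k * (1/4) ^ k"
        by (intro mult_mono trunc_twos_bound power_mono x2) auto
      also have "\<dots> = (3/4) ^ k" by (simp add: power_mult_distrib[symmetric])
      finally show ?thesis .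
    qed
    have T: "summable (\<lambda>k. norm (zeta_2 k * (- (x ^ 2)) ^ k)) \<and>
        ((\<lambda>N. suminf (\<lambda>k. ?a k N)) \<longlongrightarrow> suminf (\<lambda>k. zeta_2 k * (- (x ^ 2)) ^ k)) sequentially"
    proof (rule conjunct2[OF tannerys_theorem[where M = "\<lambda>k. (3/4) ^ k"]])
      show "(\<lambda>N. ?a k N) \<longlonglongrightarrow> zeta_2 k * (- (x ^ 2)) ^ k" for k
        unfolding zeta_2_eq_mzv by (intro tendsto_intros trunc_tendsto admissible_twos)
      show "eventually (\<lambda>(k, N). norm (?a k N) \<le> (3/4) ^ k) (at_top \<times>\<^sub>F sequentially)"
        using bound by (intro always_eventually) auto
    qed (auto intro: summable_geometric)
    have "suminf (\<lambda>k. ?a k N) = (\<Prod>k=1..N. 1 - x ^ 2 / real k ^ 2)" for N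
    proof -
      have "suminf (\<lambda>k. ?a k N) = eval_fps (twos_gf N) (- (x ^ 2))"
        by (simp add: eval_fps_def twos_gf_def)
      then show ?thesis using eval_twos_gf[of "- (x ^ 2)" N] x2 by simp
    qed
    then have "(\<lambda>N. suminf (\<lambda>k. ?a k N)) \<longlonglongrightarrow> sin (pi * x) / (pi * x)"
      using sin_product_formula_real'[of x] x by simp
    then have "suminf (\<lambda>k. zeta_2 k * (- (x ^ 2)) ^ k) = sin (pi * x) / (pi * x)"
      by (rule LIMSEQ_unique[OF conjunct2[OF T]])
    moreover have "summable (\<lambda>k. zeta_2 k * (- (x ^ 2)) ^ k)"
      by (rule summable_norm_cancel[OF conjunct1[OF T]])
    ultimately show ?thesis by (simp add: sums_iff)
  qed
  define f where "f = Abs_fps (\<lambda>k. (- 1) ^ k * (zeta_2 k - pi ^ (2 * k) / fact (2 * k + 1)))"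
  have fs: "(\<lambda>k. f $ k * (x ^ 2) ^ k) sums 0" if x: "0 < x" "x \<le> 1/2" for x
  proof -
    have "(\<lambda>k. (- 1) ^ k / fact (2 * k + 1) * (pi * x) ^ (2 * k + 1) / (pi * x)) sums (sin (pi * x) / (pi * x))"
      by (intro sums_divide sin_paired)
    moreover have "(- 1) ^ k / fact (2 * k + 1) * (pi * x) ^ (2 * k + 1) / (pi * x)
        = (- 1) ^ k * (pi ^ (2 * k) / fact (2 * k + 1)) * (x ^ 2) ^ k" for k
      using x by (simp add: power_mult_distrib power_mult[symmetric])
    ultimately have "(\<lambda>k. (- 1) ^ k * (pi ^ (2 * k) / fact (2 * k + 1)) * (x ^ 2) ^ k) sums (sin (pi * x) / (pi * x))"
      by simp
    from sums_diff[OF zs[OF x] this]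
    have "(\<lambda>k. zeta_2 k * (- (x ^ 2)) ^ k - (- 1) ^ k * (pi ^ (2 * k) / fact (2 * k + 1)) * (x ^ 2) ^ k) sums 0" by simp
    moreover have "zeta_2 k * (- (x ^ 2)) ^ k - (- 1) ^ k * (pi ^ (2 * k) / fact (2 * k + 1)) * (x ^ 2) ^ k = f $ k * (x ^ 2) ^ k" for k
    proof -
      have "(- (x ^ 2)) ^ k = (- 1) ^ k * (x ^ 2) ^ k" by (rule power_minus)
      then show ?thesis by (simp add: f_def algebra_simps)
    qed
    ultimately show ?thesis by simp
  qed
  have "f = 0"
  proof (rule fps_eq_0I[of f "1/4"])
    have "norm ((1/2::real) ^ 2) \<le> conv_radius (fps_nth f)"
      by (rule conv_radius_geI[OF sums_summable[OF fs]]) auto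
    then show "fps_conv_radius f > 0" unfolding fps_conv_radius_def
      by (rule less_le_trans[rotated]) (simp add: zero_ereal_def)
  next
    fix y :: real assume y: "0 < y" "y < 1/4"
    have "sqrt y \<le> sqrt ((1/2)^2)" using y by (intro real_sqrt_le_mono) (simp add: power_divide)
    then have "(\<lambda>k. f $ k * (sqrt y ^ 2) ^ k) sums 0" using y by (intro fs) auto
    then show "eval_fps f y = 0" using y by (simp add: eval_fps_def sums_iff)
  qed simp
  then have "f $ n = 0" by simp
  then show ?thesis by (simp add: f_def)
qed

section \<open>Congruences modulo \<open>pi\<^sup>2\<close>\<close>

lemma mzv_space_power: "x \<in> mzv_space \<Longrightarrow> x ^ n \<in> mzv_space"
  using mzv_space_rat[of 1] by (induction n) (auto intro: mzv_space_mult)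

lemma of_rat_fact: "real_of_rat (fact k) = fact k"
  by (metis of_nat_fact of_rat_of_nat_eq)

lemma zeta_2_in_ideal: "n > 0 \<Longrightarrow> zeta_2 n \<in> pi2_ideal"
proof -
  assume "n > 0"
  then obtain m where n: "n = Suc m" by (cases n) auto
  have "pi ^ (2 * n) = pi\<^sup>2 * (pi\<^sup>2) ^ m" by (simp add: n power_mult power2_eq_square)
  then have "zeta_2 n = pi\<^sup>2 * ((pi\<^sup>2) ^ m * of_rat (1 / of_nat (fact (2 * n + 1))))"
    by (simp add: zeta_2_eq_pi_power of_rat_divide of_rat_fact del: fact_Suc)
  also have "\<dots> \<in> pi2_ideal"
    by (intro pi2_idealI mzv_space_mult mzv_space_power pi2_in_space mzv_space_rat)
  finally show ?thesis .
qed

lemma zeta_2_in_space: "zeta_2 n \<in> mzv_space"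
  unfolding zeta_2_eq_mzv by (intro mzv_in_space admissible_twos)

lemma zeta0_odd_in_space: "zeta0 (2 * n + 1) \<in> mzv_space"
proof (cases n)
  case 0
  then show ?thesis by (simp add: zeta0_def mzv_space_0)
next
  case (Suc m)
  then show ?thesis by (simp add: zeta0_eq_mzv) (intro mzv_in_space, simp add: admissible_def)
qed

lemma pi2_ideal_rat: "x \<in> pi2_ideal \<Longrightarrow> of_rat q * x \<in> pi2_ideal"
  using pi2_ideal_mult[OF _ mzv_space_rat, of x q] by (simp add: mult.commute)

lemma power_minus4_rat: "(- 4 :: real) powi k = of_rat ((- 4) powi k)"
  by (simp add: power_int_def of_rat_power of_rat_inverse of_rat_minus of_rat_divide)

text \<open>For positive \<open>n\<close> this is the term of \<open>zeta1_2_Suc\<close> containing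
  \<open>zeta_2 0\<close>, the only one without a factor from the ideal. For n = 0 it vanishes by
  the convention zeta(1) = 0.\<close>

definition zeta1_2_main :: "nat \<Rightarrow> real" where
  "zeta1_2_main n = - 2 * (- 1) ^ n * zeta0 (2 * n + 1)"

lemma zeta1_2_main_in_space: "zeta1_2_main n \<in> mzv_space"
proof -
  have "zeta1_2_main n = of_rat (- 2 * (- 1) ^ n) * zeta0 (2 * n + 1)"
    by (simp add: zeta1_2_main_def of_rat_mult of_rat_power of_rat_minus)
  then show ?thesis using mzv_space_scale[OF zeta0_odd_in_space] by metis
qed

lemma zeta1_2_cong: "zeta1_2 n - zeta1_2_main n \<in> pi2_ideal"
proof (cases n)
  case 0
  then show ?thesis by (simp add: zeta1_2_0 zeta1_2_main_def zeta0_def pi2_ideal_0)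
next
  case (Suc m)
  have "zeta1_2 n - zeta1_2_main n = (\<Sum>i<m. zeta_2 (Suc i) * (of_rat (2 * (- 1) ^ (m - Suc i)) * zeta0 (2 * (m - Suc i + 1) + 1)))"
    by (simp add: Suc zeta1_2_Suc sum.atMost_shift zeta_2_0 zeta1_2_main_def sum_distrib_left of_rat_mult of_rat_power of_rat_minus
        algebra_simps eval_nat_numeral)
  also have "\<dots> \<in> pi2_ideal"
    by (intro pi2_ideal_sum pi2_ideal_mult zeta_2_in_ideal mzv_space_scale zeta0_odd_in_space) simp
  finally show ?thesis .
qed

lemma zeta1_2_in_space: "zeta1_2 n \<in> mzv_space"
  using mzv_space_add[OF pi2_ideal_subset[OF zeta1_2_cong[of n]] zeta1_2_main_in_space[of n]] by simp

lemma sym_31_eq: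
  "sym_31 0 n = (- 4) powi (- int n) * (\<Sum>i\<le>2*n. zeta_2 i * zeta_2 (2 * n - i))"
  "sym_31 1 n = (- 4) powi (- int n) * (\<Sum>i\<le>2*n. zeta_2 i * zeta1_2 (2 * n - i))"
  "sym_31 2 n = (- 4) powi (- int n) * (1/2 * (\<Sum>i\<le>2*n. zeta1_2 i * zeta1_2 (2 * n - i)))"
proof -
  have "(- 4 :: real) powi (- int n) * ((- 4) ^ n * x) = x" for x
    by (simp add: power_int_minus)
  then show "sym_31 0 n = (- 4) powi (- int n) * (\<Sum>i\<le>2*n. zeta_2 i * zeta_2 (2 * n - i))"
    "sym_31 1 n = (- 4) powi (- int n) * (\<Sum>i\<le>2*n. zeta_2 i * zeta1_2 (2 * n - i))"
    "sym_31 2 n = (- 4) powi (- int n) * (1/2 * (\<Sum>i\<le>2*n. zeta1_2 i * zeta1_2 (2 * n - i)))"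
    unfolding sym_31_evaluation[symmetric] by simp_all
qed

lemma powi4_ideal: "x \<in> pi2_ideal \<Longrightarrow> (- 4) powi k * x \<in> pi2_ideal"
  unfolding power_minus4_rat by (rule pi2_ideal_rat)

lemma sym_31_0_cong: "sym_31 0 n - (if n = 0 then 1 else 0) \<in> pi2_ideal"
proof (cases "n = 0")
  case True
  then show ?thesis by (simp add: sym_31_eq zeta_2_0 pi2_ideal_0)
next
  case False
  have "zeta_2 i * zeta_2 (2 * n - i) \<in> pi2_ideal" if "i \<le> 2 * n" for i
  proof (cases "i = 0")
    case True
    have "zeta_2 (2 * n) * zeta_2 0 \<in> pi2_ideal" using False by (intro pi2_ideal_mult zeta_2_in_ideal zeta_2_in_space) simp
    then show ?thesis using True by (simp add: mult.commute)
  next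
    case False
    then show ?thesis by (intro pi2_ideal_mult zeta_2_in_ideal zeta_2_in_space) simp
  qed
  then have "sym_31 0 n \<in> pi2_ideal" unfolding sym_31_eq by (intro powi4_ideal pi2_ideal_sum) simp
  then show ?thesis using False by simp
qed

lemma sym_31_1_cong: "sym_31 1 n - (- (2 * (- 4) powi (- int n) * zeta0 (4 * n + 1))) \<in> pi2_ideal"
proof -
  have "(\<Sum>i\<le>2*n. zeta_2 i * zeta1_2 (2 * n - i)) - zeta1_2_main (2 * n)
      = (zeta1_2 (2 * n) - zeta1_2_main (2 * n)) + (\<Sum>i<2*n. zeta_2 (Suc i) * zeta1_2 (2 * n - Suc i))"
    by (simp add: sum.atMost_shift zeta_2_0)
  also have "\<dots> \<in> pi2_ideal"
    by (intro pi2_ideal_add zeta1_2_cong pi2_ideal_sum pi2_ideal_mult zeta_2_in_ideal zeta1_2_in_space) simp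
  finally have "(- 4) powi (- int n) * ((\<Sum>i\<le>2*n. zeta_2 i * zeta1_2 (2 * n - i)) - zeta1_2_main (2 * n)) \<in> pi2_ideal"
    by (rule powi4_ideal)
  moreover have "zeta1_2_main (2 * n) = - (2 * zeta0 (4 * n + 1))" by (simp add: zeta1_2_main_def)
  ultimately show ?thesis unfolding sym_31_eq by (simp add: algebra_simps)
qed

lemma sym_31_2_cong:
  "sym_31 2 n - 2 * (- 4) powi (- int n) * (\<Sum>(n1, n2) \<in> {(n1, n2). n1 + n2 = 2 * n}. zeta0 (2 * n1 + 1) * zeta0 (2 * n2 + 1)) \<in> pi2_ideal"
proof -
  have set: "{(n1, n2). n1 + n2 = 2 * n} = (\<lambda>i. (i, 2 * n - i)) ` {..2 * n}"
    by (auto simp: image_iff)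
  have "(\<Sum>(n1, n2) \<in> {(n1, n2). n1 + n2 = 2 * n}. zeta0 (2 * n1 + 1) * zeta0 (2 * n2 + 1))
      = (\<Sum>i\<le>2*n. zeta0 (2 * i + 1) * zeta0 (2 * (2 * n - i) + 1))"
    unfolding set by (subst sum.reindex) (auto simp: inj_on_def)
  \<comment> \<open>Each main term is -2 times a sign times a zeta value; the two signs cancel since
    the indices add up to an even number.\<close>
  also have "\<dots> = 1/4 * (\<Sum>i\<le>2*n. zeta1_2_main i * zeta1_2_main (2 * n - i))"
    unfolding sum_distrib_left
  proof (intro sum.cong refl)
    fix i assume "i \<in> {..2 * n}"
    then have "(- 1 :: real) ^ i * (- 1) ^ (2 * n - i) = 1" by (simp flip: power_add)
    then show "zeta0 (2 * i + 1) * zeta0 (2 * (2 * n - i) + 1) = 1/4 * (zeta1_2_main i * zeta1_2_main (2 * n - i))"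
      unfolding zeta1_2_main_def by (simp add: mult.assoc mult.left_commute)
  qed
  finally have z: "2 * (\<Sum>(n1, n2) \<in> {(n1, n2). n1 + n2 = 2 * n}. zeta0 (2 * n1 + 1) * zeta0 (2 * n2 + 1))
      = 1/2 * (\<Sum>i\<le>2*n. zeta1_2_main i * zeta1_2_main (2 * n - i))" by simp
  \<comment> \<open>The difference a b - a' b' is split as (a - a') b + (b - b') a', so that each
    summand has a factor in the ideal.\<close>
  have "(zeta1_2 i - zeta1_2_main i) * zeta1_2 (2 * n - i) + (zeta1_2 (2 * n - i) - zeta1_2_main (2 * n - i)) * zeta1_2_main i \<in> pi2_ideal" for i
    by (intro pi2_ideal_add pi2_ideal_mult zeta1_2_cong zeta1_2_in_space zeta1_2_main_in_space)
  then have "(\<Sum>i\<le>2*n. (zeta1_2 i - zeta1_2_main i) * zeta1_2 (2 * n - i) + (zeta1_2 (2 * n - i) - zeta1_2_main (2 * n - i)) * zeta1_2_main i) \<in> pi2_ideal"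
    by (intro pi2_ideal_sum)
  then have "(- 4) powi (- int n) * (of_rat (1/2) * (\<Sum>i\<le>2*n. (zeta1_2 i - zeta1_2_main i) * zeta1_2 (2 * n - i) + (zeta1_2 (2 * n - i) - zeta1_2_main (2 * n - i)) * zeta1_2_main i)) \<in> pi2_ideal"
    by (intro powi4_ideal pi2_ideal_rat)
  also have "(\<Sum>i\<le>2*n. (zeta1_2 i - zeta1_2_main i) * zeta1_2 (2 * n - i) + (zeta1_2 (2 * n - i) - zeta1_2_main (2 * n - i)) * zeta1_2_main i)
      = (\<Sum>i\<le>2*n. zeta1_2 i * zeta1_2 (2 * n - i)) - (\<Sum>i\<le>2*n. zeta1_2_main i * zeta1_2_main (2 * n - i))"
    unfolding sum_subtractf[symmetric] by (intro sum.cong refl) (simp add: algebra_simps)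
  finally show ?thesis unfolding sym_31_eq mult.assoc[of 2] mult.left_commute[of 2] z
    by (simp add: of_rat_divide right_diff_distrib)
qed

theorem corollary1p4:
  fixes b :: reg and n :: nat
  shows "\<forall>j < 3.
    fps_nth (zeta_S 3 b (concat (replicate n [3, 1]))) j
  - fps_nth
      (fps_const (if n = 0 then 1 else 0)
       - fps_const (2 * (-4) powi (- int n) * zeta0 (4 * n + 1)) * fps_X
       + fps_const (2 * (-4) powi (- int n) *
           (\<Sum>(n1, n2) \<in> {(n1, n2). n1 + n2 = 2 * n}. zeta0 (2 * n1 + 1) * zeta0 (2 * n2 + 1)))
         * fps_X ^ 2) j
    \<in> pi2_ideal"
proof (intro allI impI)
  fix j :: nat assume "j < 3"
  then have sym_31: "fps_nth (zeta_S 3 b (concat (replicate n [3, 1]))) j = sym_31 j n"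
    by (simp only: zeta_S_def fps_cutoff_nth if_True zeta_Shat_nth)
  from \<open>j < 3\<close> consider "j = 0" | "j = 1" | "j = 2" by linarith
  then have "sym_31 j n
  - fps_nth
      (fps_const (if n = 0 then 1 else 0)
       - fps_const (2 * (-4) powi (- int n) * zeta0 (4 * n + 1)) * fps_X
       + fps_const (2 * (-4) powi (- int n) *
           (\<Sum>(n1, n2) \<in> {(n1, n2). n1 + n2 = 2 * n}. zeta0 (2 * n1 + 1) * zeta0 (2 * n2 + 1)))
         * fps_X ^ 2) j
    \<in> pi2_ideal"
  proof cases
    case 1
    then show ?thesis using sym_31_0_cong[of n] by (simp add: fps_X_power_mult_right_nth)
  next
    case 2
    then show ?thesis using sym_31_1_cong[of n] by (simp add: fps_X_power_mult_right_nth)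
  next
    case 3
    then show ?thesis using sym_31_2_cong[of n] by (simp add: fps_X_power_mult_right_nth)
  qed
  then show "fps_nth (zeta_S 3 b (concat (replicate n [3, 1]))) j
  - fps_nth
      (fps_const (if n = 0 then 1 else 0)
       - fps_const (2 * (-4) powi (- int n) * zeta0 (4 * n + 1)) * fps_X
       + fps_const (2 * (-4) powi (- int n) *
           (\<Sum>(n1, n2) \<in> {(n1, n2). n1 + n2 = 2 * n}. zeta0 (2 * n1 + 1) * zeta0 (2 * n2 + 1)))
         * fps_X ^ 2) j
    \<in> pi2_ideal"
    by (simp only: sym_31)
qed

end
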